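(* Let $\mathcal{H}^d_{a,b,n}$, with $n\in\mathbb{N}\cup\{0\}$ and $a,b\in\mathbb{Z}$, denote the $n$-th generalized Hirzebruch fibration $\mathcal{H}^d_n$ over $\mathbb{CP}^d$ with the symplectic form $\omega_{a,b}$, and let $\mathcal{Q}_{a,b,d}(n)$ be the dimension of its quantization space. Then $$\mathcal{Q}_{a,b,d}(n)=\#\big(\Delta^d_{a,b,n}\cap\mathbb{Z}^{d+1}\big)=\sum_{t=0}^{b}\binom{a+n(b-t)+d}{d}=\sum_{i=0}^{b}\binom{a+d+ni}{d}=\mathcal{Q}(\mathbb{CP}^d,\omega_a)+\sum_{i=1}^{b}\binom{a+d+ni}{d},$$ where $\mathcal{Q}(\mathbb{CP}^d,\omega_a)=\binom{a+d}{d}$ is the dimension of the quantization space of $(\mathbb{CP}^d,\omega_a)$, $\omega_a=a\,\omega_{FS}$, and $$\Delta^d_{a,b,n}=\Big\{(x_1,\dots,x_{d+1})\in\mathbb{R}^{d+1}\ \Big|\ x_i\ge 0,\ \sum_{i=1}^d x_i\le a+n(b-x_{d+1}),\ x_{d+1}\le b\Big\}$$ is the moment polytope of $\mathcal{H}^d_{a,b,n}$.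
   Context: The $n$-th generalized Hirzebruch fibration is $\mathcal{H}^d_n:=\mathrm{Proj}(\mathcal{O}\oplus\mathcal{O}(-n))\to\mathbb{CP}^d$, the projectivization of the rank-2 bundle $\mathcal{O}\oplus\mathcal{O}(-n)$ over $\mathbb{CP}^d$, where $\mathcal{O}(n)=\mathcal{O}(1)^{\otimes n}$ and $\mathcal{O}(-n)=\mathcal{O}(n)^*$. Its points are written $([x_0:\dots:x_d],[z_0:z_1])$, where replacing $(x_i)$ by $(\lambda x_i)$, $\lambda\in\mathbb{C}^*$, replaces the fiber coordinates $[z_0:z_1]$ by $[z_0:\lambda^{-n}z_1]$. It is embedded in $\mathbb{CP}^d\times\mathbb{CP}^{d+1}$ by $$\phi([x_0:\dots:x_d],[z_0:z_1])=([x_0:\dots:x_d],[z_0:z_1x_0^n:\dots:z_1x_d^n]).$$ On $\mathbb{CP}^N$ with homogeneous coordinates $[w_0:\dots:w_N]$ the Fubini--Study form is normalized as $\omega_{FS}=i\partial\bar\partial\log\big(\sum_{i=0}^N|w_i|^2\big)$. The form $\omega_{a,b}$ on $\mathcal{H}^d_n$ is the restriction (along $\phi$) of $a\,\omega_{FS}$ on $\mathbb{CP}^d$ plus $b\,\omega_{FS}$ on $\mathbb{CP}^{d+1}$. The quantization space of a symplectic toric manifold whose moment polytope has integer vertices is the space of holomorphic sections of its prequantum line bundle (geometric quantization with respect to the Kähler polarization); its dimension equals the number of integer lattice points of the moment polytope.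
   Formalization: The parameters are taken to be integers a, b ≥ 0 rather than arbitrary integers: if a or b is negative, the set Δ is not the moment polytope (for n = 0, a = 1, b = −1 the form is symplectic but Δ is empty). *)

theory Defs
  imports "HOL-Analysis.Analysis" "HOL-Library.Function_Algebras"
begin

text \<open>
  Complex manifolds below are quotients \<open>\<pi> : X \<rightarrow> M\<close> of an open set \<open>X\<close> of a complex vector
  space (homogeneous coordinates) by a free holomorphic action of a complex torus; points of
  \<open>M\<close> are equivalence classes. Since \<open>\<pi>\<close> is a holomorphic submersion, a function on an open
  part \<open>U\<close> of \<open>M\<close> is holomorphic (smooth) iff its pullback to \<open>X \<inter> \<pi>\<^sup>-\<^sup>1(U)\<close> is, and a
  differential form on \<open>M\<close> is determined by its pullback to \<open>X\<close>. Forms on \<open>M\<close> are therefore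
  represented by their pullbacks to \<open>X\<close>, and are evaluated on tangent vectors of \<open>X\<close>.
\<close>

section \<open>Several complex variables\<close>

definition holomorphic_several_on :: "(complex^'m) set \<Rightarrow> (complex^'m \<Rightarrow> complex) \<Rightarrow> bool" where
  "holomorphic_several_on S f \<longleftrightarrow>
     (\<forall>p\<in>S. \<exists>D. (f has_derivative D) (at p) \<and> (\<forall>c v. D (c *s v) = c * D v))"

text \<open>\<open>C_k_on k S f\<close>: \<open>f\<close> is of class \<open>C\<^sup>k\<close> on the open set \<open>S\<close>.\<close>

primrec C_k_on :: "nat \<Rightarrow> 'v::real_normed_vector set \<Rightarrow> ('v \<Rightarrow> real) \<Rightarrow> bool" where
  "C_k_on 0 S f \<longleftrightarrow> continuous_on S f"
| "C_k_on (Suc k) S f \<longleftrightarrow>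
     (\<forall>p\<in>S. f differentiable (at p)) \<and>
     (\<forall>v. C_k_on k S (\<lambda>p. frechet_derivative f (at p) v))"

definition smooth_fun_on :: "'v::real_normed_vector set \<Rightarrow> ('v \<Rightarrow> real) \<Rightarrow> bool" where
  "smooth_fun_on S f \<longleftrightarrow> (\<forall>k. C_k_on k S f)"

text \<open>The Wirtinger derivatives \<open>\<partial>/\<partial>w\<^sub>j\<close> and \<open>\<partial>/\<partial>w\<^sub>j\<close>-bar.\<close>

definition wirtinger :: "'m::finite \<Rightarrow> (complex^'m \<Rightarrow> complex) \<Rightarrow> complex^'m \<Rightarrow> complex" where
  "wirtinger j f p =
     (frechet_derivative f (at p) (axis j 1) - \<i> * frechet_derivative f (at p) (axis j \<i>)) / 2"

definition wirtinger_bar :: "'m::finite \<Rightarrow> (complex^'m \<Rightarrow> complex) \<Rightarrow> complex^'m \<Rightarrow> complex" where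
  "wirtinger_bar j f p =
     (frechet_derivative f (at p) (axis j 1) + \<i> * frechet_derivative f (at p) (axis j \<i>)) / 2"

text \<open>
  A 2-form on an open subset of \<open>\<complex>\<^sup>m\<close> is a function of a base point and two tangent vectors.
  The form \<open>i \<partial>\<partial>-bar K\<close> of a real function \<open>K\<close>, where
  \<open>(dw\<^sub>j \<and> dw\<^sub>k-bar)(u, v) = u\<^sub>j v\<^sub>k-bar - v\<^sub>j u\<^sub>k-bar\<close>:
\<close>

type_synonym 'm form2 = "complex^'m \<Rightarrow> complex^'m \<Rightarrow> complex^'m \<Rightarrow> complex"

definition i_ddbar :: "(complex^'m \<Rightarrow> real) \<Rightarrow> ('m::finite) form2" where
  "i_ddbar K p u v =
     \<i> * (\<Sum>j\<in>UNIV. \<Sum>k\<in>UNIV.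
        wirtinger j (wirtinger_bar k (\<lambda>q. complex_of_real (K q))) p *
        (u $ j * cnj (v $ k) - v $ j * cnj (u $ k)))"

definition pullback_form ::
  "(complex^'m \<Rightarrow> complex^'k) \<Rightarrow> ('k::finite) form2 \<Rightarrow> ('m::finite) form2" where
  "pullback_form F \<omega> p u v =
     \<omega> (F p) (frechet_derivative F (at p) u) (frechet_derivative F (at p) v)"

section \<open>Line bundles and Kaehler quantization\<close>

text \<open>
  In the following definitions \<open>\<pi> : X \<rightarrow> M\<close> is as explained above and \<open>U\<close> is an open cover of
  \<open>M\<close>. A holomorphic line bundle trivialised over \<open>U\<close> by frames \<open>e\<^sub>i\<close> is given by its
  transition functions \<open>e\<^sub>j = g\<^sub>i\<^sub>j e\<^sub>i\<close>; a section \<open>s\<^sub>i e\<^sub>i\<close> then satisfies \<open>s\<^sub>i = g\<^sub>i\<^sub>j s\<^sub>j\<close>.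
  The covers used are the standard affine ones; their members are biholomorphic to some
  \<open>\<complex>\<^sup>N\<close>, over which every holomorphic line bundle is trivial.
\<close>

definition lift_set :: "(complex^'m) set \<Rightarrow> (complex^'m \<Rightarrow> 'p) \<Rightarrow> 'p set \<Rightarrow> (complex^'m) set" where
  "lift_set X \<pi> A = {p\<in>X. \<pi> p \<in> A}"

definition holomorphic_line_bundle ::
  "(complex^'m) set \<Rightarrow> (complex^'m \<Rightarrow> 'p) \<Rightarrow> ('i \<Rightarrow> 'p set) \<Rightarrow> ('i \<Rightarrow> 'i \<Rightarrow> 'p \<Rightarrow> complex) \<Rightarrow> bool"
  where
  "holomorphic_line_bundle X \<pi> U g \<longleftrightarrow>
     (\<forall>i j. holomorphic_several_on (lift_set X \<pi> (U i \<inter> U j)) (\<lambda>p. g i j (\<pi> p))) \<and>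
     (\<forall>i j. \<forall>P \<in> U i \<inter> U j. g i j P \<noteq> 0) \<and>
     (\<forall>i. \<forall>P \<in> U i. g i i P = 1) \<and>
     (\<forall>i j k. \<forall>P \<in> U i \<inter> U j \<inter> U k. g i j P * g j k P = g i k P)"

text \<open>A smooth Hermitian metric, given by the squared norms \<open>h\<^sub>i = \<bar>e\<^sub>i\<bar>\<^sup>2\<close> of the frames.\<close>

definition hermitian_metric ::
  "(complex^'m) set \<Rightarrow> (complex^'m \<Rightarrow> 'p) \<Rightarrow> ('i \<Rightarrow> 'p set) \<Rightarrow> ('i \<Rightarrow> 'i \<Rightarrow> 'p \<Rightarrow> complex) \<Rightarrow>
   ('i \<Rightarrow> 'p \<Rightarrow> real) \<Rightarrow> bool" where
  "hermitian_metric X \<pi> U g h \<longleftrightarrow>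
     (\<forall>i. smooth_fun_on (lift_set X \<pi> (U i)) (\<lambda>p. h i (\<pi> p))) \<and>
     (\<forall>i. \<forall>P \<in> U i. h i P > 0) \<and>
     (\<forall>i j. \<forall>P \<in> U i \<inter> U j. h j P = (cmod (g i j P))\<^sup>2 * h i P)"

text \<open>
  Prequantum condition: the Chern connection, whose curvature is \<open>F = - \<partial>\<partial>-bar log h\<^sub>i\<close>, has
  \<open>F = - i \<omega>\<close>, i.e. \<open>\<omega> = - i \<partial>\<partial>-bar log h\<^sub>i\<close>.
\<close>

definition prequantum_line_bundle ::
  "(complex^'m) set \<Rightarrow> (complex^'m \<Rightarrow> 'p) \<Rightarrow> ('i \<Rightarrow> 'p set) \<Rightarrow> ('m::finite) form2 \<Rightarrow>
   ('i \<Rightarrow> 'i \<Rightarrow> 'p \<Rightarrow> complex) \<Rightarrow> ('i \<Rightarrow> 'p \<Rightarrow> real) \<Rightarrow> bool" where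
  "prequantum_line_bundle X \<pi> U \<omega> g h \<longleftrightarrow>
     holomorphic_line_bundle X \<pi> U g \<and> hermitian_metric X \<pi> U g h \<and>
     (\<forall>i. \<forall>p \<in> lift_set X \<pi> (U i). \<forall>u v. \<omega> p u v = - i_ddbar (\<lambda>q. ln (h i (\<pi> q))) p u v)"

text \<open>Local representatives are extended by 0, so that a section has a unique representation.\<close>

definition holomorphic_sections ::
  "(complex^'m) set \<Rightarrow> (complex^'m \<Rightarrow> 'p) \<Rightarrow> ('i \<Rightarrow> 'p set) \<Rightarrow> ('i \<Rightarrow> 'i \<Rightarrow> 'p \<Rightarrow> complex) \<Rightarrow>
   ('i \<Rightarrow> 'p \<Rightarrow> complex) set" where
  "holomorphic_sections X \<pi> U g =
     {s. (\<forall>i. holomorphic_several_on (lift_set X \<pi> (U i)) (\<lambda>p. s i (\<pi> p))) \<and>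
         (\<forall>i j. \<forall>P \<in> U i \<inter> U j. s i P = g i j P * s j P) \<and>
         (\<forall>i P. P \<notin> U i \<longrightarrow> s i P = 0)}"

definition scale_section :: "complex \<Rightarrow> ('i \<Rightarrow> 'p \<Rightarrow> complex) \<Rightarrow> 'i \<Rightarrow> 'p \<Rightarrow> complex" where
  "scale_section c s = (\<lambda>i P. c * s i P)"

text \<open>
  \<open>has_quantization_dim X \<pi> U \<omega> q\<close>: the manifold has a prequantum line bundle, and the space of
  holomorphic sections of any prequantum line bundle is of finite dimension \<open>q\<close>. The finite
  spanning set is required separately because \<open>dim\<close> is 0 for infinite-dimensional spaces.
\<close>

definition has_quantization_dim ::
  "(complex^'m) set \<Rightarrow> (complex^'m \<Rightarrow> 'p) \<Rightarrow> ('i \<Rightarrow> 'p set) \<Rightarrow> ('m::finite) form2 \<Rightarrow> nat \<Rightarrow> bool"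
  where
  "has_quantization_dim X \<pi> U \<omega> q \<longleftrightarrow>
     (\<exists>g h. prequantum_line_bundle X \<pi> U \<omega> g h) \<and>
     (\<forall>g h. prequantum_line_bundle X \<pi> U \<omega> g h \<longrightarrow>
        (\<exists>B. finite B \<and> holomorphic_sections X \<pi> U g \<subseteq> module.span scale_section B) \<and>
        vector_space.dim scale_section (holomorphic_sections X \<pi> U g) = q)"

section \<open>Torus actions and moment polytopes\<close>

text \<open>
  Actions of the torus \<open>(\<real>/2\<pi>\<int>)\<^sup>T\<close> are written with angles \<open>\<theta> \<in> \<real>\<^sup>T\<close>. The sign convention is
  \<open>d\<langle>\<mu>, \<xi>\<rangle> = - \<iota>(X\<^sub>\<xi>) \<omega> = \<omega>(\<cdot>, X\<^sub>\<xi>)\<close>, for which rotation of a coordinate \<open>z\<close> with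
  \<open>\<omega> = i dz \<and> dz-bar\<close> has moment map \<open>\<bar>z\<bar>\<^sup>2\<close>.
\<close>

definition fundamental_field ::
  "(real^'t \<Rightarrow> complex^'m \<Rightarrow> complex^'m) \<Rightarrow> real^'t \<Rightarrow> complex^'m \<Rightarrow> complex^'m" where
  "fundamental_field act \<xi> p = vector_derivative (\<lambda>s::real. act (s *\<^sub>R \<xi>) p) (at 0)"

definition is_moment_map ::
  "(complex^'m) set \<Rightarrow> (complex^'m \<Rightarrow> 'p) \<Rightarrow> (real^'t \<Rightarrow> complex^'m \<Rightarrow> complex^'m) \<Rightarrow>
   ('m::finite) form2 \<Rightarrow> ('p \<Rightarrow> real^'t) \<Rightarrow> bool" where
  "is_moment_map X \<pi> act \<omega> \<mu> \<longleftrightarrow>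
     (\<forall>\<xi>. \<forall>p\<in>X. \<exists>D. ((\<lambda>q. \<mu> (\<pi> q) \<bullet> \<xi>) has_derivative D) (at p) \<and>
        (\<forall>v. complex_of_real (D v) = \<omega> p v (fundamental_field act \<xi> p)))"

definition is_moment_polytope ::
  "(complex^'m) set \<Rightarrow> (complex^'m \<Rightarrow> 'p) \<Rightarrow> (real^'t \<Rightarrow> complex^'m \<Rightarrow> complex^'m) \<Rightarrow>
   ('m::finite) form2 \<Rightarrow> (real^'t) set \<Rightarrow> bool" where
  "is_moment_polytope X \<pi> act \<omega> \<Delta> \<longleftrightarrow>
     (\<exists>\<mu>. is_moment_map X \<pi> act \<omega> \<mu> \<and> \<mu> ` (\<pi> ` X) = \<Delta>)"

section \<open>Complex projective space\<close>

text \<open>\<open>CP\<^sup>N\<close> with homogeneous coordinates indexed by a type with \<open>N + 1\<close> elements.\<close>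

definition cp_cone :: "(complex^'m) set" where
  "cp_cone = - {0}"

definition cp_class :: "complex^'m \<Rightarrow> (complex^'m) set" where
  "cp_class w = {c *s w | c. c \<noteq> 0}"

definition cp_chart :: "'m \<Rightarrow> (complex^'m) set set" where
  "cp_chart k = cp_class ` {w \<in> cp_cone. w $ k \<noteq> 0}"

definition fubini_study :: "('m::finite) form2" where
  "fubini_study = i_ddbar (\<lambda>w. ln (\<Sum>k\<in>UNIV. (cmod (w $ k))\<^sup>2))"

definition cp_form :: "int \<Rightarrow> ('m::finite) form2" where
  "cp_form a p u v = of_int a * fubini_study p u v"

section \<open>Generalized Hirzebruch fibrations\<close>

text \<open>
  With \<open>d = CARD('d)\<close>, the index type \<open>'d option\<close> stands for \<open>{0, \<dots>, d}\<close> (\<open>None\<close> is 0) and the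
  type \<open>2\<close> for \<open>{0, 1}\<close>. For \<open>p :: complex^('d option + 2)\<close> the base coordinates are
  \<open>x\<^sub>k = p $ Inl k\<close> and the fibre coordinates are \<open>z\<^sub>0 = p $ Inr 0\<close>, \<open>z\<^sub>1 = p $ Inr 1\<close>.
\<close>

definition hirz_cone :: "(complex^('d::finite option + 2)) set" where
  "hirz_cone = {p. (\<exists>k. p $ Inl k \<noteq> 0) \<and> (\<exists>j. p $ Inr j \<noteq> 0)}"

definition hirz_act ::
  "nat \<Rightarrow> complex \<Rightarrow> complex \<Rightarrow> complex^('d::finite option + 2) \<Rightarrow> complex^('d option + 2)" where
  "hirz_act n l m p = (\<chi> i. case i of
       Inl k \<Rightarrow> l * p $ Inl k
     | Inr j \<Rightarrow> if j = 0 then m * p $ Inr 0 else m * (inverse l ^ n * p $ Inr 1))"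

definition hirz_class ::
  "nat \<Rightarrow> complex^('d::finite option + 2) \<Rightarrow> (complex^('d option + 2)) set" where
  "hirz_class n p = {hirz_act n l m p | l m. l \<noteq> 0 \<and> m \<noteq> 0}"

definition hirz_chart ::
  "nat \<Rightarrow> 'd::finite option \<times> 2 \<Rightarrow> (complex^('d option + 2)) set set" where
  "hirz_chart n c = hirz_class n ` {p \<in> hirz_cone. p $ Inl (fst c) \<noteq> 0 \<and> p $ Inr (snd c) \<noteq> 0}"

text \<open>
  The two components of the embedding \<open>\<phi>\<close> in homogeneous coordinates; on \<open>CP\<^sup>d\<^sup>+\<^sup>1\<close> they are
  indexed by \<open>'d option option\<close>, the first one being \<open>None\<close>.
\<close>

definition phi_base :: "complex^('d::finite option + 2) \<Rightarrow> complex^('d option)" where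
  "phi_base p = (\<chi> k. p $ Inl k)"

definition phi_fibre ::
  "nat \<Rightarrow> complex^('d::finite option + 2) \<Rightarrow> complex^('d option option)" where
  "phi_fibre n p = (\<chi> r. case r of None \<Rightarrow> p $ Inr 0 | Some k \<Rightarrow> p $ Inr 1 * (p $ Inl k) ^ n)"

definition hirz_form :: "nat \<Rightarrow> int \<Rightarrow> int \<Rightarrow> ('d::finite option + 2) form2" where
  "hirz_form n a b p u v =
     pullback_form phi_base (cp_form a) p u v + pullback_form (phi_fibre n) (cp_form b) p u v"

text \<open>
  The torus of dimension \<open>d + 1\<close> has index type \<open>'d + unit\<close>, where \<open>Inr ()\<close> stands for \<open>d + 1\<close>.
  It rotates \<open>x\<^sub>1, \<dots>, x\<^sub>d\<close> and \<open>z\<^sub>0\<close> with weight 1, and fixes \<open>x\<^sub>0\<close> and \<open>z\<^sub>1\<close>.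
\<close>

definition hirz_torus_act ::
  "real^('d + unit) \<Rightarrow> complex^('d::finite option + 2) \<Rightarrow> complex^('d option + 2)" where
  "hirz_torus_act \<theta> p = (\<chi> i. case i of
       Inl None \<Rightarrow> p $ Inl None
     | Inl (Some k) \<Rightarrow> cis (\<theta> $ Inl k) * p $ Inl (Some k)
     | Inr j \<Rightarrow> if j = 0 then cis (\<theta> $ Inr ()) * p $ Inr 0 else p $ Inr 1)"

definition hirz_polytope :: "nat \<Rightarrow> int \<Rightarrow> int \<Rightarrow> (real^('d::finite + unit)) set" where
  "hirz_polytope n a b =
     {x. (\<forall>i. x $ i \<ge> 0) \<and>
         (\<Sum>i\<in>UNIV. x $ Inl i) \<le> of_int a + of_nat n * (of_int b - x $ Inr ()) \<and>
         x $ Inr () \<le> of_int b}"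

definition integer_points :: "(real^'t) set" where
  "integer_points = {x. \<forall>i. x $ i \<in> \<int>}"

text \<open>The binomial coefficient with integer upper index, 0 if the latter is negative.\<close>

definition ichoose :: "int \<Rightarrow> nat \<Rightarrow> nat" where
  "ichoose m k = (if m < 0 then 0 else nat m choose k)"

end

theory Submission
  imports Defs "HOL-Complex_Analysis.Cauchy_Integral_Formula"
begin

text \<open>
  Both manifolds are toric quotients \<open>X \<rightarrow> M\<close> of an open set \<open>X \<subseteq> \<complex>\<^sup>m\<close>, covered by charts on which
  some coordinates do not vanish. Two prequantum line bundles with the same curvature differ by a
  flat Hermitian bundle. The quotient of the two metrics is pluriharmonic in each chart, hence the
  modulus of a nowhere vanishing holomorphic function, so after a change of frames the transition
  functions differ by constants; these form a coboundary because all charts contain the point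
  \<open>(1, \<dots>, 1)\<close>. Hence one may take the standard bundle, whose sections are the holomorphic functions
  on \<open>X\<close> that are homogeneous of the right (bi)degree. By Liouville's theorem in an affine chart
  these are polynomials, so the monomials of that degree form a basis, and they correspond to the
  lattice points of the polytope.

  The moment map is a combination of the coordinates \<open>\<bar>w\<^sub>r\<bar>\<^sup>2 / \<bar>w\<bar>\<^sup>2\<close> of the two projective factors.
  That it fills the polytope is the solvability on the simplex of
  \<open>a P\<^sub>k + s P\<^sub>k\<^sup>n / \<Sum>\<^sub>j P\<^sub>j\<^sup>n = Y\<^sub>k\<close>, with \<open>s = n (b - x\<^sub>d\<^sub>+\<^sub>1)\<close>.
\<close>

section \<open>Smoothness\<close>

text \<open>Since \<open>has_quantization_dim\<close> speaks of all prequantum bundles and all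
  metrics, computing the sections of one explicit bundle is not enough: the dimension has to be
  carried over to every other bundle, and this is what the uniqueness argument is for. Its obstacle
  is topological: the preimage of a chart is a product of complex and punctured complex lines, where
  a pluriharmonic function need not be a real part. It is overcome by descending to the slice on
  which the distinguished coordinates are 1. The second obstacle is that
  \<open>frechet_derivative\<close>, and with it \<open>i_ddbar\<close>, is a total function.
  Identities between curvature forms therefore carry a proof that the potential is twice
  differentiable near the point, recorded by \<open>has_ddbar\<close>. On the Hirzebruch fibration
  Liouville's theorem is applied twice: along a fibre, and then to the coefficients of the resulting
  polynomial in \<open>z_0, z_1\<close> as functions on the base. The twist by O(-n) makes the
  coefficient of \<open>z_1^j\<close> homogeneous of degree \<open>A + n * j\<close>, which is the
  origin of the summands of the formula.\<close>

lemma C_k_on_cong: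
  assumes "open S" "\<And>p. p \<in> S \<Longrightarrow> f p = g p"
  shows "C_k_on k S f \<longleftrightarrow> C_k_on k S g"
proof -
  have "C_k_on k S g" if "open S" "\<And>p. p \<in> S \<Longrightarrow> f p = g p" "C_k_on k S f" for f g :: "'a \<Rightarrow> real"
    using that
  proof (induction k arbitrary: f g)
    case 0
    then show ?case using continuous_on_eq by (auto cong: continuous_on_cong)
  next
    case (Suc k)
    have d: "g differentiable at p" if "p \<in> S" for p
    proof -
      have "f differentiable at p" using Suc.prems(3) that by simp
      then obtain D where "(f has_derivative D) (at p)" unfolding differentiable_def by blast
      then have "(g has_derivative D) (at p)"
        using has_derivative_transform_within_open[OF _ Suc.prems(1) that] Suc.prems(2) by blast
      then show ?thesis unfolding differentiable_def by blast
    qed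
    have "C_k_on k S (\<lambda>p. frechet_derivative g (at p) v)" for v
    proof (rule Suc.IH[OF Suc.prems(1)])
      show "C_k_on k S (\<lambda>p. frechet_derivative f (at p) v)" using Suc.prems(3) by simp
      show "frechet_derivative f (at p) v = frechet_derivative g (at p) v" if "p \<in> S" for p
        using frechet_derivative_transform_within_open[of f p S g] Suc.prems that by auto
    qed
    then show ?case using d by simp
  qed
  then show ?thesis using assms by metis
qed

lemma C_k_on_SucD: "C_k_on (Suc k) S f \<Longrightarrow> C_k_on k S f"
proof (induction k arbitrary: f)
  case 0
  then show ?case
    by (auto intro!: continuous_at_imp_continuous_on differentiable_imp_continuous_within)
next
  case (Suc k)
  then show ?case by auto
qed

lemma C_k_on_subset: "C_k_on k S f \<Longrightarrow> T \<subseteq> S \<Longrightarrow> C_k_on k T f"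
  by (induction k arbitrary: f) (auto intro: continuous_on_subset)

text \<open>\<open>C_k_on\<close> is phrased with \<open>frechet_derivative\<close>; this rule and
  \<open>C_k_on_SucE\<close> exchange it for an arbitrary family \<open>D\<close> of derivatives, to
  which the rules of calculus apply directly.\<close>

lemma C_k_on_SucI:
  assumes "open S" "\<And>p. p \<in> S \<Longrightarrow> (f has_derivative D p) (at p)" "\<And>v. C_k_on k S (\<lambda>p. D p v)"
  shows "C_k_on (Suc k) S f"
proof -
  have fd: "frechet_derivative f (at p) = D p" if "p \<in> S" for p
    using frechet_derivative_at[OF assms(2)[OF that]] by simp
  have "C_k_on k S (\<lambda>p. frechet_derivative f (at p) v)" for v
    using assms(3)[of v] C_k_on_cong[OF assms(1), of "\<lambda>p. frechet_derivative f (at p) v" "\<lambda>p. D p v"]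
    by (simp add: fd)
  then show ?thesis using assms(2) by (auto simp: differentiable_def)
qed

lemma C_k_on_SucE:
  assumes "C_k_on (Suc k) S f"
  obtains D where "\<And>p. p \<in> S \<Longrightarrow> (f has_derivative D p) (at p)" "\<And>v. C_k_on k S (\<lambda>p. D p v)"
proof
  show "(f has_derivative frechet_derivative f (at p)) (at p)" if "p \<in> S" for p
    using assms that frechet_derivative_works by auto
  show "C_k_on k S (\<lambda>p. frechet_derivative f (at p) v)" for v using assms by simp
qed

lemma C_k_on_const: "C_k_on k S (\<lambda>_. c)"
  by (induction k arbitrary: c) auto

lemma C_k_on_bounded_linear:
  assumes "open S" "bounded_linear f" shows "C_k_on k S f"
proof (cases k)
  case 0
  then show ?thesis using assms by (auto simp: linear_continuous_on)
next
  case (Suc k')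
  show ?thesis unfolding Suc
    by (rule C_k_on_SucI[where D="\<lambda>_. f"])
       (auto intro: assms bounded_linear_imp_has_derivative C_k_on_const)
qed

lemma C_k_on_add:
  assumes "open S" shows "C_k_on k S f \<Longrightarrow> C_k_on k S g \<Longrightarrow> C_k_on k S (\<lambda>p. f p + g p)"
proof (induction k arbitrary: f g)
  case 0
  then show ?case by (auto intro: continuous_intros)
next
  case (Suc k)
  obtain D where D: "\<And>p. p \<in> S \<Longrightarrow> (f has_derivative D p) (at p)" "\<And>v. C_k_on k S (\<lambda>p. D p v)"
    using C_k_on_SucE[OF Suc.prems(1)] by blast
  obtain E where E: "\<And>p. p \<in> S \<Longrightarrow> (g has_derivative E p) (at p)" "\<And>v. C_k_on k S (\<lambda>p. E p v)"
    using C_k_on_SucE[OF Suc.prems(2)] by blast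
  show ?case
    by (rule C_k_on_SucI[where D="\<lambda>p v. D p v + E p v", OF assms])
       (auto intro!: has_derivative_add D E Suc.IH)
qed

lemma C_k_on_mult:
  assumes "open S" shows "C_k_on k S f \<Longrightarrow> C_k_on k S g \<Longrightarrow> C_k_on k S (\<lambda>p. f p * g p)"
proof (induction k arbitrary: f g)
  case 0
  then show ?case by (auto intro: continuous_intros)
next
  case (Suc k)
  obtain D where D: "\<And>p. p \<in> S \<Longrightarrow> (f has_derivative D p) (at p)" "\<And>v. C_k_on k S (\<lambda>p. D p v)"
    using C_k_on_SucE[OF Suc.prems(1)] by blast
  obtain E where E: "\<And>p. p \<in> S \<Longrightarrow> (g has_derivative E p) (at p)" "\<And>v. C_k_on k S (\<lambda>p. E p v)"
    using C_k_on_SucE[OF Suc.prems(2)] by blast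
  show ?case
    by (rule C_k_on_SucI[where D="\<lambda>p v. f p * E p v + D p v * g p", OF assms])
       (auto intro!: has_derivative_mult D E Suc.IH C_k_on_add assms C_k_on_SucD[OF Suc.prems(1)]
          C_k_on_SucD[OF Suc.prems(2)])
qed

lemma C_k_on_cmult: "open S \<Longrightarrow> C_k_on k S f \<Longrightarrow> C_k_on k S (\<lambda>p. c * f p)"
  by (intro C_k_on_mult C_k_on_const)

lemma C_k_on_power: "open S \<Longrightarrow> C_k_on k S f \<Longrightarrow> C_k_on k S (\<lambda>p. f p ^ n)"
  by (induction n) (auto intro: C_k_on_mult C_k_on_const)

lemma C_k_on_sum: "open S \<Longrightarrow> (\<And>i. i \<in> I \<Longrightarrow> C_k_on k S (f i)) \<Longrightarrow> C_k_on k S (\<lambda>p. \<Sum>i\<in>I. f i p)"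
  by (induction I rule: infinite_finite_induct) (auto intro: C_k_on_add C_k_on_const)

text \<open>The derivative of 1/f contains 1/f again, but with one order of smoothness less to be
  shown; the induction on k runs on this.\<close>

lemma C_k_on_inverse:
  assumes "open S" "\<And>p. p \<in> S \<Longrightarrow> f p \<noteq> 0"
  shows "C_k_on k S f \<Longrightarrow> C_k_on k S (\<lambda>p. inverse (f p))"
proof (induction k)
  case 0
  then show ?case using assms by (auto intro: continuous_intros)
next
  case (Suc k)
  obtain D where D: "\<And>p. p \<in> S \<Longrightarrow> (f has_derivative D p) (at p)" "\<And>v. C_k_on k S (\<lambda>p. D p v)"
    using C_k_on_SucE[OF Suc.prems(1)] by blast
  have IH: "C_k_on k S (\<lambda>p. inverse (f p))" using Suc.IH C_k_on_SucD[OF Suc.prems] by blast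
  show ?case
  proof (rule C_k_on_SucI[where D="\<lambda>p v. (-1) * (inverse (f p) * D p v * inverse (f p))", OF assms(1)])
    show "((\<lambda>p. inverse (f p)) has_derivative (\<lambda>v. (-1) * (inverse (f p) * D p v * inverse (f p)))) (at p)"
      if "p \<in> S" for p
      using Deriv.has_derivative_inverse[OF assms(2)[OF that] D(1)[OF that]] by simp
  qed (intro C_k_on_cmult C_k_on_mult assms IH D)
qed

text \<open>One differentiation removes the logarithm and leaves a quotient, so a case distinction
  on k takes the place of an induction.\<close>

lemma C_k_on_ln:
  assumes "open S" "\<And>p. p \<in> S \<Longrightarrow> f p > 0" "C_k_on k S f"
  shows "C_k_on k S (\<lambda>p. ln (f p))"
proof (cases k)
  case 0
  then show ?thesis using assms by (auto intro!: continuous_on_ln simp: less_le)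
next
  case (Suc k')
  obtain D where D: "\<And>p. p \<in> S \<Longrightarrow> (f has_derivative D p) (at p)" "\<And>v. C_k_on k' S (\<lambda>p. D p v)"
    using C_k_on_SucE assms(3) Suc by blast
  have IH: "C_k_on k' S (\<lambda>p. inverse (f p))"
    using C_k_on_inverse[of S f k'] C_k_on_SucD[of k' S f] assms Suc by (simp add: less_le)
  show ?thesis unfolding Suc
  proof (rule C_k_on_SucI[where D="\<lambda>p v. D p v * inverse (f p)", OF assms(1)])
    show "((\<lambda>p. ln (f p)) has_derivative (\<lambda>v. D p v * inverse (f p))) (at p)" if "p \<in> S" for p
      using has_derivative_ln[OF assms(2)[OF that] D(1)[OF that]] by (simp add: mult.commute)
  qed (intro C_k_on_mult assms IH D)
qed

lemma C_k_on_cmod_coordinate_sq: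
  fixes S :: "(complex^'m) set"
  assumes "open S" shows "C_k_on k S (\<lambda>p. (cmod (p $ c))\<^sup>2)"
proof -
  have "bounded_linear (\<lambda>p::complex^'m. Re (p $ c))" "bounded_linear (\<lambda>p::complex^'m. Im (p $ c))"
    by (intro bounded_linear_compose[OF bounded_linear_Re] bounded_linear_compose[OF bounded_linear_Im]
      bounded_linear_vec_nth)+
  then show ?thesis unfolding cmod_power2
    by (intro C_k_on_add C_k_on_power C_k_on_bounded_linear assms)
qed

section \<open>Holomorphic functions of several variables\<close>

lemma holomorphic_several_onI:
  assumes "\<And>p. p \<in> S \<Longrightarrow> (f has_derivative D p) (at p)" "\<And>p c v. p \<in> S \<Longrightarrow> D p (c *s v) = c * D p v"
  shows "holomorphic_several_on S f"
  using assms unfolding holomorphic_several_on_def by metis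

lemma holomorphic_several_onE:
  assumes "holomorphic_several_on S f"
  obtains D where "\<And>p. p \<in> S \<Longrightarrow> (f has_derivative D p) (at p)" "\<And>p c v. p \<in> S \<Longrightarrow> D p (c *s v) = c * D p v"
proof -
  have "\<exists>D. \<forall>p\<in>S. (f has_derivative D p) (at p) \<and> (\<forall>c v. D p (c *s v) = c * D p v)"
    using assms unfolding holomorphic_several_on_def by (rule bchoice)
  then show thesis using that by blast
qed

lemma holomorphic_several_on_subset:
  "holomorphic_several_on S f \<Longrightarrow> T \<subseteq> S \<Longrightarrow> holomorphic_several_on T f"
  unfolding holomorphic_several_on_def by blast

lemma holomorphic_several_on_cong:
  assumes "open S" "\<And>p. p \<in> S \<Longrightarrow> f p = g p" "holomorphic_several_on S f"
  shows "holomorphic_several_on S g"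
proof -
  obtain D where D: "\<And>p. p \<in> S \<Longrightarrow> (f has_derivative D p) (at p)"
    "\<And>p c v. p \<in> S \<Longrightarrow> D p (c *s v) = c * D p v"
    using assms(3) holomorphic_several_onE by blast
  show ?thesis
  proof (rule holomorphic_several_onI)
    show "(g has_derivative D p) (at p)" if "p \<in> S" for p
      using has_derivative_transform_within_open[OF D(1)[OF that] assms(1) that] assms(2) by blast
  qed (rule D(2))
qed

lemma holomorphic_several_on_imp_continuous_on:
  "holomorphic_several_on S f \<Longrightarrow> continuous_on S f"
  unfolding holomorphic_several_on_def
  by (meson continuous_at_imp_continuous_on has_derivative_continuous)

lemma holomorphic_several_on_const: "holomorphic_several_on S (\<lambda>_. c)"
  by (rule holomorphic_several_onI[where D="\<lambda>_ _. 0"]) auto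

lemma holomorphic_several_on_coordinate: "holomorphic_several_on S (\<lambda>p. p $ j)"
  by (rule holomorphic_several_onI[where D="\<lambda>_ v. v $ j"])
     (auto intro!: bounded_linear_imp_has_derivative bounded_linear_vec_nth)

lemma holomorphic_several_on_add:
  assumes "holomorphic_several_on S f" "holomorphic_several_on S g"
  shows "holomorphic_several_on S (\<lambda>p. f p + g p)"
proof -
  obtain D where D: "\<And>p. p \<in> S \<Longrightarrow> (f has_derivative D p) (at p)"
    "\<And>p c v. p \<in> S \<Longrightarrow> D p (c *s v) = c * D p v"
    using assms(1) holomorphic_several_onE by blast
  obtain E where E: "\<And>p. p \<in> S \<Longrightarrow> (g has_derivative E p) (at p)"
    "\<And>p c v. p \<in> S \<Longrightarrow> E p (c *s v) = c * E p v"
    using assms(2) holomorphic_several_onE by blast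
  show ?thesis
    by (rule holomorphic_several_onI[where D="\<lambda>p v. D p v + E p v"])
       (auto intro!: has_derivative_add D(1) E(1) simp: D(2) E(2) algebra_simps)
qed

lemma holomorphic_several_on_mult:
  assumes "holomorphic_several_on S f" "holomorphic_several_on S g"
  shows "holomorphic_several_on S (\<lambda>p. f p * g p)"
proof -
  obtain D where D: "\<And>p. p \<in> S \<Longrightarrow> (f has_derivative D p) (at p)"
    "\<And>p c v. p \<in> S \<Longrightarrow> D p (c *s v) = c * D p v"
    using assms(1) holomorphic_several_onE by blast
  obtain E where E: "\<And>p. p \<in> S \<Longrightarrow> (g has_derivative E p) (at p)"
    "\<And>p c v. p \<in> S \<Longrightarrow> E p (c *s v) = c * E p v"
    using assms(2) holomorphic_several_onE by blast
  show ?thesis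
    by (rule holomorphic_several_onI[where D="\<lambda>p v. f p * E p v + D p v * g p"],
        rule has_derivative_mult[OF D(1) E(1)]) (auto simp: D(2) E(2) algebra_simps)
qed

lemma holomorphic_several_on_sum:
  "(\<And>i. i \<in> I \<Longrightarrow> holomorphic_several_on S (f i)) \<Longrightarrow> holomorphic_several_on S (\<lambda>p. \<Sum>i\<in>I. f i p)"
  by (induction I rule: infinite_finite_induct)
     (auto intro: holomorphic_several_on_add holomorphic_several_on_const)

lemma holomorphic_several_on_prod:
  "(\<And>i. i \<in> I \<Longrightarrow> holomorphic_several_on S (f i)) \<Longrightarrow> holomorphic_several_on S (\<lambda>p. \<Prod>i\<in>I. f i p)"
  by (induction I rule: infinite_finite_induct)
     (auto intro: holomorphic_several_on_mult holomorphic_several_on_const)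

lemma holomorphic_several_on_power:
  "holomorphic_several_on S f \<Longrightarrow> holomorphic_several_on S (\<lambda>p. f p ^ n)"
  by (induction n) (auto intro: holomorphic_several_on_mult holomorphic_several_on_const)

lemma holomorphic_several_on_compose_field:
  assumes "holomorphic_several_on S f" "\<And>p. p \<in> S \<Longrightarrow> g field_differentiable at (f p)"
  shows "holomorphic_several_on S (\<lambda>p. g (f p))"
proof -
  obtain D where D: "\<And>p. p \<in> S \<Longrightarrow> (f has_derivative D p) (at p)"
    "\<And>p c v. p \<in> S \<Longrightarrow> D p (c *s v) = c * D p v"
    using assms(1) holomorphic_several_onE by blast
  show ?thesis
  proof (rule holomorphic_several_onI[where D="\<lambda>p v. deriv g (f p) * D p v"])
    show "((\<lambda>p. g (f p)) has_derivative (\<lambda>v. deriv g (f p) * D p v)) (at p)" if "p \<in> S" for p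
      using has_derivative_compose[OF D(1)[OF that], of g "\<lambda>x. deriv g (f p) * x"]
        field_differentiable_derivI[OF assms(2)[OF that]] by (simp add: has_field_derivative_def)
  qed (auto simp: D(2) algebra_simps)
qed

lemma holomorphic_several_on_inverse:
  assumes "holomorphic_several_on S f" "\<And>p. p \<in> S \<Longrightarrow> f p \<noteq> 0"
  shows "holomorphic_several_on S (\<lambda>p. inverse (f p))"
proof (rule holomorphic_several_on_compose_field[where g=inverse, OF assms(1)])
  show "inverse field_differentiable at (f p)" if "p \<in> S" for p
    using field_differentiable_inverse[OF field_differentiable_ident] assms(2)[OF that] by blast
qed

lemma holomorphic_several_on_divide:
  assumes "holomorphic_several_on S f" "holomorphic_several_on S g" "\<And>p. p \<in> S \<Longrightarrow> g p \<noteq> 0"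
  shows "holomorphic_several_on S (\<lambda>p. f p / g p)"
  unfolding divide_inverse
  by (rule holomorphic_several_on_mult[OF assms(1) holomorphic_several_on_inverse[OF assms(2,3)]])

lemma holomorphic_several_on_exp:
  "holomorphic_several_on S f \<Longrightarrow> holomorphic_several_on S (\<lambda>p. exp (f p))"
  using holomorphic_several_on_compose_field[where g=exp] field_differentiable_within_exp by blast

text \<open>Differentiability is tested against the real basis vectors \<open>axis i u\<close>, each
  of which sees the component i only.\<close>

lemma has_derivative_vec_lambda:
  assumes "\<And>i. ((\<lambda>p. F p $ i) has_derivative (\<lambda>v. D v $ i)) (at p)"
  shows "(F has_derivative (D :: 'a::real_normed_vector \<Rightarrow> complex^'k)) (at p)"
  unfolding has_derivative_componentwise_within[of F]
proof
  fix b :: "complex^'k" assume "b \<in> Basis"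
  then obtain i u where b: "b = axis i u" by (auto simp: Basis_vec_def)
  show "((\<lambda>p. F p \<bullet> b) has_derivative (\<lambda>v. D v \<bullet> b)) (at p)"
    unfolding b inner_axis by (rule bounded_linear.has_derivative[OF bounded_linear_inner_left assms])
qed

lemma holomorphic_several_on_compose:
  fixes F :: "complex^'m \<Rightarrow> complex^'k"
  assumes "holomorphic_several_on T f" "\<And>p. p \<in> S \<Longrightarrow> F p \<in> T"
    "\<And>k. holomorphic_several_on S (\<lambda>p. F p $ k)"
  shows "holomorphic_several_on S (\<lambda>p. f (F p))"
  unfolding holomorphic_several_on_def
proof
  fix p assume p: "p \<in> S"
  have "\<forall>k. \<exists>D. ((\<lambda>p. F p $ k) has_derivative D) (at p) \<and> (\<forall>c v. D (c *s v) = c * D v)"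
    using assms(3) p unfolding holomorphic_several_on_def by blast
  then obtain D where D: "\<And>k. ((\<lambda>p. F p $ k) has_derivative D k) (at p)"
    "\<And>k c v. D k (c *s v) = c * D k v" by metis
  have F: "(F has_derivative (\<lambda>v. \<chi> k. D k v)) (at p)"
    by (rule has_derivative_vec_lambda) (simp add: D(1))
  obtain E where E: "(f has_derivative E) (at (F p))" "\<And>c v. E (c *s v) = c * E v"
    using assms(1) assms(2)[OF p] unfolding holomorphic_several_on_def by blast
  have "(\<chi> k. D k (c *s v)) = c *s (\<chi> k. D k v)" for c v by (simp add: vec_eq_iff D(2))
  then show "\<exists>D. ((\<lambda>p. f (F p)) has_derivative D) (at p) \<and> (\<forall>c v. D (c *s v) = c * D v)"
    using has_derivative_compose[OF F E(1)] E(2) by auto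
qed

section \<open>Explicit partial derivatives\<close>

definition has_partials_on ::
  "(complex^'m) set \<Rightarrow> (complex^'m \<Rightarrow> complex) \<Rightarrow> ('m::finite \<Rightarrow> complex^'m \<Rightarrow> complex) \<Rightarrow> bool" where
  "has_partials_on S f f' \<longleftrightarrow> (\<forall>p\<in>S. (f has_derivative (\<lambda>v. \<Sum>j\<in>UNIV. v $ j * f' j p)) (at p))"

text \<open>Sums \<open>v\<^sub>1 f'\<^sub>1 + \<dots>\<close> of this shape are the complex linear functionals, so \<open>has_partials_on\<close> and
  \<open>holomorphic_several_on\<close> differ only in naming the derivative.\<close>

lemma holomorphic_several_on_iff_partials:
  "holomorphic_several_on S f \<longleftrightarrow> (\<exists>f'. has_partials_on S f f')"
proof
  assume "holomorphic_several_on S f"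
  then obtain D where D: "\<And>p. p \<in> S \<Longrightarrow> (f has_derivative D p) (at p)"
    "\<And>p c v. p \<in> S \<Longrightarrow> D p (c *s v) = c * D p v"
    using holomorphic_several_onE by blast
  have "D p v = (\<Sum>j\<in>UNIV. v $ j * D p (axis j 1))" if "p \<in> S" for p v
  proof -
    have l: "linear (D p)" using D(1)[OF that] has_derivative_linear by blast
    have "D p v = D p (\<Sum>j\<in>UNIV. (v $ j) *s axis j 1)" by (simp add: basis_expansion)
    also have "\<dots> = (\<Sum>j\<in>UNIV. D p ((v $ j) *s axis j 1))" by (rule linear_sum[OF l])
    finally show ?thesis using D(2) that by simp
  qed
  then have "(\<lambda>v. \<Sum>j\<in>UNIV. v $ j * D p (axis j 1)) = D p" if "p \<in> S" for p using that by auto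
  then have "has_partials_on S f (\<lambda>j p. D p (axis j 1))"
    unfolding has_partials_on_def using D(1) by simp
  then show "\<exists>f'. has_partials_on S f f'" by blast
next
  assume "\<exists>f'. has_partials_on S f f'"
  then obtain f' where f': "has_partials_on S f f'" by blast
  show "holomorphic_several_on S f"
    by (rule holomorphic_several_onI[where D="\<lambda>p v. \<Sum>j\<in>UNIV. v $ j * f' j p"])
       (use f' in \<open>auto simp: has_partials_on_def sum_distrib_left mult.assoc\<close>)
qed

text \<open>The form \<open>i_ddbar\<close> of the logarithm of a sum of squares involves
  derivatives of the first partials of the terms. For the polynomial maps considered here closure
  under products supplies them.\<close>

definition holomorphic2_on :: "(complex^'m) set \<Rightarrow> (complex^'m::finite \<Rightarrow> complex) \<Rightarrow> bool" where
  "holomorphic2_on S f \<longleftrightarrow> (\<exists>f'. has_partials_on S f f' \<and> (\<forall>j. holomorphic_several_on S (f' j)))"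

lemma holomorphic2_on_imp: "holomorphic2_on S f \<Longrightarrow> holomorphic_several_on S f"
  unfolding holomorphic2_on_def holomorphic_several_on_iff_partials by blast

lemma holomorphic2_on_const: "holomorphic2_on S (\<lambda>_. c)"
  unfolding holomorphic2_on_def has_partials_on_def
  by (rule exI[of _ "\<lambda>_ _. 0"]) (auto intro: holomorphic_several_on_const)

lemma holomorphic2_on_coordinate: "holomorphic2_on S (\<lambda>p. p $ i)"
  unfolding holomorphic2_on_def has_partials_on_def
proof (intro exI[of _ "\<lambda>j _. of_bool (j = i)"] conjI ballI allI)
  show "((\<lambda>p. p $ i) has_derivative (\<lambda>v. \<Sum>j\<in>UNIV. v $ j * of_bool (j = i))) (at p)" for p :: "complex^'a"
  proof -
    have "(\<Sum>j\<in>UNIV. v $ j * of_bool (j = i)) = (\<Sum>j\<in>UNIV. if j = i then v $ j else 0)" for v :: "complex^'a"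
      by (intro sum.cong) auto
    then show ?thesis by (simp add: bounded_linear_imp_has_derivative[OF bounded_linear_vec_nth])
  qed
qed (rule holomorphic_several_on_const)

lemma holomorphic2_on_mult:
  assumes "holomorphic2_on S f" "holomorphic2_on S g"
  shows "holomorphic2_on S (\<lambda>p. f p * g p)"
proof -
  obtain f' where f': "has_partials_on S f f'" "\<And>j. holomorphic_several_on S (f' j)"
    using assms unfolding holomorphic2_on_def by blast
  obtain g' where g': "has_partials_on S g g'" "\<And>j. holomorphic_several_on S (g' j)"
    using assms unfolding holomorphic2_on_def by blast
  have "has_partials_on S (\<lambda>p. f p * g p) (\<lambda>j p. f p * g' j p + f' j p * g p)"
    unfolding has_partials_on_def
  proof
    fix p assume p: "p \<in> S"
    have "((\<lambda>p. f p * g p) has_derivative (\<lambda>v. f p * (\<Sum>j\<in>UNIV. v $ j * g' j p) + (\<Sum>j\<in>UNIV. v $ j * f' j p) * g p)) (at p)"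
      using f'(1) g'(1) p unfolding has_partials_on_def by (intro has_derivative_mult) auto
    then show "((\<lambda>p. f p * g p) has_derivative (\<lambda>v. \<Sum>j\<in>UNIV. v $ j * (f p * g' j p + f' j p * g p))) (at p)"
      by (simp add: sum_distrib_left sum_distrib_right sum.distrib algebra_simps)
  qed
  moreover have "holomorphic_several_on S (\<lambda>p. f p * g' j p + f' j p * g p)" for j
    by (intro holomorphic_several_on_add holomorphic_several_on_mult f' g' holomorphic2_on_imp assms)
  ultimately show ?thesis unfolding holomorphic2_on_def by blast
qed

lemma holomorphic2_on_power: "holomorphic2_on S f \<Longrightarrow> holomorphic2_on S (\<lambda>p. f p ^ n)"
  by (induction n) (auto intro: holomorphic2_on_mult holomorphic2_on_const)

section \<open>Monomials\<close>

definition cmonom :: "('m::finite \<Rightarrow> nat) \<Rightarrow> complex^'m \<Rightarrow> complex" where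
  "cmonom \<beta> p = (\<Prod>c\<in>UNIV. (p $ c) ^ \<beta> c)"

lemma holomorphic_several_on_cmonom: "holomorphic_several_on S (cmonom \<beta>)"
proof -
  have "holomorphic_several_on S (\<lambda>p. cmonom \<beta> p)" unfolding cmonom_def
    by (intro holomorphic_several_on_prod holomorphic_several_on_power holomorphic_several_on_coordinate)
  then show ?thesis by simp
qed

text \<open>Artin's independence of characters, applied to the monomials on the torus \<open>(\<complex>\<^sup>*)\<^sup>m\<close>.\<close>

lemma cmonom_independent:
  fixes E :: "('m::finite \<Rightarrow> nat) set"
  assumes "finite E" "\<And>p. (\<And>c. p $ c \<noteq> 0) \<Longrightarrow> (\<Sum>\<beta>\<in>E. a \<beta> * cmonom \<beta> p) = 0" "\<beta> \<in> E"
  shows "a \<beta> = 0"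
  using assms
proof (induction E arbitrary: a \<beta> rule: finite_induct)
  case empty
  then show ?case by simp
next
  case (insert \<gamma> E)
  have mm: "cmonom \<beta> (\<chi> c. p $ c * q $ c) = cmonom \<beta> p * cmonom \<beta> q" for \<beta> :: "'m \<Rightarrow> nat" and p q
    by (simp add: cmonom_def power_mult_distrib prod.distrib)
  have E0: "a \<beta> = 0" if \<beta>: "\<beta> \<in> E" for \<beta>
  proof -
    have "\<beta> \<noteq> \<gamma>" using \<beta> insert.hyps by auto
    then obtain c where c: "\<beta> c \<noteq> \<gamma> c" by auto
    \<comment> \<open>A character value that separates \<open>\<beta>\<close> from
      \<open>\<gamma>\<close>: it is 2 to the exponent of c. Taking the relation at the product of p
      and q, and subtracting \<open>cmonom \<gamma> q\<close> times the relation at p, eliminates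
      \<open>\<gamma>\<close>.\<close>
    define q :: "complex^'m" where "q = (\<chi> i. if i = c then 2 else 1)"
    have q: "cmonom \<delta> q = 2 ^ \<delta> c" for \<delta>
    proof -
      have "cmonom \<delta> q = (\<Prod>i\<in>UNIV. if i = c then 2 ^ \<delta> c else 1)"
        unfolding cmonom_def q_def by (intro prod.cong) auto
      then show ?thesis by simp
    qed
    have "(\<Sum>\<delta>\<in>E. (a \<delta> * (cmonom \<delta> q - cmonom \<gamma> q)) * cmonom \<delta> p) = 0"
      if p: "\<And>i. p $ i \<noteq> 0" for p
    proof -
      have "(\<Sum>\<delta>\<in>insert \<gamma> E. a \<delta> * cmonom \<delta> (\<chi> i. q $ i * p $ i)) = 0"
        by (rule insert.prems(1)) (use p in \<open>auto simp: q_def\<close>)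
      then have "(\<Sum>\<delta>\<in>insert \<gamma> E. a \<delta> * cmonom \<delta> q * cmonom \<delta> p) = 0" by (simp add: mm mult.assoc)
      moreover have "(\<Sum>\<delta>\<in>insert \<gamma> E. a \<delta> * cmonom \<delta> p) * cmonom \<gamma> q = 0"
        using insert.prems(1)[OF p] by simp
      ultimately have "(\<Sum>\<delta>\<in>insert \<gamma> E. (a \<delta> * (cmonom \<delta> q - cmonom \<gamma> q)) * cmonom \<delta> p) = 0"
        unfolding sum_distrib_right by (simp add: sum_subtractf algebra_simps)
      then show ?thesis using insert.hyps by simp
    qed
    then have "a \<beta> * (cmonom \<beta> q - cmonom \<gamma> q) = 0"
      using insert.IH[of "\<lambda>\<delta>. a \<delta> * (cmonom \<delta> q - cmonom \<gamma> q)"] \<beta> by blast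
    moreover have "(2::complex) ^ \<beta> c \<noteq> 2 ^ \<gamma> c"
    proof
      assume "(2::complex) ^ \<beta> c = 2 ^ \<gamma> c"
      then have "of_nat (2 ^ \<beta> c) = (of_nat (2 ^ \<gamma> c) :: complex)" by simp
      then show False using c unfolding of_nat_eq_iff by simp
    qed
    ultimately show ?thesis by (simp add: q)
  qed
  moreover have "a \<gamma> = 0"
    using insert.prems(1)[of "\<chi> i. 1"] E0 insert.hyps by (simp add: cmonom_def)
  ultimately show ?case using insert.prems(2) by auto
qed

section \<open>The form \<open>i \<partial>\<partial>-bar ln\<close> of a sum of squares\<close>

text \<open>P is the complex linear and Q the antilinear part of the derivative; each Wirtinger
  operator kills one of them.\<close>

lemma wirtinger_split:
  assumes "(f has_derivative (\<lambda>v. P v + Q v)) (at p)"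
    "P (axis j \<i>) = \<i> * P (axis j 1)" "Q (axis j \<i>) = - \<i> * Q (axis j 1)"
  shows "wirtinger j f p = P (axis j 1)" "wirtinger_bar j f p = Q (axis j 1)"
proof -
  have fd: "frechet_derivative f (at p) = (\<lambda>v. P v + Q v)" using frechet_derivative_at[OF assms(1)] by simp
  show "wirtinger j f p = P (axis j 1)" "wirtinger_bar j f p = Q (axis j 1)"
    by (simp_all add: wirtinger_def wirtinger_bar_def fd assms(2,3) algebra_simps)
qed

text \<open>\<open>has_ddbar S K A\<close>: \<open>K\<close> is twice differentiable on \<open>S\<close> in the sense needed for \<open>i_ddbar\<close>, and
  \<open>A j k = \<partial>\<^sub>j \<partial>\<^sub>k-bar K\<close>.\<close>

definition has_ddbar ::
  "(complex^'m) set \<Rightarrow> (complex^'m \<Rightarrow> real) \<Rightarrow> ('m::finite \<Rightarrow> 'm \<Rightarrow> complex^'m \<Rightarrow> complex) \<Rightarrow> bool" where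
  "has_ddbar S K A \<longleftrightarrow> (\<exists>B. \<forall>p\<in>S. (\<lambda>q. complex_of_real (K q)) differentiable (at p) \<and>
     (\<forall>k. wirtinger_bar k (\<lambda>q. complex_of_real (K q)) p = B k p \<and> B k differentiable (at p) \<and>
       (\<forall>j. wirtinger j (B k) p = A j k p)))"

lemma wirtinger_cong:
  assumes "open S" "p \<in> S" "\<And>q. q \<in> S \<Longrightarrow> f q = g q" "f differentiable (at p)"
  shows "wirtinger j f p = wirtinger j g p" "wirtinger_bar j f p = wirtinger_bar j g p"
  using frechet_derivative_transform_within_open[OF assms(4,1,2,3)]
  by (simp_all add: wirtinger_def wirtinger_bar_def)

text \<open>\<open>has_ddbar\<close> differentiates functions \<open>B k\<close> that agree with the
  first derivatives on S only. Since S is open, agreement near p is enough.\<close>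

lemma has_ddbar_wirtinger:
  assumes "open S" "has_ddbar S K A" "p \<in> S"
  shows "wirtinger j (wirtinger_bar k (\<lambda>q. complex_of_real (K q))) p = A j k p"
proof -
  obtain B where B: "\<forall>p\<in>S. (\<lambda>q. complex_of_real (K q)) differentiable (at p) \<and>
     (\<forall>k. wirtinger_bar k (\<lambda>q. complex_of_real (K q)) p = B k p \<and> B k differentiable (at p) \<and>
       (\<forall>j. wirtinger j (B k) p = A j k p))"
    using assms(2) unfolding has_ddbar_def by blast
  then show ?thesis
    using wirtinger_cong(1)[OF assms(1,3), of "B k" "wirtinger_bar k (\<lambda>q. complex_of_real (K q))" j]
      assms(3) by auto
qed

lemma i_ddbar_eq:
  assumes "open S" "has_ddbar S K A" "p \<in> S"
  shows "i_ddbar K p u v =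
    \<i> * (\<Sum>j\<in>UNIV. \<Sum>k\<in>UNIV. A j k p * (u $ j * cnj (v $ k) - v $ j * cnj (u $ k)))"
  by (simp add: i_ddbar_def has_ddbar_wirtinger[OF assms])

lemma wirtinger_linear:
  assumes "f differentiable (at p)" "g differentiable (at p)"
  shows "wirtinger j (\<lambda>q. a * f q + b * g q) p = a * wirtinger j f p + b * wirtinger j g p"
    "wirtinger_bar j (\<lambda>q. a * f q + b * g q) p = a * wirtinger_bar j f p + b * wirtinger_bar j g p"
    "(\<lambda>q. a * f q + b * g q) differentiable (at p)"
proof -
  have d: "((\<lambda>q. a * f q + b * g q) has_derivative
      (\<lambda>v. a * frechet_derivative f (at p) v + b * frechet_derivative g (at p) v)) (at p)"
    using assms unfolding frechet_derivative_works
    by (intro has_derivative_add has_derivative_mult_right)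
  show "wirtinger j (\<lambda>q. a * f q + b * g q) p = a * wirtinger j f p + b * wirtinger j g p"
    "wirtinger_bar j (\<lambda>q. a * f q + b * g q) p = a * wirtinger_bar j f p + b * wirtinger_bar j g p"
    using frechet_derivative_at[OF d, symmetric]
    by (simp_all add: wirtinger_def wirtinger_bar_def field_simps)
  show "(\<lambda>q. a * f q + b * g q) differentiable (at p)" using d unfolding differentiable_def by blast
qed

lemma has_ddbar_linear:
  assumes "has_ddbar S K A" "has_ddbar S L C"
  shows "has_ddbar S (\<lambda>p. a * K p + b * L p) (\<lambda>j k p. of_real a * A j k p + of_real b * C j k p)"
proof -
  obtain B where B: "\<And>p k. p\<in>S \<Longrightarrow> (\<lambda>q. complex_of_real (K q)) differentiable (at p) \<and>
     (wirtinger_bar k (\<lambda>q. complex_of_real (K q)) p = B k p \<and> B k differentiable (at p) \<and>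
       (\<forall>j. wirtinger j (B k) p = A j k p))"
    using assms(1) unfolding has_ddbar_def by blast
  obtain D where D: "\<And>p k. p\<in>S \<Longrightarrow> (\<lambda>q. complex_of_real (L q)) differentiable (at p) \<and>
     (wirtinger_bar k (\<lambda>q. complex_of_real (L q)) p = D k p \<and> D k differentiable (at p) \<and>
       (\<forall>j. wirtinger j (D k) p = C j k p))"
    using assms(2) unfolding has_ddbar_def by blast
  show ?thesis unfolding has_ddbar_def
    by (rule exI[of _ "\<lambda>k p. of_real a * B k p + of_real b * D k p"])
       (auto simp: B D wirtinger_linear)
qed

lemma has_ddbar_cong:
  assumes "open S" "\<And>p. p \<in> S \<Longrightarrow> K p = L p" "has_ddbar S K A"
  shows "has_ddbar S L A"
proof -
  obtain B where B: "\<And>p k. p\<in>S \<Longrightarrow> (\<lambda>q. complex_of_real (K q)) differentiable (at p) \<and>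
     (wirtinger_bar k (\<lambda>q. complex_of_real (K q)) p = B k p \<and> B k differentiable (at p) \<and>
       (\<forall>j. wirtinger j (B k) p = A j k p))"
    using assms(3) unfolding has_ddbar_def by blast
  have "(\<lambda>q. complex_of_real (L q)) differentiable (at p)" if p: "p \<in> S" for p
  proof -
    obtain D where "((\<lambda>q. complex_of_real (K q)) has_derivative D) (at p)"
      using B[OF p] unfolding differentiable_def by blast
    then show ?thesis
      using has_derivative_transform_within_open[OF _ assms(1) p, of _ _ _ "\<lambda>q. complex_of_real (L q)"] assms(2)
      unfolding differentiable_def by fastforce
  qed
  moreover have "wirtinger_bar k (\<lambda>q. complex_of_real (L q)) p = B k p" if p: "p \<in> S" for p k
    using wirtinger_cong(2)[OF assms(1) p, of "\<lambda>q. complex_of_real (K q)" "\<lambda>q. complex_of_real (L q)" k]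
      assms(2) B[OF p] by auto
  ultimately show ?thesis unfolding has_ddbar_def using B by blast
qed

section \<open>Logarithms of sums of squares\<close>

definition hprod :: "'r set \<Rightarrow> ('r \<Rightarrow> complex) \<Rightarrow> ('r \<Rightarrow> complex) \<Rightarrow> complex" where
  "hprod R U V = (\<Sum>r\<in>R. U r * cnj (V r))"

text \<open>The Fubini-Study form in homogeneous coordinates \<open>F\<close>, on tangent vectors \<open>U\<close> and \<open>V\<close>.\<close>

definition fs_form :: "'r set \<Rightarrow> ('r \<Rightarrow> complex) \<Rightarrow> ('r \<Rightarrow> complex) \<Rightarrow> ('r \<Rightarrow> complex) \<Rightarrow> complex" where
  "fs_form R F U V = \<i> * ((hprod R U V - hprod R V U) / hprod R F F
     - (hprod R U F * hprod R F V - hprod R V F * hprod R F U) / (hprod R F F)\<^sup>2)"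

lemma hprod_self: "hprod R F F = of_real (\<Sum>r\<in>R. (cmod (F r))\<^sup>2)"
  by (simp add: hprod_def complex_mult_cnj cmod_power2)

lemma sum_axis: "(\<Sum>i\<in>UNIV. (axis j c :: complex^'m) $ i * f i) = c * f j"
proof -
  have "(\<Sum>i\<in>UNIV. (axis j c :: complex^'m) $ i * f i) = (\<Sum>i\<in>UNIV. if i = j then c * f i else 0)"
    by (intro sum.cong) (auto simp: axis_def)
  then show ?thesis by simp
qed

text \<open>The quotient rule, applied to \<open>hprod R f f\<close>: as the \<open>f r\<close> are
  holomorphic, \<partial> differentiates only the left factors and \<partial>-bar only the
  conjugated right ones.\<close>

lemma has_ddbar_ln_sum_norm:
  fixes f :: "'r \<Rightarrow> complex^'m \<Rightarrow> complex" and f' :: "'r \<Rightarrow> 'm \<Rightarrow> complex^'m \<Rightarrow> complex"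
  assumes f: "\<And>r. r \<in> R \<Longrightarrow> has_partials_on S (f r) (f' r)"
    and f': "\<And>r j. r \<in> R \<Longrightarrow> holomorphic_several_on S (f' r j)"
    and pos: "\<And>p. p \<in> S \<Longrightarrow> (\<Sum>r\<in>R. (cmod (f r p))\<^sup>2) > 0"
  shows "has_ddbar S (\<lambda>p. ln (\<Sum>r\<in>R. (cmod (f r p))\<^sup>2))
    (\<lambda>j k p. hprod R (\<lambda>r. f' r j p) (\<lambda>r. f' r k p) / hprod R (\<lambda>r. f r p) (\<lambda>r. f r p)
       - hprod R (\<lambda>r. f' r j p) (\<lambda>r. f r p) * hprod R (\<lambda>r. f r p) (\<lambda>r. f' r k p)
          / (hprod R (\<lambda>r. f r p) (\<lambda>r. f r p))\<^sup>2)"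
    (is "has_ddbar S ?K ?A")
proof -
  define T where "T p = hprod R (\<lambda>r. f r p) (\<lambda>r. f r p)" for p
  define D where "D r p v = (\<Sum>j\<in>UNIV. v $ j * f' r j p)" for r p v
  have D: "(f r has_derivative D r p) (at p)" if "r \<in> R" "p \<in> S" for r p
    using f that unfolding has_partials_on_def D_def by blast
  have D_axis: "D r p (axis j c) = c * f' r j p" for r p j c unfolding D_def by (rule sum_axis)
  \<comment> \<open>The complex linear and the antilinear part of dT, in the shape that
    \<open>wirtinger_split\<close> expects after division by T.\<close>
  define P where "P p v = (\<Sum>r\<in>R. D r p v * cnj (f r p))" for p v
  define Q where "Q p v = (\<Sum>r\<in>R. f r p * cnj (D r p v))" for p v
  have dT: "(T has_derivative (\<lambda>v. P p v + Q p v)) (at p)" if "p \<in> S" for p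
  proof -
    have "((\<lambda>p. \<Sum>r\<in>R. f r p * cnj (f r p)) has_derivative
        (\<lambda>v. \<Sum>r\<in>R. f r p * cnj (D r p v) + D r p v * cnj (f r p))) (at p)"
      by (intro has_derivative_sum has_derivative_mult D that has_derivative_cnj)
    then show ?thesis
      by (simp add: T_def[abs_def] hprod_def P_def Q_def sum.distrib add.commute)
  qed
  have PQ: "Q p v = cnj (P p v)" for p v by (simp add: P_def Q_def mult.commute)
  have T_real: "T p = of_real (\<Sum>r\<in>R. (cmod (f r p))\<^sup>2)" for p by (simp add: T_def hprod_self)
  have T0: "T p \<noteq> 0" if "p \<in> S" for p using pos[OF that] by (simp add: T_real del: of_real_sum)
  have dK: "((\<lambda>p. complex_of_real (?K p)) has_derivative (\<lambda>v. P p v / T p + Q p v / T p)) (at p)"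
    if p: "p \<in> S" for p
  proof -
    have "((\<lambda>p. Re (T p)) has_derivative (\<lambda>v. Re (P p v + Q p v))) (at p)"
      by (rule has_derivative_Re[OF dT[OF p]])
    then have "((\<lambda>p. \<Sum>r\<in>R. (cmod (f r p))\<^sup>2) has_derivative (\<lambda>v. Re (P p v + Q p v))) (at p)"
      by (simp add: T_real del: of_real_sum)
    then have "((\<lambda>p. complex_of_real (?K p)) has_derivative
        (\<lambda>v. of_real (Re (P p v + Q p v) * inverse (\<Sum>r\<in>R. (cmod (f r p))\<^sup>2)))) (at p)"
      using has_derivative_ln[of "\<lambda>p. \<Sum>r\<in>R. (cmod (f r p))\<^sup>2" p _ UNIV] pos[OF p]
      by (intro has_derivative_of_real) (simp add: mult.commute)
    moreover have "of_real (Re (P p v + Q p v) * inverse (\<Sum>r\<in>R. (cmod (f r p))\<^sup>2))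
        = P p v / T p + Q p v / T p" for v
    proof -
      have "complex_of_real (Re (P p v + Q p v)) = P p v + Q p v"
        unfolding PQ by (simp add: complex_eq_iff)
      then show ?thesis unfolding of_real_mult of_real_inverse T_real
        by (simp add: divide_inverse algebra_simps del: of_real_sum)
    qed
    ultimately show ?thesis by (simp del: of_real_sum)
  qed
  have Q_axis: "Q p (axis k 1) = hprod R (\<lambda>r. f r p) (\<lambda>r. f' r k p)" for p k
    by (simp add: Q_def D_axis hprod_def)
  have P_axis: "P p (axis k 1) = hprod R (\<lambda>r. f' r k p) (\<lambda>r. f r p)" for p k
    by (simp add: P_def D_axis hprod_def)
  have P_axis_i: "P p (axis k \<i>) = \<i> * P p (axis k 1)" for p k
    by (simp add: P_def D_axis sum_distrib_left mult.assoc)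
  have Q_axis_i: "Q p (axis k \<i>) = - \<i> * Q p (axis k 1)" for p k
    unfolding PQ P_axis_i by simp
  define B where "B k p = hprod R (\<lambda>r. f r p) (\<lambda>r. f' r k p) / T p" for k p
  have wK: "wirtinger_bar k (\<lambda>p. complex_of_real (?K p)) p = B k p" if "p \<in> S" for k p
    using wirtinger_split(2)[OF dK[OF that], of k] P_axis_i Q_axis_i Q_axis by (simp add: B_def)
  have wB: "B k differentiable (at p) \<and> (\<forall>j. wirtinger j (B k) p = ?A j k p)" if p: "p \<in> S" for k p
  proof -
    have "\<forall>r\<in>R. \<exists>E. (f' r k has_derivative E) (at p) \<and> (\<forall>c v. E (c *s v) = c * E v)"
      using f' p unfolding holomorphic_several_on_def by blast
    then obtain E where E: "\<And>r. r \<in> R \<Longrightarrow> (f' r k has_derivative E r) (at p)"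
      "\<And>r c v. r \<in> R \<Longrightarrow> E r (c *s v) = c * E r v" by metis
    have E_axis: "E r (axis j \<i>) = \<i> * E r (axis j 1)" if "r \<in> R" for r j
    proof -
      have "axis j \<i> = \<i> *s (axis j 1 :: complex^'m)" by (simp add: vec_eq_iff axis_def)
      then show ?thesis using E(2)[OF that] by metis
    qed
    define N where "N = hprod R (\<lambda>r. f r p) (\<lambda>r. f' r k p)"
    \<comment> \<open>The same splitting for the numerator. The second derivatives E occur only in
      Q', under a conjugation, and so disappear from \<open>wirtinger j\<close>.\<close>
    define P' where "P' v = (\<Sum>r\<in>R. D r p v * cnj (f' r k p))" for v
    define Q' where "Q' v = (\<Sum>r\<in>R. f r p * cnj (E r v))" for v
    have dN: "((\<lambda>p. hprod R (\<lambda>r. f r p) (\<lambda>r. f' r k p)) has_derivative (\<lambda>v. P' v + Q' v)) (at p)"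
    proof -
      have "((\<lambda>p. \<Sum>r\<in>R. f r p * cnj (f' r k p)) has_derivative
          (\<lambda>v. \<Sum>r\<in>R. f r p * cnj (E r v) + D r p v * cnj (f' r k p))) (at p)"
        by (intro has_derivative_sum has_derivative_mult D p has_derivative_cnj E(1))
      then show ?thesis by (simp add: hprod_def P'_def Q'_def sum.distrib add.commute)
    qed
    have dB: "(B k has_derivative (\<lambda>v. (P' v / T p - N * P p v / (T p)\<^sup>2) + (Q' v / T p - N * Q p v / (T p)\<^sup>2))) (at p)"
    proof -
      have "(B k has_derivative (\<lambda>v. - N * (inverse (T p) * (P p v + Q p v) * inverse (T p)) + (P' v + Q' v) / T p)) (at p)"
        using Deriv.has_derivative_divide[OF dN dT[OF p] T0[OF p]] by (simp add: N_def B_def[abs_def])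
      then show ?thesis
        by (rule has_derivative_eq_rhs) (simp add: fun_eq_iff field_simps power2_eq_square T0[OF p])
    qed
    have "wirtinger j (B k) p = P' (axis j 1) / T p - N * P p (axis j 1) / (T p)\<^sup>2" for j
    proof (rule wirtinger_split(1)[OF dB])
      have "P' (axis j \<i>) = \<i> * P' (axis j 1)"
        by (simp add: P'_def D_axis sum_distrib_left mult.assoc)
      then show "P' (axis j \<i>) / T p - N * P p (axis j \<i>) / (T p)\<^sup>2 = \<i> * (P' (axis j 1) / T p - N * P p (axis j 1) / (T p)\<^sup>2)"
        by (simp add: P_axis_i algebra_simps)
      have "Q' (axis j \<i>) = - \<i> * Q' (axis j 1)"
        by (simp add: Q'_def E_axis sum_distrib_left algebra_simps sum_negf)
      then show "Q' (axis j \<i>) / T p - N * Q p (axis j \<i>) / (T p)\<^sup>2 = - \<i> * (Q' (axis j 1) / T p - N * Q p (axis j 1) / (T p)\<^sup>2)"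
        by (simp add: Q_axis_i algebra_simps)
    qed
    moreover have "P' (axis j 1) = hprod R (\<lambda>r. f' r j p) (\<lambda>r. f' r k p)" for j
      by (simp add: P'_def D_axis hprod_def)
    ultimately have "wirtinger j (B k) p = ?A j k p" for j
      by (simp add: N_def P_axis T_def mult.commute)
    then show ?thesis using dB unfolding differentiable_def by blast
  qed
  show ?thesis unfolding has_ddbar_def
  proof (intro exI[of _ B] ballI conjI allI)
    fix p assume p: "p \<in> S"
    show "(\<lambda>p. complex_of_real (?K p)) differentiable (at p)"
      using dK[OF p] unfolding differentiable_def by blast
  qed (use wK wB in auto)
qed

lemma sum_hermitian_contract:
  "(\<Sum>j\<in>UNIV. \<Sum>k\<in>UNIV. hprod R (\<lambda>r. f' r j) (\<lambda>r. f' r k) * (u j * cnj (v k))) =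
   hprod R (\<lambda>r. \<Sum>j\<in>UNIV. u j * f' r j) (\<lambda>r. \<Sum>k\<in>UNIV. v k * f' r k)"
proof -
  have "(\<Sum>j\<in>UNIV. \<Sum>k\<in>UNIV. hprod R (\<lambda>r. f' r j) (\<lambda>r. f' r k) * (u j * cnj (v k))) =
    (\<Sum>j\<in>UNIV. \<Sum>k\<in>UNIV. \<Sum>r\<in>R. (u j * f' r j) * cnj (v k * f' r k))"
    by (simp add: hprod_def sum_distrib_right sum_distrib_left mult_ac)
  also have "\<dots> = (\<Sum>j\<in>UNIV. \<Sum>r\<in>R. \<Sum>k\<in>UNIV. (u j * f' r j) * cnj (v k * f' r k))"
    by (intro sum.cong refl sum.swap)
  also have "\<dots> = (\<Sum>r\<in>R. \<Sum>j\<in>UNIV. \<Sum>k\<in>UNIV. (u j * f' r j) * cnj (v k * f' r k))"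
    by (rule sum.swap)
  finally show ?thesis by (simp add: hprod_def sum_product)
qed

lemma i_ddbar_ln_sum_norm:
  fixes f :: "'r \<Rightarrow> complex^'m \<Rightarrow> complex"
  assumes "open S" "p \<in> S"
    and "\<And>r. r \<in> R \<Longrightarrow> has_partials_on S (f r) (f' r)"
    and "\<And>r j. r \<in> R \<Longrightarrow> holomorphic_several_on S (f' r j)"
    and "\<And>p. p \<in> S \<Longrightarrow> (\<Sum>r\<in>R. (cmod (f r p))\<^sup>2) > 0"
  shows "i_ddbar (\<lambda>p. ln (\<Sum>r\<in>R. (cmod (f r p))\<^sup>2)) p u v =
    fs_form R (\<lambda>r. f r p) (\<lambda>r. \<Sum>j\<in>UNIV. u $ j * f' r j p) (\<lambda>r. \<Sum>j\<in>UNIV. v $ j * f' r j p)"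
proof -
  let ?T = "hprod R (\<lambda>r. f r p) (\<lambda>r. f r p)"
  let ?D = "\<lambda>u r. \<Sum>j\<in>UNIV. u $ j * f' r j p"
  let ?F = "\<lambda>r. f r p"
  \<comment> \<open>Half of the form: \<open>i_ddbar\<close> antisymmetrises a sesquilinear
    expression, so this is used both for (u, v) and for (v, u).\<close>
  have *: "(\<Sum>j\<in>UNIV. \<Sum>k\<in>UNIV. (hprod R (\<lambda>r. f' r j p) (\<lambda>r. f' r k p) / ?T
       - hprod R (\<lambda>r. f' r j p) ?F * hprod R ?F (\<lambda>r. f' r k p) / ?T\<^sup>2) * (u $ j * cnj (v $ k)))
    = hprod R (?D u) (?D v) / ?T - hprod R (?D u) ?F * hprod R ?F (?D v) / ?T\<^sup>2" for u v
  proof -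
    have "hprod R (?D u) (?D v) / ?T =
      (\<Sum>j\<in>UNIV. \<Sum>k\<in>UNIV. hprod R (\<lambda>r. f' r j p) (\<lambda>r. f' r k p) * (u $ j * cnj (v $ k)) / ?T)"
      unfolding sum_hermitian_contract[symmetric] by (simp add: sum_divide_distrib)
    moreover have "hprod R (?D u) ?F = (\<Sum>j\<in>UNIV. u $ j * hprod R (\<lambda>r. f' r j p) ?F)"
      unfolding hprod_def sum_distrib_right sum_distrib_left
      by (subst sum.swap) (simp add: mult.assoc)
    moreover have "hprod R ?F (?D v) = (\<Sum>k\<in>UNIV. cnj (v $ k) * hprod R ?F (\<lambda>r. f' r k p))"
      unfolding hprod_def sum_distrib_left cnj_sum
      by (subst sum.swap) (simp add: mult_ac)
    ultimately show ?thesis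
      by (simp add: sum_subtractf sum_product sum_divide_distrib algebra_simps)
  qed
  have "i_ddbar (\<lambda>p. ln (\<Sum>r\<in>R. (cmod (f r p))\<^sup>2)) p u v = \<i> *
    ((\<Sum>j\<in>UNIV. \<Sum>k\<in>UNIV. (hprod R (\<lambda>r. f' r j p) (\<lambda>r. f' r k p) / ?T
       - hprod R (\<lambda>r. f' r j p) ?F * hprod R ?F (\<lambda>r. f' r k p) / ?T\<^sup>2) * (u $ j * cnj (v $ k)))
    - (\<Sum>j\<in>UNIV. \<Sum>k\<in>UNIV. (hprod R (\<lambda>r. f' r j p) (\<lambda>r. f' r k p) / ?T
       - hprod R (\<lambda>r. f' r j p) ?F * hprod R ?F (\<lambda>r. f' r k p) / ?T\<^sup>2) * (v $ j * cnj (u $ k))))"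
    using i_ddbar_eq[OF assms(1) has_ddbar_ln_sum_norm[of R S f f', OF assms(3,4,5)] assms(2), of u v]
    unfolding sum_subtractf[symmetric] right_diff_distrib[symmetric] by blast
  then show ?thesis unfolding * fs_form_def by (simp add: diff_divide_distrib algebra_simps)
qed

text \<open>The potential \<open>ln |f|^2\<close> of a nonvanishing holomorphic f is pluriharmonic,
  so changing a frame does not change the curvature. At a zero of \<open>F r\<close> the value is 0
  by the convention on division.\<close>

lemma fs_form_singleton: "fs_form {r} F U V = 0"
  by (cases "F r = 0") (auto simp: fs_form_def hprod_def field_simps power2_eq_square)

section \<open>Pluriharmonic functions\<close>

lemma real_linear_complex_vec:
  fixes D :: "complex^'m \<Rightarrow> 'b::real_vector"
  assumes "linear D"
  shows "D v = (\<Sum>j\<in>UNIV. Re (v $ j) *\<^sub>R D (axis j 1) + Im (v $ j) *\<^sub>R D (axis j \<i>))"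
proof -
  have v: "v = (\<Sum>j\<in>UNIV. Re (v $ j) *\<^sub>R axis j 1 + Im (v $ j) *\<^sub>R axis j \<i>)"
  proof -
    have "v = (\<Sum>j\<in>UNIV. (v $ j) *s axis j 1)" by (simp add: basis_expansion)
    also have "\<dots> = (\<Sum>j\<in>UNIV. Re (v $ j) *\<^sub>R axis j 1 + Im (v $ j) *\<^sub>R axis j \<i>)"
      by (intro sum.cong refl) (auto simp: vec_eq_iff axis_def complex_eq_iff)
    finally show ?thesis .
  qed
  show ?thesis
    by (subst v) (simp add: linear_sum[OF assms] linear_add[OF assms] linear_cmul[OF assms])
qed

text \<open>With \<open>G\<^sub>k = 2 \<partial>\<^sub>k u\<close>, which is holomorphic, \<open>u\<close> is the real part of
  \<open>F(w) = u(p\<^sub>0) + \<integral>\<^sub>0\<^sup>1 \<Sum>\<^sub>k G\<^sub>k(p\<^sub>0 + t(w - p\<^sub>0)) (w - p\<^sub>0)\<^sub>k dt\<close> by the fundamental theorem of calculus on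
  segments, and \<open>F\<close> is holomorphic by differentiation under the integral sign.\<close>

lemma pluriharmonic_imp_real_part:
  fixes u :: "complex^'m \<Rightarrow> real"
  assumes S: "open S" "convex S" and p0: "p0 \<in> S" and u: "C_k_on (Suc (Suc 0)) S u"
    and ph: "\<And>p j k. p \<in> S \<Longrightarrow> wirtinger j (wirtinger_bar k (\<lambda>q. complex_of_real (u q))) p = 0"
  obtains F where "holomorphic_several_on S F" "\<And>p. p \<in> S \<Longrightarrow> Re (F p) = u p"
proof -
  obtain d where d: "\<And>p. p \<in> S \<Longrightarrow> (u has_derivative d p) (at p)"
    and d1: "\<And>w. C_k_on (Suc 0) S (\<lambda>p. d p w)" using C_k_on_SucE[OF u] by blast
  have "\<forall>w. \<exists>D. (\<forall>p\<in>S. ((\<lambda>p. d p w) has_derivative D p) (at p)) \<and> (\<forall>v. continuous_on S (\<lambda>p. D p v))"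
  proof
    fix w
    obtain D where "\<And>p. p \<in> S \<Longrightarrow> ((\<lambda>p. d p w) has_derivative D p) (at p)"
      "\<And>v. C_k_on 0 S (\<lambda>p. D p v)" using C_k_on_SucE[OF d1[of w]] by blast
    then show "\<exists>D. (\<forall>p\<in>S. ((\<lambda>p. d p w) has_derivative D p) (at p)) \<and> (\<forall>v. continuous_on S (\<lambda>p. D p v))"
      by (intro exI[of _ D]) simp
  qed
  then obtain e where "\<forall>w. (\<forall>p\<in>S. ((\<lambda>p. d p w) has_derivative e w p) (at p)) \<and>
      (\<forall>v. continuous_on S (\<lambda>p. e w p v))" by (rule choice[THEN exE])
  then have e: "\<And>p w. p \<in> S \<Longrightarrow> ((\<lambda>p. d p w) has_derivative e w p) (at p)"
    and e_cont: "\<And>w v. continuous_on S (\<lambda>p. e w p v)" by blast+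
  define G where "G k p = complex_of_real (d p (axis k 1)) - \<i> * of_real (d p (axis k \<i>))" for k p
  define E where "E k p v = complex_of_real (e (axis k 1) p v) - \<i> * of_real (e (axis k \<i>) p v)" for k p v
  have dG: "(G k has_derivative E k p) (at p)" if "p \<in> S" for k p
    unfolding G_def[abs_def] E_def[abs_def]
    by (intro has_derivative_diff has_derivative_of_real has_derivative_mult_right e that)
  have Gc: "continuous_on S (G k)" for k
    using dG by (meson continuous_at_imp_continuous_on has_derivative_continuous)
  have du: "d p v = Re (\<Sum>k\<in>UNIV. G k p * v $ k)" if "p \<in> S" for p v
  proof -
    have "d p v = (\<Sum>k\<in>UNIV. Re (v $ k) *\<^sub>R d p (axis k 1) + Im (v $ k) *\<^sub>R d p (axis k \<i>))"
      by (rule real_linear_complex_vec[OF has_derivative_linear[OF d[OF that]]])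
    also have "\<dots> = Re (\<Sum>k\<in>UNIV. G k p * v $ k)"
      unfolding Re_sum by (intro sum.cong refl) (simp add: G_def algebra_simps)
    finally show ?thesis .
  qed
  have du': "((\<lambda>q. complex_of_real (u q)) has_derivative (\<lambda>v. of_real (d p v))) (at p)" if "p \<in> S" for p
    by (rule has_derivative_of_real[OF d[OF that]])
  have wb: "wirtinger_bar k (\<lambda>q. complex_of_real (u q)) p = cnj (G k p) / 2" if "p \<in> S" for k p
    using frechet_derivative_at[OF du'[OF that], symmetric] by (simp add: wirtinger_bar_def G_def)
  \<comment> \<open>The Cauchy-Riemann equations of \<open>G k\<close>: the first derivative
    \<open>wirtinger_bar k\<close> of u is half the conjugate of \<open>G k\<close>, and the
    hypothesis says that \<partial> kills it.\<close>
  have E_i: "E k p (axis j \<i>) = \<i> * E k p (axis j 1)" if p: "p \<in> S" for k p j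
  proof -
    have dg: "((\<lambda>p. cnj (G k p) / 2) has_derivative (\<lambda>v. cnj (E k p v) / 2)) (at p)"
      by (rule bounded_linear.has_derivative[OF bounded_linear_divide has_derivative_cnj[OF dG[OF p]]])
    have "wirtinger j (\<lambda>p. cnj (G k p) / 2) p = wirtinger j (wirtinger_bar k (\<lambda>q. complex_of_real (u q))) p"
      by (rule wirtinger_cong(1)[OF S(1) p]) (use wb dg in \<open>auto simp: differentiable_def\<close>)
    also have "\<dots> = 0" by (rule ph[OF p])
    finally have "cnj (E k p (axis j 1)) = \<i> * cnj (E k p (axis j \<i>))"
      unfolding wirtinger_def frechet_derivative_at[OF dg, symmetric] by simp
    then have "cnj (cnj (E k p (axis j 1))) = cnj (\<i> * cnj (E k p (axis j \<i>)))" by simp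
    then show ?thesis by simp
  qed
  define g where "g k j p = E k p (axis j 1)" for k j p
  have Eg: "E k p v = (\<Sum>j\<in>UNIV. v $ j * g k j p)" if p: "p \<in> S" for k p v
  proof -
    have "E k p v = (\<Sum>j\<in>UNIV. Re (v $ j) *\<^sub>R E k p (axis j 1) + Im (v $ j) *\<^sub>R E k p (axis j \<i>))"
      by (rule real_linear_complex_vec[OF has_derivative_linear[OF dG[OF p]]])
    also have "\<dots> = (\<Sum>j\<in>UNIV. v $ j * g k j p)"
      unfolding E_i[OF p] g_def
    proof (intro sum.cong refl)
      fix j
      have "v $ j = of_real (Re (v $ j)) + \<i> * of_real (Im (v $ j))" by (rule complex_eq)
      then have "v $ j * E k p (axis j 1) = (of_real (Re (v $ j)) + \<i> * of_real (Im (v $ j))) * E k p (axis j 1)"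
        by (rule arg_cong)
      then show "Re (v $ j) *\<^sub>R E k p (axis j 1) + Im (v $ j) *\<^sub>R (\<i> * E k p (axis j 1)) = v $ j * E k p (axis j 1)"
        by (simp add: scaleR_conv_of_real algebra_simps)
    qed
    finally show ?thesis .
  qed
  have gc: "continuous_on S (g k j)" for k j
    unfolding g_def[abs_def] E_def[abs_def] by (intro continuous_intros e_cont)
  define \<gamma> where "\<gamma> w t = p0 + t *\<^sub>R (w - p0)" for w and t :: real
  have \<gamma>S: "\<gamma> w t \<in> S" if "w \<in> S" "t \<in> {0..1}" for w t
  proof -
    have "(1 - t) *\<^sub>R p0 + t *\<^sub>R w \<in> S" using S(2) p0 that unfolding convex_alt by auto
    then show ?thesis by (simp add: \<gamma>_def algebra_simps)
  qed
  have \<gamma>c: "continuous_on X (\<lambda>x. \<gamma> (fst x) (snd x))" for X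
    unfolding \<gamma>_def by (intro continuous_intros)
  have Gc2: "continuous_on (S \<times> {0..1}) (\<lambda>x. h (\<gamma> (fst x) (snd x)))" if "continuous_on S h" for h :: "complex^'m \<Rightarrow> complex"
    by (rule continuous_on_compose2[OF that \<gamma>c]) (use \<gamma>S in auto)
  have fstc: "continuous_on X (\<lambda>x. fst x $ k)" for X :: "((complex^'m) \<times> real) set" and k
    by (intro continuous_intros)
  define H where "H w t = (\<Sum>k\<in>UNIV. G k (\<gamma> w t) * (w - p0) $ k)" for w t
  \<comment> \<open>The partial derivative of H in the coordinate j of w: the sum comes from moving
    the point of the segment, at speed t, and the last term from the factor
    \<open>w - p0\<close>.\<close>
  define M where "M j w t = (\<Sum>k\<in>UNIV. of_real t * g k j (\<gamma> w t) * (w - p0) $ k) + G j (\<gamma> w t)" for j w t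
  \<comment> \<open>The rule for differentiation under the integral sign expects the derivative as a
    continuous map into bounded linear maps.\<close>
  define L :: "('m \<Rightarrow> complex) \<Rightarrow> (complex^'m) \<Rightarrow>\<^sub>L complex" where "L c = Blinfun (\<lambda>v. \<Sum>j\<in>UNIV. v $ j * c j)" for c
  have L: "blinfun_apply (L c) = (\<lambda>v. \<Sum>j\<in>UNIV. v $ j * c j)" for c
    unfolding L_def by (rule bounded_linear_Blinfun_apply)
      (intro bounded_linear_sum bounded_linear_mult_const bounded_linear_vec_nth)
  have Hc: "continuous_on (S \<times> {0..1}) (\<lambda>x. H (fst x) (snd x))"
    unfolding H_def by (intro continuous_intros Gc2 Gc fstc)
  have Mc: "continuous_on (S \<times> {0..1}) (\<lambda>x. M j (fst x) (snd x))" for j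
    unfolding M_def by (intro continuous_intros Gc2 Gc gc fstc)
  have LMc: "continuous_on (S \<times> {0..1}) (\<lambda>x. L (\<lambda>j. M j (fst x) (snd x)))"
    by (rule continuous_on_blinfun_componentwise) (auto simp: L intro!: continuous_intros Mc)
  have slice: "continuous_on {0..1} (\<lambda>t. \<Phi> w t)"
    if "continuous_on (S \<times> {0..1}) (\<lambda>x. \<Phi> (fst x) (snd x))" "w \<in> S" for \<Phi> :: "(complex^'m) \<Rightarrow> real \<Rightarrow> 'x::topological_space" and w
  proof -
    have "continuous_on {0..1} (\<lambda>t. (w, t))" by (intro continuous_on_Pair continuous_on_const continuous_on_id)
    then show ?thesis using continuous_on_compose2[OF that(1), of "{0..1}" "\<lambda>t. (w, t)"] that(2) by auto
  qed
  have dH: "((\<lambda>w. H w t) has_derivative blinfun_apply (L (\<lambda>j. M j w t))) (at w)"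
    if "w \<in> S" "t \<in> {0..1}" for w t
  proof -
    have \<gamma>d: "((\<lambda>w. \<gamma> w t) has_derivative (\<lambda>v. t *\<^sub>R v)) (at w)"
      unfolding \<gamma>_def by (auto intro!: derivative_eq_intros)
    have Gd: "((\<lambda>w. G k (\<gamma> w t)) has_derivative (\<lambda>v. E k (\<gamma> w t) (t *\<^sub>R v))) (at w)" for k
      by (rule has_derivative_compose[OF \<gamma>d dG[OF \<gamma>S[OF that]]])
    have cd: "((\<lambda>w. (w - p0) $ k) has_derivative (\<lambda>v. v $ k)) (at w)" for k
      by (rule bounded_linear.has_derivative[OF bounded_linear_vec_nth]) (auto intro!: derivative_eq_intros)
    have "((\<lambda>w. H w t) has_derivative
        (\<lambda>v. \<Sum>k\<in>UNIV. G k (\<gamma> w t) * v $ k + E k (\<gamma> w t) (t *\<^sub>R v) * (w - p0) $ k)) (at w)"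
      unfolding H_def by (intro has_derivative_sum has_derivative_mult Gd cd)
    moreover have "(\<Sum>k\<in>UNIV. G k (\<gamma> w t) * v $ k + E k (\<gamma> w t) (t *\<^sub>R v) * (w - p0) $ k)
        = L (\<lambda>j. M j w t) v" for v
    proof -
      have "(\<Sum>k\<in>UNIV. E k (\<gamma> w t) (t *\<^sub>R v) * (w - p0) $ k) =
        (\<Sum>k\<in>UNIV. \<Sum>j\<in>UNIV. v $ j * (of_real t * g k j (\<gamma> w t) * (w - p0) $ k))"
        unfolding Eg[OF \<gamma>S[OF that]] sum_distrib_right
        by (intro sum.cong refl)
           (simp only: vector_scaleR_component scaleR_conv_of_real[of t "v $ _"] mult_ac)
      also have "\<dots> = (\<Sum>j\<in>UNIV. \<Sum>k\<in>UNIV. v $ j * (of_real t * g k j (\<gamma> w t) * (w - p0) $ k))"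
        by (rule sum.swap)
      finally show ?thesis
        by (simp add: L M_def sum.distrib sum_distrib_left distrib_left mult.commute)
    qed
    ultimately show ?thesis by simp
  qed
  define F where "F w = of_real (u p0) + integral {0..1} (H w)" for w
  have "holomorphic_several_on S F"
  proof (rule holomorphic_several_onI)
    fix w assume w: "w \<in> S"
    have "((\<lambda>w. integral (cbox 0 1) (H w)) has_derivative
        integral (cbox 0 1) (\<lambda>t. L (\<lambda>j. M j w t))) (at w within S)"
    proof (rule leibniz_rule[OF _ _ _ w S(2)])
      show "((\<lambda>w. H w t) has_derivative blinfun_apply (L (\<lambda>j. M j w t))) (at w within S)"
        if "w \<in> S" "t \<in> cbox 0 1" for w t
        using dH that by (simp add: has_derivative_at_withinI)
      show "H w integrable_on cbox 0 1" if "w \<in> S" for w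
        using slice[OF Hc that] by (simp add: integrable_continuous_real)
      show "continuous_on (S \<times> cbox 0 1) (\<lambda>(w, t). L (\<lambda>j. M j w t))"
        using LMc by (simp add: case_prod_beta)
    qed
    then show "(F has_derivative blinfun_apply (integral {0..1} (\<lambda>t. L (\<lambda>j. M j w t)))) (at w)"
      unfolding F_def[abs_def] using w S(1) at_within_open[OF w S(1)]
      by (auto intro!: derivative_eq_intros)
    have int: "(\<lambda>t. L (\<lambda>j. M j w t)) integrable_on cbox 0 1"
      using slice[OF LMc w] by (simp add: integrable_continuous_real)
    fix c v
    have "blinfun_apply (integral {0..1} (\<lambda>t. L (\<lambda>j. M j w t))) v = integral {0..1} (\<lambda>t. L (\<lambda>j. M j w t) v)" for v
      using blinfun_apply_integral[OF int] by simp
    moreover have "L (\<lambda>j. M j w t) (c *s v) = c * L (\<lambda>j. M j w t) v" for t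
      by (simp add: L sum_distrib_left mult.assoc)
    ultimately show "blinfun_apply (integral {0..1} (\<lambda>t. L (\<lambda>j. M j w t))) (c *s v) =
        c * blinfun_apply (integral {0..1} (\<lambda>t. L (\<lambda>j. M j w t))) v"
      by simp
  qed
  moreover have "Re (F w) = u w" if w: "w \<in> S" for w
  proof -
    have "((\<lambda>t. d (\<gamma> w t) (w - p0)) has_integral (u (\<gamma> w 1) - u (\<gamma> w 0))) {0..1}"
    proof (rule fundamental_theorem_of_calculus)
      fix t :: real assume t: "t \<in> {0..1}"
      have \<gamma>d: "((\<lambda>t. \<gamma> w t) has_derivative (\<lambda>s. s *\<^sub>R (w - p0))) (at t within {0..1})"
        unfolding \<gamma>_def by (auto intro!: derivative_eq_intros)
      have "((\<lambda>t. u (\<gamma> w t)) has_derivative (\<lambda>s. d (\<gamma> w t) (s *\<^sub>R (w - p0)))) (at t within {0..1})"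
        by (rule has_derivative_compose[OF \<gamma>d d[OF \<gamma>S[OF w t]]])
      then show "((\<lambda>t. u (\<gamma> w t)) has_vector_derivative d (\<gamma> w t) (w - p0)) (at t within {0..1})"
        unfolding has_vector_derivative_def
        using linear_cmul[OF has_derivative_linear[OF d[OF \<gamma>S[OF w t]]]] by simp
    qed simp
    then have 1: "((\<lambda>t. d (\<gamma> w t) (w - p0)) has_integral (u w - u p0)) {0..1}"
      by (simp add: \<gamma>_def)
    have "(H w has_integral integral {0..1} (H w)) {0..1}"
      using slice[OF Hc w] by (simp add: integrable_continuous_real integrable_integral)
    then have "((\<lambda>t. Re (H w t)) has_integral Re (integral {0..1} (H w))) {0..1}"
      using has_integral_linear[OF _ bounded_linear_Re] by (auto simp: o_def)
    then have "((\<lambda>t. d (\<gamma> w t) (w - p0)) has_integral Re (integral {0..1} (H w))) {0..1}"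
      by (rule has_integral_eq[rotated]) (simp add: H_def du[OF \<gamma>S[OF w]])
    with 1 have "Re (integral {0..1} (H w)) = u w - u p0" using has_integral_unique by blast
    then show ?thesis by (simp add: F_def)
  qed
  ultimately show thesis using that by blast
qed

section \<open>Homogeneous holomorphic functions\<close>

text \<open>Lagrange interpolation at the nodes 0, ..., N. The point is that L does not depend on a:
  coefficients that vary with parameters are fixed linear combinations of values, hence as regular
  in the parameters as these.\<close>

lemma coefficients_from_values:
  obtains L :: "nat \<Rightarrow> nat \<Rightarrow> complex" where
    "\<And>a j. j \<le> N \<Longrightarrow> a j = (\<Sum>t\<le>N. L j t * (\<Sum>k\<le>N. a k * of_nat t ^ k))"
proof
  \<comment> \<open>The Lagrange basis polynomial of the node t.\<close>
  define lag :: "nat \<Rightarrow> complex poly" where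
    "lag t = (\<Prod>s\<in>{..N}-{t}. smult (1 / (of_nat t - of_nat s)) [:- of_nat s, 1:])" for t
  have deg_lag: "degree (lag t) \<le> N" if "t \<le> N" for t
  proof -
    have "degree (lag t) \<le> (\<Sum>s\<in>{..N}-{t}. 1)"
      unfolding lag_def
      by (rule order_trans[OF degree_prod_sum_le[unfolded o_def]])
         (auto intro!: sum_mono order_trans[OF degree_smult_le])
    then show ?thesis using that by simp
  qed
  have lag: "poly (lag t) (of_nat s) = of_bool (s = t)" if "t \<le> N" "s \<le> N" for s t
  proof (cases "s = t")
    case True
    have "of_nat t - of_nat i \<noteq> (0::complex)" if "i \<noteq> t" for i
      using that of_nat_eq_iff[of t i, where ?'a=complex] by auto
    then have "poly (smult (1 / (of_nat t - of_nat i)) [:- of_nat i, 1:]) (of_nat t) = (1::complex)"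
      if "i \<noteq> t" for i using that by (simp add: diff_divide_distrib[symmetric])
    then show ?thesis unfolding lag_def poly_prod using True by (auto intro!: prod.neutral)
  next
    case False
    then show ?thesis unfolding lag_def poly_prod using that by (intro trans[OF prod_zero]) auto
  qed
  show "a j = (\<Sum>t\<le>N. coeff (lag t) j * (\<Sum>k\<le>N. a k * of_nat t ^ k))" if j: "j \<le> N" for a j
  proof -
    define P where "P = (\<Sum>k\<le>N. monom (a k) k)"
    have P: "poly P x = (\<Sum>k\<le>N. a k * x ^ k)" for x by (simp add: P_def poly_sum poly_monom)
    have "P = (\<Sum>t\<le>N. smult (poly P (of_nat t)) (lag t))" (is "P = ?Q")
    proof (rule poly_eqI_degree[where A = "of_nat ` {..N}"])
      show "poly P x = poly ?Q x" if x: "x \<in> of_nat ` {..N}" for x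
      proof -
        obtain s where s: "s \<le> N" "x = of_nat s" using x by auto
        have "poly ?Q x = (\<Sum>t\<le>N. poly P (of_nat t) * poly (lag t) (of_nat s))"
          by (simp add: poly_sum s)
        also have "\<dots> = (\<Sum>t\<le>N. if t = s then poly P (of_nat t) else 0)"
          by (intro sum.cong refl) (use lag s in auto)
        finally show ?thesis using s by simp
      qed
      have c: "card (of_nat ` {..N} :: complex set) = Suc N"
        by (subst card_image) (auto simp: inj_on_def)
      have "degree P \<le> N" unfolding P_def
        by (intro degree_sum_le) (auto intro: order_trans[OF degree_monom_le])
      then show "card (of_nat ` {..N} :: complex set) > degree P" using c by simp
      have "degree ?Q \<le> N"
        by (intro degree_sum_le) (auto intro!: order_trans[OF degree_smult_le] deg_lag)
      then show "card (of_nat ` {..N} :: complex set) > degree ?Q" using c by simp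
    qed
    then have "coeff P j = (\<Sum>t\<le>N. poly P (of_nat t) * coeff (lag t) j)"
      by (metis (no_types, lifting) coeff_smult coeff_sum sum.cong)
    moreover have "coeff P j = a j" using j by (simp add: P_def coeff_sum)
    ultimately show ?thesis by (simp add: P mult.commute)
  qed
qed

section \<open>Polynomial functions\<close>

lemma sum_cmonom_regroup:
  assumes "finite S" "finite E" "\<phi> ` S \<subseteq> E"
  shows "(\<Sum>i\<in>S. c i * cmonom (\<phi> i) p) = (\<Sum>\<beta>\<in>E. (\<Sum>i\<in>{i\<in>S. \<phi> i = \<beta>}. c i) * cmonom \<beta> p)"
proof -
  have "(\<Sum>i\<in>S. c i * cmonom (\<phi> i) p) = (\<Sum>\<beta>\<in>E. \<Sum>i\<in>{i\<in>S. \<phi> i = \<beta>}. c i * cmonom (\<phi> i) p)"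
    by (rule sum.group[OF assms, symmetric])
  also have "\<dots> = (\<Sum>\<beta>\<in>E. \<Sum>i\<in>{i\<in>S. \<phi> i = \<beta>}. c i * cmonom \<beta> p)"
    by (intro sum.cong) auto
  finally show ?thesis by (simp add: sum_distrib_right)
qed

lemma cmonom_shift: "cmonom (\<alpha>(c := \<alpha> c + i)) p = cmonom \<alpha> p * (p $ c) ^ i"
proof -
  have "cmonom (\<alpha>(c := \<alpha> c + i)) p = (\<Prod>k\<in>UNIV. (p $ k) ^ \<alpha> k * (if k = c then (p $ c) ^ i else 1))"
    unfolding cmonom_def by (intro prod.cong) (auto simp: power_add)
  then show ?thesis by (simp add: prod.distrib cmonom_def)
qed

lemma cmonom_scale: "cmonom \<alpha> (x *s p) = x ^ (\<Sum>c\<in>UNIV. \<alpha> c) * cmonom \<alpha> p"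
  by (simp add: cmonom_def power_mult_distrib prod.distrib power_sum)

lemma finite_exponents_le: "finite {\<beta> :: 'm::finite \<Rightarrow> nat. \<forall>c. \<beta> c \<le> N}"
  using finite_set_of_finite_funs[of "UNIV :: 'm set" "{..N}" 0] by simp

lemma finite_exponents: "finite {\<beta> :: 'm::finite \<Rightarrow> nat. (\<Sum>c\<in>UNIV. \<beta> c) = N}"
  by (rule finite_subset[OF _ finite_exponents_le[of N]]) (auto intro: member_le_sum)

definition is_polyfun :: "(complex^'m::finite \<Rightarrow> complex) \<Rightarrow> bool" where
  "is_polyfun f \<longleftrightarrow> (\<exists>A c. finite A \<and> (\<forall>p. f p = (\<Sum>\<alpha>\<in>A. c \<alpha> * cmonom \<alpha> p)))"

text \<open>Repeated monomials are permitted here, which spares a normal form in the closure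
  proofs.\<close>

lemma is_polyfunI:
  assumes "finite S" "\<And>p. f p = (\<Sum>i\<in>S. c i * cmonom (\<phi> i) p)"
  shows "is_polyfun f"
  unfolding is_polyfun_def
proof (intro exI conjI allI)
  show "f p = (\<Sum>\<beta>\<in>\<phi> ` S. (\<Sum>i\<in>{i\<in>S. \<phi> i = \<beta>}. c i) * cmonom \<beta> p)" for p
    using sum_cmonom_regroup[OF assms(1), of "\<phi> ` S" \<phi> c p] assms by simp
qed (use assms in auto)

lemma is_polyfun_add:
  assumes "is_polyfun f" "is_polyfun g" shows "is_polyfun (\<lambda>p. f p + g p)"
proof -
  obtain A a where A: "finite A" "\<And>p. f p = (\<Sum>\<alpha>\<in>A. a \<alpha> * cmonom \<alpha> p)"
    using assms(1) unfolding is_polyfun_def by blast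
  obtain B b where B: "finite B" "\<And>p. g p = (\<Sum>\<alpha>\<in>B. b \<alpha> * cmonom \<alpha> p)"
    using assms(2) unfolding is_polyfun_def by blast
  show ?thesis
  proof (rule is_polyfunI)
    show "finite (A <+> B)" using A B by simp
    show "f p + g p = (\<Sum>i\<in>A <+> B. case_sum a b i * cmonom (case_sum id id i) p)" for p
      using A B by (simp add: sum.Plus o_def)
  qed
qed

lemma is_polyfun_sum:
  "(\<And>i. i \<in> I \<Longrightarrow> is_polyfun (f i)) \<Longrightarrow> is_polyfun (\<lambda>p. \<Sum>i\<in>I. f i p)"
proof (induction I rule: infinite_finite_induct)
  case (insert x F)
  then show ?case by (auto intro: is_polyfun_add)
qed (auto intro: is_polyfunI[of "{}"])

lemma is_polyfun_mult_coordinate_power: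
  assumes "is_polyfun f" shows "is_polyfun (\<lambda>p. e * f p * (p $ c) ^ i)"
proof -
  obtain A a where A: "finite A" "\<And>p. f p = (\<Sum>\<alpha>\<in>A. a \<alpha> * cmonom \<alpha> p)"
    using assms(1) unfolding is_polyfun_def by blast
  show ?thesis
    by (rule is_polyfunI[OF A(1), where c="\<lambda>\<alpha>. e * a \<alpha>" and \<phi>="\<lambda>\<alpha>. \<alpha>(c := \<alpha> c + i)"])
       (simp add: A cmonom_shift sum_distrib_left sum_distrib_right mult_ac)
qed

definition vec_upd :: "'a^'m \<Rightarrow> 'm::finite \<Rightarrow> 'a \<Rightarrow> 'a^'m" where
  "vec_upd p c x = (\<chi> i. if i = c then x else p $ i)"

text \<open>Induction on the set of coordinates on which f depends. With the coordinate c frozen at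
  0, ..., N the function is a polynomial in the others, and interpolation expresses the coefficients
  of f in the coordinate c through these slices. The common degree bound N is what makes finitely
  many slices enough.\<close>

lemma separately_polynomial_imp_polyfun:
  fixes f :: "complex^'m \<Rightarrow> complex"
  assumes "finite I" "\<And>p q. (\<And>c. c \<in> I \<Longrightarrow> p $ c = q $ c) \<Longrightarrow> f p = f q"
    and "\<And>p c. \<exists>a. \<forall>x. f (vec_upd p c x) = (\<Sum>k\<le>N. a k * x ^ k)"
  shows "is_polyfun f"
  using assms
proof (induction I arbitrary: f rule: finite_induct)
  case empty
  define K where "K = f 0"
  have "f p = (\<Sum>i\<in>{()}. K * cmonom (\<lambda>_. 0) p)" for p
    using empty.prems(1)[of p 0] by (simp add: cmonom_def K_def)
  then show ?case by (intro is_polyfunI[of "{()}" f "\<lambda>_. K" "\<lambda>_ _. 0"] finite.intros)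
next
  case (insert c I)
  obtain L :: "nat \<Rightarrow> nat \<Rightarrow> complex" where
    L: "\<And>a j. j \<le> N \<Longrightarrow> a j = (\<Sum>t\<le>N. L j t * (\<Sum>k\<le>N. a k * of_nat t ^ k))"
    using coefficients_from_values by blast
  define h where "h t p = f (vec_upd p c (of_nat t))" for t p
  have h_poly: "is_polyfun (h t)" for t
  proof (rule insert.IH)
    show "h t p = h t q" if "\<And>c. c \<in> I \<Longrightarrow> p $ c = q $ c" for p q
      unfolding h_def by (rule insert.prems(1)) (use that in \<open>auto simp: vec_upd_def\<close>)
    show "\<exists>a. \<forall>x. h t (vec_upd p c' x) = (\<Sum>k\<le>N. a k * x ^ k)" for p c'
    proof (cases "c' = c")
      case True
      \<comment> \<open>A slice is constant along its frozen coordinate: a polynomial of degree 0,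
        padded to the bound N.\<close>
      have "h t (vec_upd p c' x) = (\<Sum>k\<le>N. (if k = 0 then h t p else 0) * x ^ k)" for x
      proof -
        have "vec_upd (vec_upd p c x) c (of_nat t) = vec_upd p c (of_nat t)"
          by (simp add: vec_upd_def vec_eq_iff)
        moreover have "(\<Sum>k\<le>N. (if k = 0 then h t p else 0) * x ^ k) = (\<Sum>k\<le>N. if k = 0 then h t p else 0)"
          by (intro sum.cong) auto
        ultimately show ?thesis using True by (simp add: h_def)
      qed
      then show ?thesis by (intro exI allI)
    next
      case False
      then have "h t (vec_upd p c' x) = f (vec_upd (vec_upd p c (of_nat t)) c' x)" for x
        unfolding h_def by (intro arg_cong[where f=f]) (auto simp: vec_upd_def vec_eq_iff)
      then show ?thesis using insert.prems(2)[of "vec_upd p c (of_nat t)" c'] by presburger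
    qed
  qed
  have "f p = (\<Sum>k\<le>N. \<Sum>t\<le>N. L k t * h t p * (p $ c) ^ k)" for p
  proof -
    obtain a where a: "\<And>x. f (vec_upd p c x) = (\<Sum>k\<le>N. a k * x ^ k)"
      using insert.prems(2)[of p c] by blast
    have ak: "a k = (\<Sum>t\<le>N. L k t * h t p)" if "k \<le> N" for k
      using L[OF that, of a] by (simp add: a[symmetric] h_def)
    have "vec_upd p c (p $ c) = p" by (simp add: vec_upd_def vec_eq_iff)
    then have "f p = (\<Sum>k\<le>N. a k * (p $ c) ^ k)" using a[of "p $ c"] by simp
    then show ?thesis by (simp add: ak sum_distrib_right)
  qed
  then have "f = (\<lambda>p. \<Sum>k\<le>N. \<Sum>t\<le>N. L k t * h t p * (p $ c) ^ k)" by blast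
  moreover have "is_polyfun (\<lambda>p. \<Sum>k\<le>N. \<Sum>t\<le>N. L k t * h t p * (p $ c) ^ k)"
    by (intro is_polyfun_sum is_polyfun_mult_coordinate_power h_poly)
  ultimately show ?case by (rule ssubst[where P=is_polyfun])
qed

section \<open>Entire functions of polynomial growth\<close>

lemma norm_vec_scale: "norm (x *s p) = cmod x * norm (p :: complex^'m)"
  by (simp add: norm_vec_def norm_mult L2_set_right_distrib)

lemma polynomial_growth_on_line:
  fixes f :: "complex^'m \<Rightarrow> complex"
  assumes f: "holomorphic_several_on UNIV f" and g: "\<And>p. cmod (f p) \<le> C * (1 + norm p) ^ N"
  shows "\<exists>a. \<forall>x. f (p + x *s q) = (\<Sum>k\<le>N. a k * x ^ k)"
proof -
  have C: "C \<ge> 0" using order_trans[OF norm_ge_zero g[of 0]] by simp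
  have hol: "(\<lambda>x. f (p + x *s q)) holomorphic_on UNIV"
    unfolding holomorphic_on_def
  proof
    fix x
    obtain D where D: "(f has_derivative D) (at (p + x *s q))" "\<And>c v. D (c *s v) = c * D v"
      using f unfolding holomorphic_several_on_def by blast
    have "((\<lambda>x. p + x *s q) has_derivative (\<lambda>h. h *s q)) (at x)"
      by (rule has_derivative_vec_lambda) (auto intro!: derivative_eq_intros)
    then have "((\<lambda>x. f (p + x *s q)) has_derivative (\<lambda>h. D (h *s q))) (at x)"
      using has_derivative_compose[of "\<lambda>x. p + x *s q" _ x UNIV f D] D(1) by blast
    then have "((\<lambda>x. f (p + x *s q)) has_field_derivative D q) (at x)"
      by (simp add: D(2) has_field_derivative_def mult.commute[of _ "D q"])
    then show "(\<lambda>x. f (p + x *s q)) field_differentiable at x within UNIV"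
      unfolding field_differentiable_def by blast
  qed
  have "norm (f (p + x *s q)) \<le> (C * (1 + norm p + norm q) ^ N) * norm x ^ N" if x: "1 \<le> norm x" for x
  proof -
    have "norm (p + x *s q) \<le> norm p + norm x * norm q"
      using norm_triangle_ineq[of p "x *s q"] by (simp add: norm_vec_scale)
    moreover have "norm p \<le> norm x * norm p" "1 \<le> norm x" using x by (auto simp: mult_le_cancel_right1)
    ultimately have "1 + norm (p + x *s q) \<le> (1 + norm p + norm q) * norm x"
      by (simp add: algebra_simps)
    then have "(1 + norm (p + x *s q)) ^ N \<le> ((1 + norm p + norm q) * norm x) ^ N"
      by (intro power_mono) auto
    then have "C * (1 + norm (p + x *s q)) ^ N \<le> C * ((1 + norm p + norm q) * norm x) ^ N"
      using C by (rule mult_left_mono)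
    then show ?thesis using g[of "p + x *s q"] by (simp add: power_mult_distrib mult.assoc)
  qed
  then have "f (p + x *s q) = (\<Sum>k\<le>N. (deriv ^^ k) (\<lambda>x. f (p + x *s q)) 0 / fact k * x ^ k)" for x
    using Liouville_polynomial[OF hol, of 1] by blast
  then show ?thesis by (intro exI allI)
qed

text \<open>Separate polynomiality bounds the degree in each variable only. For the total degree, f
  is restricted to lines through 0: its homogeneous part of degree k is the coefficient of
  \<open>x^k\<close>, which the growth forces to vanish for k > N. The monomials of such degrees can
  then be dropped together.\<close>

lemma Liouville_several:
  fixes f :: "complex^'m \<Rightarrow> complex"
  assumes f: "holomorphic_several_on UNIV f" and g: "\<And>p. cmod (f p) \<le> C * (1 + norm p) ^ N"
  obtains A c where "finite A" "\<And>\<alpha>. \<alpha> \<in> A \<Longrightarrow> (\<Sum>i\<in>UNIV. \<alpha> i) \<le> N"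
    "\<And>p. f p = (\<Sum>\<alpha>\<in>A. c \<alpha> * cmonom \<alpha> p)"
proof -
  have "is_polyfun f"
  proof (rule separately_polynomial_imp_polyfun[where I=UNIV])
    show "\<exists>a. \<forall>x. f (vec_upd p c x) = (\<Sum>k\<le>N. a k * x ^ k)" for p c
    proof -
      have line: "vec_upd p c x = vec_upd p c 0 + x *s axis c 1" for x
        by (auto simp: vec_upd_def vec_eq_iff axis_def)
      show ?thesis by (subst line) (rule polynomial_growth_on_line[OF assms])
    qed
  qed (auto simp: vec_eq_iff intro!: arg_cong[where f=f])
  then obtain A c where A: "finite A" "\<And>p. f p = (\<Sum>\<alpha>\<in>A. c \<alpha> * cmonom \<alpha> p)"
    unfolding is_polyfun_def by blast
  let ?deg = "\<lambda>\<alpha> :: 'm \<Rightarrow> nat. \<Sum>i\<in>UNIV. \<alpha> i"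
  \<comment> \<open>A crude common bound of N and of all degrees that occur in A.\<close>
  define M where "M = N + (\<Sum>\<alpha>\<in>A. ?deg \<alpha>)"
  have M: "?deg ` A \<subseteq> {..M}" using A(1) by (auto simp: M_def intro: member_le_sum trans_le_add2)
  define P where "P p k = (\<Sum>\<alpha>\<in>{\<alpha>\<in>A. ?deg \<alpha> = k}. c \<alpha> * cmonom \<alpha> p)" for p k
  have fP: "f (x *s p) = (\<Sum>k\<le>M. P p k * x ^ k)" for x p
  proof -
    have "f (x *s p) = (\<Sum>k\<le>M. \<Sum>\<alpha>\<in>{\<alpha>\<in>A. ?deg \<alpha> = k}. c \<alpha> * cmonom \<alpha> (x *s p))"
      unfolding A(2) by (rule sum.group[OF A(1) _ M, symmetric]) simp
    also have "\<dots> = (\<Sum>k\<le>M. P p k * x ^ k)"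
      unfolding P_def sum_distrib_right
      by (intro sum.cong refl) (auto simp: cmonom_scale mult_ac)
    finally show ?thesis .
  qed
  have P0: "P p k = 0" if "k > N" "k \<le> M" for p k
  proof -
    obtain a where a: "\<And>x. f (0 + x *s p) = (\<Sum>k\<le>N. a k * x ^ k)"
      using polynomial_growth_on_line[OF assms, of 0 p] by blast
    have "(\<Sum>k\<le>M. P p k * x ^ k) = (\<Sum>k\<le>M. (if k \<le> N then a k else 0) * x ^ k)" for x
    proof -
      have "(\<Sum>k\<le>M. (if k \<le> N then a k else 0) * x ^ k) = (\<Sum>k\<le>N. (if k \<le> N then a k else 0) * x ^ k)"
        by (intro sum.mono_neutral_right) (auto simp: M_def)
      also have "\<dots> = (\<Sum>k\<le>N. a k * x ^ k)" by (intro sum.cong) auto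
      also have "\<dots> = f (x *s p)" using a[of x] by simp
      finally show ?thesis unfolding fP ..
    qed
    then have "\<forall>k\<le>M. P p k = (if k \<le> N then a k else 0)"
      by (intro iffD1[OF polyfun_eq_coeffs] allI)
    then show ?thesis using that by simp
  qed
  show thesis
  proof
    show "finite {\<alpha>\<in>A. ?deg \<alpha> \<le> N}" using A(1) by simp
    show "f p = (\<Sum>\<alpha>\<in>{\<alpha>\<in>A. ?deg \<alpha> \<le> N}. c \<alpha> * cmonom \<alpha> p)" for p
    proof -
      have "f p = (\<Sum>k\<le>M. P p k)" using fP[of 1 p] by simp
      also have "\<dots> = (\<Sum>k\<le>N. P p k)"
        by (rule sum.mono_neutral_right) (auto simp: M_def intro!: P0)
      also have "\<dots> = (\<Sum>k\<le>N. \<Sum>\<alpha>\<in>{\<alpha>\<in>{\<alpha>\<in>A. ?deg \<alpha> \<le> N}. ?deg \<alpha> = k}. c \<alpha> * cmonom \<alpha> p)"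
        unfolding P_def by (intro sum.cong) auto
      also have "\<dots> = (\<Sum>\<alpha>\<in>{\<alpha>\<in>A. ?deg \<alpha> \<le> N}. c \<alpha> * cmonom \<alpha> p)"
        by (rule sum.group) (use A(1) in auto)
      finally show ?thesis .
    qed
  qed auto
qed

text \<open>Compactness of the unit sphere gives C; homogeneity spreads the bound radially.\<close>

lemma homogeneous_growth:
  fixes \<Psi> :: "complex^'m \<Rightarrow> complex"
  assumes hol: "holomorphic_several_on (- {0}) \<Psi>"
    and hom: "\<And>c w. c \<noteq> 0 \<Longrightarrow> w \<noteq> 0 \<Longrightarrow> \<Psi> (c *s w) = c ^ N * \<Psi> w"
  obtains C where "C \<ge> 0" "\<And>w. w \<noteq> 0 \<Longrightarrow> cmod (\<Psi> w) \<le> C * norm w ^ N"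
proof -
  have "continuous_on (sphere 0 1) \<Psi>"
    by (rule continuous_on_subset[OF holomorphic_several_on_imp_continuous_on[OF hol]]) auto
  then have "compact (\<Psi> ` sphere 0 1)" by (rule compact_continuous_image) simp
  then obtain C where C: "C > 0" "\<And>w. norm w = 1 \<Longrightarrow> cmod (\<Psi> w) \<le> C"
    using compact_imp_bounded[of "\<Psi> ` sphere 0 1"] unfolding bounded_pos by auto
  have "cmod (\<Psi> w) \<le> C * norm w ^ N" if w: "w \<noteq> 0" for w
  proof -
    define r where "r = complex_of_real (norm w)"
    have r: "r \<noteq> 0" "cmod r = norm w" using w by (auto simp: r_def)
    have "w = r *s (inverse r *s w)" using r by (simp add: vec_eq_iff)
    then have "\<Psi> w = r ^ N * \<Psi> (inverse r *s w)" using hom[of r "inverse r *s w"] r w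
      by (metis vector_mul_eq_0)
    moreover have "norm (inverse r *s w) = 1" using r w by (simp add: norm_vec_scale norm_inverse)
    ultimately show ?thesis
      using C(2)[of "inverse r *s w"] r(2) by (simp add: norm_mult norm_power mult.commute[of _ "norm w ^ N"] mult_left_mono)
  qed
  then show thesis using C(1) that[of C] by simp
qed

text \<open>On the affine hyperplane \<open>w $ k0 = 1\<close>, which avoids the origin, the growth
  estimate turns \<open>\<Psi>\<close> into an entire function of polynomial growth. Homogenising
  gives the formula for \<open>w $ k0 \<noteq> 0\<close>, and continuity away from the origin gives
  the rest.\<close>

theorem homogeneous_holomorphic_imp_polynomial:
  fixes \<Psi> :: "complex^'m \<Rightarrow> complex"
  assumes hol: "holomorphic_several_on (- {0}) \<Psi>"
    and hom: "\<And>c w. c \<noteq> 0 \<Longrightarrow> w \<noteq> 0 \<Longrightarrow> \<Psi> (c *s w) = c ^ N * \<Psi> w"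
  obtains a where "\<And>w. w \<noteq> 0 \<Longrightarrow> \<Psi> w = (\<Sum>\<beta> | (\<Sum>i\<in>UNIV. \<beta> i) = N. a \<beta> * cmonom \<beta> w)"
proof -
  obtain C where C: "C \<ge> 0" "\<And>w. w \<noteq> 0 \<Longrightarrow> cmod (\<Psi> w) \<le> C * norm w ^ N"
    using homogeneous_growth[OF assms] by blast
  define k0 :: 'm where "k0 = undefined"
  define K where "K = norm (axis k0 1 :: complex^'m)"
  have upd0: "vec_upd y k0 1 \<noteq> 0" for y :: "complex^'m"
    by (auto simp: vec_upd_def vec_eq_iff)
  have upd_norm: "norm (vec_upd y k0 1) \<le> (1 + K) * (1 + norm y)" for y :: "complex^'m"
  proof -
    have "vec_upd y k0 1 = y + (1 - y $ k0) *s axis k0 1"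
      by (auto simp: vec_upd_def vec_eq_iff axis_def)
    then have "norm (vec_upd y k0 1) \<le> norm y + cmod (1 - y $ k0) * K"
      using norm_triangle_ineq[of y "(1 - y $ k0) *s axis k0 1"] unfolding norm_vec_scale K_def by simp
    moreover have "cmod (1 - y $ k0) \<le> 1 + norm y"
      using norm_triangle_ineq4[of 1 "y $ k0"] Finite_Cartesian_Product.norm_nth_le[of y k0] by simp
    then have "cmod (1 - y $ k0) * K \<le> (1 + norm y) * K" by (simp add: K_def mult_right_mono)
    ultimately show ?thesis by (simp add: algebra_simps K_def)
  qed
  have f_hol: "holomorphic_several_on UNIV (\<lambda>y. \<Psi> (vec_upd y k0 1))"
  proof (rule holomorphic_several_on_compose[OF hol])
    show "holomorphic_several_on UNIV (\<lambda>y. (vec_upd y k0 1 :: complex^'m) $ k)" for k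
      by (cases "k = k0")
         (auto simp: vec_upd_def intro: holomorphic_several_on_const holomorphic_several_on_coordinate)
  qed (use upd0 in auto)
  have f_growth: "cmod (\<Psi> (vec_upd y k0 1)) \<le> (C * (1 + K) ^ N) * (1 + norm y) ^ N" for y
  proof -
    have "norm (vec_upd y k0 1) ^ N \<le> ((1 + K) * (1 + norm y)) ^ N"
      by (rule power_mono[OF upd_norm]) simp
    then have "C * norm (vec_upd y k0 1) ^ N \<le> C * ((1 + K) * (1 + norm y)) ^ N"
      using C(1) by (rule mult_left_mono)
    then show ?thesis using C(2)[OF upd0, of y] by (simp add: power_mult_distrib mult.assoc)
  qed
  obtain A c where A: "finite A" "\<And>\<alpha>. \<alpha> \<in> A \<Longrightarrow> (\<Sum>i\<in>UNIV. \<alpha> i) \<le> N"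
    "\<And>y. \<Psi> (vec_upd y k0 1) = (\<Sum>\<alpha>\<in>A. c \<alpha> * cmonom \<alpha> y)"
    by (rule Liouville_several[OF f_hol f_growth]) blast
  let ?E = "{\<beta> :: 'm \<Rightarrow> nat. (\<Sum>i\<in>UNIV. \<beta> i) = N}"
  \<comment> \<open>Homogenisation: the exponent of k0 is raised until the total degree is N.
    Different \<open>\<alpha>\<close> may become equal, so their coefficients are collected in
    a.\<close>
  define \<phi> where "\<phi> \<alpha> = \<alpha>(k0 := \<alpha> k0 + (N - (\<Sum>i\<in>UNIV. \<alpha> i)))" for \<alpha> :: "'m \<Rightarrow> nat"
  define a where "a \<beta> = (\<Sum>\<alpha>\<in>{\<alpha>\<in>A. \<phi> \<alpha> = \<beta>}. c \<alpha>)" for \<beta>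
  have \<phi>: "\<phi> ` A \<subseteq> ?E"
  proof -
    have "(\<Sum>i\<in>UNIV. \<phi> \<alpha> i) = N" if "\<alpha> \<in> A" for \<alpha>
    proof -
      have "(\<Sum>i\<in>UNIV. \<phi> \<alpha> i) = (\<Sum>i\<in>UNIV. \<alpha> i + (if i = k0 then N - (\<Sum>i\<in>UNIV. \<alpha> i) else 0))"
        unfolding \<phi>_def by (intro sum.cong) auto
      then show ?thesis using A(2)[OF that] by (simp add: sum.distrib)
    qed
    then show ?thesis by auto
  qed
  have main: "\<Psi> w = (\<Sum>\<beta>\<in>?E. a \<beta> * cmonom \<beta> w)" if w: "w $ k0 \<noteq> 0" for w
  proof -
    define x where "x = inverse (w $ k0)"
    have x: "x \<noteq> 0" using w by (simp add: x_def)
    have w0: "w \<noteq> 0" using w by auto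
    have "vec_upd (x *s w) k0 1 = x *s w" using w by (simp add: vec_upd_def vec_eq_iff x_def)
    then have "\<Psi> (x *s w) = (\<Sum>\<alpha>\<in>A. c \<alpha> * cmonom \<alpha> (x *s w))" using A(3)[of "x *s w"] by simp
    then have "x ^ N * \<Psi> w = (\<Sum>\<alpha>\<in>A. c \<alpha> * cmonom \<alpha> (x *s w))" using hom[OF x w0] by simp
    then have "(w $ k0) ^ N * (x ^ N * \<Psi> w) = (\<Sum>\<alpha>\<in>A. (w $ k0) ^ N * (c \<alpha> * cmonom \<alpha> (x *s w)))"
      by (simp add: sum_distrib_left)
    moreover have "(w $ k0) ^ N * (x ^ N * \<Psi> w) = \<Psi> w" using w by (simp add: x_def power_inverse)
    moreover have "(w $ k0) ^ N * (c \<alpha> * cmonom \<alpha> (x *s w)) = c \<alpha> * cmonom (\<phi> \<alpha>) w" if "\<alpha> \<in> A" for \<alpha>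
    proof -
      have "(w $ k0) ^ N * x ^ (\<Sum>i\<in>UNIV. \<alpha> i) = (w $ k0) ^ (N - (\<Sum>i\<in>UNIV. \<alpha> i))"
        using A(2)[OF that] w by (simp add: x_def power_diff power_inverse divide_inverse)
      then show ?thesis by (simp add: \<phi>_def cmonom_shift cmonom_scale mult_ac)
    qed
    ultimately have "\<Psi> w = (\<Sum>\<alpha>\<in>A. c \<alpha> * cmonom (\<phi> \<alpha>) w)" by simp
    then show ?thesis
      using sum_cmonom_regroup[OF A(1) finite_exponents \<phi>, of c w] by (simp add: a_def)
  qed
  show thesis
  proof
    fix w :: "complex^'m" assume w: "w \<noteq> 0"
    show "\<Psi> w = (\<Sum>\<beta>\<in>?E. a \<beta> * cmonom \<beta> w)"
    proof (cases "w $ k0 = 0")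
      case True
      \<comment> \<open>Points off the hyperplane \<open>w $ k0 = 0\<close> that converge to
        w.\<close>
      define v where "v n = w + inverse (of_nat (Suc n)) *s axis k0 1" for n
      have "(\<lambda>n. inverse (complex_of_nat (Suc n))) \<longlonglongrightarrow> 0"
        using lim_inverse_n[where 'a=complex] by (rule LIMSEQ_Suc)
      then have v: "v \<longlonglongrightarrow> w"
      proof -
        have "(\<lambda>n. v n $ i) \<longlonglongrightarrow> w $ i" for i
        proof (cases "i = k0")
          case True
          then show ?thesis
            using tendsto_add[OF tendsto_const \<open>(\<lambda>n. inverse (complex_of_nat (Suc n))) \<longlonglongrightarrow> 0\<close>, of "w $ i"]
            by (simp add: v_def axis_def)
        qed (simp add: v_def axis_def)
        then show ?thesis by (rule vec_tendstoI)
      qed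
      have vk: "v n $ k0 \<noteq> 0" for n
      proof -
        have "v n $ k0 = inverse (of_nat (Suc n))" using True by (simp add: v_def axis_def)
        then show ?thesis by (metis inverse_nonzero_iff_nonzero of_nat_neq_0)
      qed
      have "isCont \<Psi> w"
        using holomorphic_several_on_imp_continuous_on[OF hol] w
        by (auto simp: continuous_on_eq_continuous_at open_Compl)
      then have 1: "(\<lambda>n. \<Psi> (v n)) \<longlonglongrightarrow> \<Psi> w" using v by (rule isCont_tendsto_compose)
      have "continuous_on UNIV (\<lambda>w. \<Sum>\<beta>\<in>?E. a \<beta> * cmonom \<beta> w)"
        by (intro continuous_intros holomorphic_several_on_imp_continuous_on holomorphic_several_on_cmonom)
      then have "isCont (\<lambda>w. \<Sum>\<beta>\<in>?E. a \<beta> * cmonom \<beta> w) w"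
        by (simp add: continuous_on_eq_continuous_at)
      then have "(\<lambda>n. \<Sum>\<beta>\<in>?E. a \<beta> * cmonom \<beta> (v n)) \<longlonglongrightarrow> (\<Sum>\<beta>\<in>?E. a \<beta> * cmonom \<beta> w)"
        using v by (rule isCont_tendsto_compose)
      then have "(\<lambda>n. \<Psi> (v n)) \<longlonglongrightarrow> (\<Sum>\<beta>\<in>?E. a \<beta> * cmonom \<beta> w)" by (simp add: main[OF vk])
      with 1 show ?thesis by (rule LIMSEQ_unique)
    qed (rule main)
  qed
qed

section \<open>Prequantum line bundles on toric quotients\<close>

text \<open>Makes arbitrary smooth metrics accessible to \<open>i_ddbar_eq\<close>: for a potential
  of class C^2 the iterated Wirtinger derivatives serve as coefficients.\<close>

lemma C_k_on_imp_has_ddbar: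
  assumes S: "open S" and K: "C_k_on (Suc (Suc 0)) S K"
  shows "has_ddbar S K (\<lambda>j k. wirtinger j (wirtinger_bar k (\<lambda>q. complex_of_real (K q))))"
proof -
  obtain d where d: "\<And>p. p \<in> S \<Longrightarrow> (K has_derivative d p) (at p)"
    and d1: "\<And>w. C_k_on (Suc 0) S (\<lambda>p. d p w)" using C_k_on_SucE[OF K] by blast
  have dK: "((\<lambda>q. complex_of_real (K q)) has_derivative (\<lambda>v. of_real (d p v))) (at p)" if "p \<in> S" for p
    by (rule has_derivative_of_real[OF d[OF that]])
  have wb: "(complex_of_real (d p (axis k 1)) + \<i> * complex_of_real (d p (axis k \<i>))) / 2 =
      wirtinger_bar k (\<lambda>q. complex_of_real (K q)) p" if "p \<in> S" for k p
    using frechet_derivative_at[OF dK[OF that], symmetric] by (simp add: wirtinger_bar_def)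
  have "wirtinger_bar k (\<lambda>q. complex_of_real (K q)) differentiable (at p)" if p: "p \<in> S" for k p
  proof -
    have "\<exists>D. ((\<lambda>p. d p w) has_derivative D) (at p)" for w
      using d1[of w] p by (auto simp: differentiable_def)
    then obtain e where e: "\<And>w. ((\<lambda>p. d p w) has_derivative e w) (at p)" by metis
    have "((\<lambda>p. (complex_of_real (d p (axis k 1)) + \<i> * complex_of_real (d p (axis k \<i>))) / 2) has_derivative
        (\<lambda>v. (complex_of_real (e (axis k 1) v) + \<i> * complex_of_real (e (axis k \<i>) v)) / 2)) (at p)"
      by (intro bounded_linear.has_derivative[OF bounded_linear_divide] has_derivative_add
          has_derivative_mult_right has_derivative_of_real e)
    then have "(wirtinger_bar k (\<lambda>q. complex_of_real (K q)) has_derivative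
        (\<lambda>v. (complex_of_real (e (axis k 1) v) + \<i> * complex_of_real (e (axis k \<i>) v)) / 2)) (at p)"
      by (rule has_derivative_transform_within_open[OF _ S p]) (rule wb)
    then show ?thesis unfolding differentiable_def by blast
  qed
  then show ?thesis unfolding has_ddbar_def
    by (intro exI[of _ "\<lambda>k. wirtinger_bar k (\<lambda>q. complex_of_real (K q))"])
       (use dK in \<open>auto simp: differentiable_def\<close>)
qed

lemma hermitian_form_eq_zero_imp:
  fixes M :: "'m::finite \<Rightarrow> 'm \<Rightarrow> complex"
  assumes "\<And>u v :: complex^'m. (\<Sum>j\<in>UNIV. \<Sum>k\<in>UNIV. M j k * (u $ j * cnj (v $ k) - v $ j * cnj (u $ k))) = 0"
  shows "M j k = 0"
proof -
  have ax: "(\<Sum>j\<in>UNIV. \<Sum>k\<in>UNIV. M j k * ((axis i x :: complex^'m) $ j * cnj ((axis l y :: complex^'m) $ k)))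
      = M i l * (x * cnj y)" for i l x y
  proof -
    have "(\<Sum>j\<in>UNIV. \<Sum>k\<in>UNIV. M j k * ((axis i x :: complex^'m) $ j * cnj ((axis l y :: complex^'m) $ k)))
      = (\<Sum>j\<in>UNIV. \<Sum>k\<in>UNIV. if k = l then (if j = i then M j k * (x * cnj y) else 0) else 0)"
      by (intro sum.cong refl) (auto simp: axis_def)
    then show ?thesis by simp
  qed
  have *: "M j k * (x * cnj y) = M k j * (y * cnj x)" for x y
    using assms[of "axis j x" "axis k y"] ax by (simp add: right_diff_distrib sum_subtractf)
  \<comment> \<open>The first instance gives \<open>M j k = M k j\<close>, the second
    \<open>M j k = - M k j\<close>.\<close>
  show ?thesis using *[of 1 1] *[of \<i> 1] by simp
qed

lemma unit_modulus_holomorphic_constant: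
  assumes S: "open S" "connected S" and hol: "holomorphic_several_on S \<gamma>"
    and one: "\<And>p. p \<in> S \<Longrightarrow> cmod (\<gamma> p) = 1"
  shows "\<gamma> constant_on S"
proof -
  obtain D where D: "\<And>p. p \<in> S \<Longrightarrow> (\<gamma> has_derivative D p) (at p)"
    "\<And>p c v. p \<in> S \<Longrightarrow> D p (c *s v) = c * D p v"
    using hol holomorphic_several_onE by blast
  have "D p = (\<lambda>_. 0)" if p: "p \<in> S" for p
  proof
    fix v
    have "((\<lambda>p. \<gamma> p * cnj (\<gamma> p)) has_derivative (\<lambda>v. \<gamma> p * cnj (D p v) + D p v * cnj (\<gamma> p))) (at p)"
      by (intro has_derivative_mult has_derivative_cnj D(1) p)
    moreover have "((\<lambda>p. \<gamma> p * cnj (\<gamma> p)) has_derivative (\<lambda>v. 0)) (at p)"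
      by (rule has_derivative_transform_within_open[OF has_derivative_const[of "1::complex"] S(1) p])
         (simp add: complex_mult_cnj cmod_power2[symmetric] one)
    ultimately have "(\<lambda>v. \<gamma> p * cnj (D p v) + D p v * cnj (\<gamma> p)) = (\<lambda>v. 0)"
      by (rule has_derivative_unique)
    then have *: "\<gamma> p * cnj (D p v) + D p v * cnj (\<gamma> p) = 0" for v by (rule fun_cong)
    \<comment> \<open>The derivative of \<open>\<gamma> * cnj \<gamma> = 1\<close> in the directions
      v and i v, the latter divided by i; adding the two isolates \<open>D p v\<close>.\<close>
    have "\<gamma> p * cnj (D p v) + D p v * cnj (\<gamma> p) = 0" "- (\<gamma> p * cnj (D p v)) + D p v * cnj (\<gamma> p) = 0"
      using *[of v] *[of "\<i> *s v"] D(2)[OF p] by (simp_all add: algebra_simps)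
    then have "D p v * cnj (\<gamma> p) = 0" by (simp add: add_eq_0_iff)
    then show "D p v = 0" using one[OF p] by auto
  qed
  then have "\<forall>p\<in>S - {}. (\<gamma> has_derivative (\<lambda>_. 0)) (at p within S)"
    using D(1) has_derivative_at_withinI by force
  then show ?thesis
    using has_derivative_zero_connected_constant_on[OF S(2,1) finite.emptyI
      holomorphic_several_on_imp_continuous_on[OF hol]] by blast
qed

section \<open>Charts and representatives\<close>

definition nonzero_coords :: "'m set \<Rightarrow> (complex^'m) set" where
  "nonzero_coords A = {p. \<forall>c\<in>A. p $ c \<noteq> 0}"

lemma open_nonzero_coords: "open (nonzero_coords (A :: 'm::finite set))"
proof -
  have "open {p :: complex^'m. p $ c \<noteq> 0}" for c
    by (intro open_Collect_neq continuous_intros)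
  then have "open (\<Inter>c\<in>A. {p :: complex^'m. p $ c \<noteq> 0})" by (intro open_INT) auto
  then show ?thesis by (simp add: nonzero_coords_def Collect_ball_eq)
qed

text \<open>The image of the whole space under exp in the coordinates of A, with preimages given by
  Ln.\<close>

lemma connected_nonzero_coords: "connected (nonzero_coords (A :: 'm::finite set))"
proof -
  define \<epsilon> :: "complex^'m \<Rightarrow> complex^'m" where "\<epsilon> w = (\<chi> c. if c \<in> A then exp (w $ c) else w $ c)" for w
  have "p \<in> range \<epsilon>" if "p \<in> nonzero_coords A" for p
    by (rule image_eqI[where x="\<chi> c. if c \<in> A then Ln (p $ c) else p $ c"])
       (use that in \<open>auto simp: \<epsilon>_def vec_eq_iff nonzero_coords_def\<close>)
  moreover have "\<epsilon> w \<in> nonzero_coords A" for w by (simp add: \<epsilon>_def nonzero_coords_def)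
  ultimately have "nonzero_coords A = range \<epsilon>" by blast
  moreover have "continuous_on UNIV \<epsilon>" unfolding \<epsilon>_def[abs_def]
  proof (rule continuous_on_vec_lambda)
    show "continuous_on UNIV (\<lambda>w :: complex^'m. if c \<in> A then exp (w $ c) else w $ c)" for c
      by (cases "c \<in> A")
        (simp_all add: linear_continuous_on bounded_linear_vec_nth
          continuous_on_exp[OF linear_continuous_on[OF bounded_linear_vec_nth]])
  qed
  ultimately show ?thesis using connected_continuous_image[OF _ connected_UNIV] by metis
qed

text \<open>Functions on the quotient are defined through their values at a chosen representative;
  independence of the choice then amounts to invariance under the torus.\<close>

definition class_rep :: "'a set \<Rightarrow> ('a \<Rightarrow> 'p) \<Rightarrow> 'p \<Rightarrow> 'a" where
  "class_rep X \<pi> P = (SOME p. p \<in> X \<and> \<pi> p = P)"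

lemma class_rep: "P \<in> \<pi> ` X \<Longrightarrow> class_rep X \<pi> P \<in> X \<and> \<pi> (class_rep X \<pi> P) = P"
  unfolding class_rep_def by (rule someI_ex) blast

lemma prequantum_line_bundleD:
  assumes "prequantum_line_bundle X \<pi> U \<omega> g h"
  shows "holomorphic_several_on (lift_set X \<pi> (U i \<inter> U j)) (\<lambda>p. g i j (\<pi> p))"
    and "P \<in> U i \<Longrightarrow> P \<in> U j \<Longrightarrow> g i j P \<noteq> 0"
    and "P \<in> U i \<Longrightarrow> P \<in> U j \<Longrightarrow> P \<in> U k \<Longrightarrow> g i j P * g j k P = g i k P"
    and "C_k_on n (lift_set X \<pi> (U i)) (\<lambda>p. h i (\<pi> p))"
    and "P \<in> U i \<Longrightarrow> h i P > 0"
    and "P \<in> U i \<Longrightarrow> P \<in> U j \<Longrightarrow> h j P = (cmod (g i j P))\<^sup>2 * h i P"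
    and "p \<in> lift_set X \<pi> (U i) \<Longrightarrow> \<omega> p u v = - i_ddbar (\<lambda>q. ln (h i (\<pi> q))) p u v"
proof -
  note defs = prequantum_line_bundle_def hermitian_metric_def holomorphic_line_bundle_def smooth_fun_on_def
  have A: "\<forall>i j. holomorphic_several_on (lift_set X \<pi> (U i \<inter> U j)) (\<lambda>p. g i j (\<pi> p))"
    "\<forall>i j. \<forall>P \<in> U i \<inter> U j. g i j P \<noteq> 0"
    "\<forall>i j k. \<forall>P \<in> U i \<inter> U j \<inter> U k. g i j P * g j k P = g i k P"
    using assms unfolding defs by - (elim conjE, assumption)+
  have B: "\<forall>i n. C_k_on n (lift_set X \<pi> (U i)) (\<lambda>p. h i (\<pi> p))" "\<forall>i. \<forall>P \<in> U i. h i P > 0"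
    "\<forall>i j. \<forall>P \<in> U i \<inter> U j. h j P = (cmod (g i j P))\<^sup>2 * h i P"
    "\<forall>i. \<forall>p \<in> lift_set X \<pi> (U i). \<forall>u v. \<omega> p u v = - i_ddbar (\<lambda>q. ln (h i (\<pi> q))) p u v"
    using assms unfolding defs by - (elim conjE, assumption)+
  show "holomorphic_several_on (lift_set X \<pi> (U i \<inter> U j)) (\<lambda>p. g i j (\<pi> p))" by (rule A(1)[rule_format])
  show "P \<in> U i \<Longrightarrow> P \<in> U j \<Longrightarrow> g i j P \<noteq> 0" by (rule A(2)[rule_format, OF IntI])
  show "P \<in> U i \<Longrightarrow> P \<in> U j \<Longrightarrow> P \<in> U k \<Longrightarrow> g i j P * g j k P = g i k P"
    by (rule A(3)[rule_format, OF IntI[OF IntI]])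
  show "C_k_on n (lift_set X \<pi> (U i)) (\<lambda>p. h i (\<pi> p))" by (rule B(1)[rule_format])
  show "P \<in> U i \<Longrightarrow> h i P > 0" by (rule B(2)[rule_format])
  show "P \<in> U i \<Longrightarrow> P \<in> U j \<Longrightarrow> h j P = (cmod (g i j P))\<^sup>2 * h i P"
    by (rule B(3)[rule_format, OF IntI])
  show "p \<in> lift_set X \<pi> (U i) \<Longrightarrow> \<omega> p u v = - i_ddbar (\<lambda>q. ln (h i (\<pi> q))) p u v"
    by (rule B(4)[rule_format])
qed

text \<open>A toric quotient \<open>\<pi> : X \<rightarrow> M\<close>: the chart \<open>U i\<close> is where the coordinates in \<open>J i\<close> do not vanish,
  and \<open>ret i\<close> moves a point within its class so that these coordinates become 1.\<close>

locale toric_quotient =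
  fixes X :: "(complex^'m::finite) set" and \<pi> :: "complex^'m \<Rightarrow> 'p" and U :: "'i \<Rightarrow> 'p set"
    and J :: "'i \<Rightarrow> 'm set" and ret :: "'i \<Rightarrow> complex^'m \<Rightarrow> complex^'m"
  assumes lift_chart: "lift_set X \<pi> (U i) = nonzero_coords (J i)"
    and chart_image: "U i \<subseteq> \<pi> ` X"
    and ret_one: "p \<in> nonzero_coords (J i) \<Longrightarrow> c \<in> J i \<Longrightarrow> ret i p $ c = 1"
    and class_ret: "p \<in> nonzero_coords (J i) \<Longrightarrow> \<pi> (ret i p) = \<pi> p"
    and holomorphic_ret: "holomorphic_several_on (nonzero_coords (J i)) (\<lambda>p. ret i p $ k)"
    and ret_class: "p \<in> nonzero_coords (J i) \<Longrightarrow> q \<in> nonzero_coords (J i) \<Longrightarrow> \<pi> p = \<pi> q \<Longrightarrow> ret i p = ret i q"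
begin

abbreviation L where "L i \<equiv> nonzero_coords (J i)"
abbreviation rep where "rep \<equiv> class_rep X \<pi>"

lemma L_subset: "L i \<subseteq> X" using lift_chart[of i] unfolding lift_set_def by blast

lemma L_chart: "p \<in> L i \<Longrightarrow> \<pi> p \<in> U i" using lift_chart[of i] unfolding lift_set_def by blast

lemma L_I: "p \<in> X \<Longrightarrow> \<pi> p \<in> U i \<Longrightarrow> p \<in> L i" using lift_chart[of i] unfolding lift_set_def by blast

lemma rep: "P \<in> U i \<Longrightarrow> rep P \<in> L i" "P \<in> U i \<Longrightarrow> \<pi> (rep P) = P"
proof -
  assume P: "P \<in> U i"
  then have "rep P \<in> X \<and> \<pi> (rep P) = P" using class_rep[of P \<pi> X] chart_image[of i] by blast
  then show "rep P \<in> L i" "\<pi> (rep P) = P" using L_I P by auto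
qed

lemma lift_overlap: "lift_set X \<pi> (U i \<inter> U j) = nonzero_coords (J i \<union> J j)"
proof -
  have "lift_set X \<pi> (U i \<inter> U j) = L i \<inter> L j"
    unfolding lift_chart[symmetric] by (auto simp: lift_set_def)
  then show ?thesis by (auto simp: nonzero_coords_def)
qed

lemma one_in_L: "1 \<in> L i" by (simp add: nonzero_coords_def)

text \<open>The candidate is exp (F / 2) with F holomorphic and Re F = ln (h / h0). Such an F is
  constructed on a convex subset S of the chart only. Since \<open>ret i\<close> maps the chart into
  S and preserves classes, composition with it extends the function to all of \<open>L i\<close>, in
  a form that depends on the class alone.\<close>

lemma relative_potential:
  assumes gh: "prequantum_line_bundle X \<pi> U \<omega> g h" and gh0: "prequantum_line_bundle X \<pi> U \<omega> g0 h0"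
  obtains \<psi> where "holomorphic_several_on (L i) (\<lambda>p. \<psi> (\<pi> p))" "\<And>P. P \<in> U i \<Longrightarrow> \<psi> P \<noteq> 0"
    "\<And>P. P \<in> U i \<Longrightarrow> (cmod (\<psi> P))\<^sup>2 * h0 i P = h i P"
proof -
  define K where "K p = ln (h i (\<pi> p))" for p
  define K0 where "K0 p = ln (h0 i (\<pi> p))" for p
  have pos: "h i P > 0" "h0 i P > 0" if "P \<in> U i" for P
    using prequantum_line_bundleD(5)[OF gh that] prequantum_line_bundleD(5)[OF gh0 that] .
  have "C_k_on k (L i) (\<lambda>p. h i (\<pi> p))" "C_k_on k (L i) (\<lambda>p. h0 i (\<pi> p))" for k
    using prequantum_line_bundleD(4)[OF gh] prequantum_line_bundleD(4)[OF gh0] unfolding lift_chart[symmetric] .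
  then have CK: "C_k_on k (L i) K" "C_k_on k (L i) K0" for k
    unfolding K_def[abs_def] K0_def[abs_def]
    by (auto intro!: C_k_on_ln open_nonzero_coords pos L_chart)
  define A where "A = (\<lambda>j k. wirtinger j (wirtinger_bar k (\<lambda>q. complex_of_real (K q))))"
  define A0 where "A0 = (\<lambda>j k. wirtinger j (wirtinger_bar k (\<lambda>q. complex_of_real (K0 q))))"
  have dd: "has_ddbar (L i) K A" "has_ddbar (L i) K0 A0"
    unfolding A_def A0_def
    by (rule C_k_on_imp_has_ddbar[OF open_nonzero_coords CK(1)], rule C_k_on_imp_has_ddbar[OF open_nonzero_coords CK(2)])
  define u where "u p = 1 * K p + (- 1) * K0 p" for p
  have Cu: "C_k_on k (L i) u" for k
    unfolding u_def[abs_def] by (intro C_k_on_add C_k_on_cmult open_nonzero_coords CK)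
  have ddu: "has_ddbar (L i) u (\<lambda>j k p. of_real 1 * A j k p + of_real (- 1) * A0 j k p)"
    unfolding u_def[abs_def] by (rule has_ddbar_linear[OF dd])
  have A_eq: "A j k p = A0 j k p" if p: "p \<in> L i" for j k p
  proof -
    have "i_ddbar K p v w = i_ddbar K0 p v w" for v w
    proof -
      have "\<omega> p v w = - i_ddbar K p v w" "\<omega> p v w = - i_ddbar K0 p v w"
        using prequantum_line_bundleD(7)[OF gh] prequantum_line_bundleD(7)[OF gh0] p
        unfolding lift_chart K_def K0_def by blast+
      then show ?thesis by simp
    qed
    then have "(\<Sum>j\<in>UNIV. \<Sum>k\<in>UNIV. A j k p * (v $ j * cnj (w $ k) - w $ j * cnj (v $ k))) =
      (\<Sum>j\<in>UNIV. \<Sum>k\<in>UNIV. A0 j k p * (v $ j * cnj (w $ k) - w $ j * cnj (v $ k)))" for v w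
      unfolding i_ddbar_eq[OF open_nonzero_coords dd(1) p] i_ddbar_eq[OF open_nonzero_coords dd(2) p] by simp
    then have "A j k p - A0 j k p = 0"
      by (intro hermitian_form_eq_zero_imp[of "\<lambda>j k. A j k p - A0 j k p"])
         (simp add: left_diff_distrib sum_subtractf)
    then show ?thesis by simp
  qed
  have ph: "wirtinger j (wirtinger_bar k (\<lambda>q. complex_of_real (u q))) p = 0" if "p \<in> L i" for j k p
    using has_ddbar_wirtinger[OF open_nonzero_coords ddu that] A_eq[OF that] by simp
  \<comment> \<open>Right half-planes in the coordinates that must not vanish: convex, contained in
    \<open>L i\<close>, and containing the slice where these coordinates are 1.\<close>
  define S where "S = {p. \<forall>c\<in>J i. Re (p $ c) > 0}"
  have S: "open S" "convex S" "1 \<in> S" "S \<subseteq> L i"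
  proof -
    have "open {p :: complex^'m. Re (p $ c) > 0}" for c
      by (intro open_Collect_less continuous_intros)
    then have "open (\<Inter>c\<in>J i. {p :: complex^'m. Re (p $ c) > 0})" by (intro open_INT) auto
    then show "open S" by (simp add: S_def Collect_ball_eq)
    show "convex S" unfolding S_def
    proof (rule convexI)
      fix x y :: "complex^'m" and s t :: real
      assume xy: "x \<in> {p. \<forall>c\<in>J i. 0 < Re (p $ c)}" "y \<in> {p. \<forall>c\<in>J i. 0 < Re (p $ c)}"
        and st: "0 \<le> s" "0 \<le> t" "s + t = 1"
      have "0 < s * Re (x $ c) + t * Re (y $ c)" if "c \<in> J i" for c
      proof (cases "s = 0")
        case False
        then have "0 < s * Re (x $ c)" "0 \<le> t * Re (y $ c)" using xy st that by auto
        then show ?thesis by linarith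
      qed (use xy st that in auto)
      then show "s *\<^sub>R x + t *\<^sub>R y \<in> {p. \<forall>c\<in>J i. 0 < Re (p $ c)}" by simp
    qed
    show "1 \<in> S" by (simp add: S_def)
    show "S \<subseteq> L i" by (auto simp: S_def nonzero_coords_def)
  qed
  obtain F where F: "holomorphic_several_on S F" "\<And>p. p \<in> S \<Longrightarrow> Re (F p) = u p"
    using pluriharmonic_imp_real_part[OF S(1,2,3) C_k_on_subset[OF Cu S(4)]] ph S(4) by blast
  have retS: "ret i p \<in> S" if "p \<in> L i" for p using ret_one[OF that] by (simp add: S_def)
  \<comment> \<open>The factor 1/2 is due to the square in
    \<open>(cmod (\<psi> P))\<^sup>2\<close>.\<close>
  define \<psi> where "\<psi> P = exp (F (ret i (rep P)) * (1 / 2))" for P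
  have \<psi>: "\<psi> (\<pi> p) = exp (F (ret i p) * (1 / 2))" if "p \<in> L i" for p
    unfolding \<psi>_def using ret_class[OF _ that] rep L_chart[OF that] by metis
  show thesis
  proof
    show "holomorphic_several_on (L i) (\<lambda>p. \<psi> (\<pi> p))"
    proof (rule holomorphic_several_on_cong[OF open_nonzero_coords])
      show "holomorphic_several_on (L i) (\<lambda>p. exp (F (ret i p) * (1 / 2)))"
        by (intro holomorphic_several_on_exp holomorphic_several_on_mult holomorphic_several_on_const
            holomorphic_several_on_compose[OF F(1)] retS holomorphic_ret)
    qed (simp add: \<psi>)
    show "\<psi> P \<noteq> 0" for P by (simp add: \<psi>_def)
    show "(cmod (\<psi> P))\<^sup>2 * h0 i P = h i P" if P: "P \<in> U i" for P
    proof -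
      define p where "p = rep P"
      have p: "p \<in> L i" "\<pi> p = P" using rep[OF P] by (auto simp: p_def)
      have "(cmod (\<psi> P))\<^sup>2 = exp (Re (F (ret i p) * (1 / 2))) ^ 2"
        using \<psi>[OF p(1)] p(2) by (simp add: norm_exp_eq_Re)
      also have "\<dots> = exp (u (ret i p))"
        using F(2)[OF retS[OF p(1)]] by (simp add: exp_double[symmetric])
      also have "u (ret i p) = ln (h i P) - ln (h0 i P)"
        using class_ret[OF p(1)] p(2) by (simp add: u_def K_def K0_def)
      also have "exp \<dots> = h i P / h0 i P" using pos[OF P] by (simp add: exp_diff)
      finally show ?thesis using pos[OF P] by simp
    qed
  qed
qed

text \<open>Flat Hermitian line bundles on \<open>M\<close> are trivial: the transition functions can be made unitary, hence
  constant, and a constant cocycle is a coboundary because all charts share the point \<open>(1, \<dots>, 1)\<close>.\<close>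

lemma prequantum_line_bundle_unique:
  assumes gh: "prequantum_line_bundle X \<pi> U \<omega> g h" and gh0: "prequantum_line_bundle X \<pi> U \<omega> g0 h0"
  obtains f where "\<And>i. holomorphic_several_on (L i) (\<lambda>p. f i (\<pi> p))" "\<And>i P. P \<in> U i \<Longrightarrow> f i P \<noteq> 0"
    "\<And>i j P. P \<in> U i \<Longrightarrow> P \<in> U j \<Longrightarrow> g i j P = g0 i j P * f j P / f i P"
proof -
  have "\<forall>i. \<exists>\<psi>. holomorphic_several_on (L i) (\<lambda>p. \<psi> (\<pi> p)) \<and> (\<forall>P\<in>U i. \<psi> P \<noteq> 0) \<and>
      (\<forall>P\<in>U i. (cmod (\<psi> P))\<^sup>2 * h0 i P = h i P)"
    using relative_potential[OF assms] by metis
  then obtain \<psi> where \<psi>: "\<And>i. holomorphic_several_on (L i) (\<lambda>p. \<psi> i (\<pi> p))"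
    "\<And>i P. P \<in> U i \<Longrightarrow> \<psi> i P \<noteq> 0" "\<And>i P. P \<in> U i \<Longrightarrow> (cmod (\<psi> i P))\<^sup>2 * h0 i P = h i P" by metis
  have g0: "g i j P \<noteq> 0" "g0 i j P \<noteq> 0" if "P \<in> U i" "P \<in> U j" for i j P
    using prequantum_line_bundleD(2)[OF gh that] prequantum_line_bundleD(2)[OF gh0 that] .
  \<comment> \<open>The quotient of the two cocycles after the frames have been changed by
    \<open>\<psi>\<close>; it is unitary because the metrics then agree.\<close>
  define \<gamma> where "\<gamma> i j P = g i j P * \<psi> i P / (\<psi> j P * g0 i j P)" for i j P
  have \<gamma>_one: "cmod (\<gamma> i j P) = 1" if P: "P \<in> U i" "P \<in> U j" for i j P
  proof -
    have pos: "h0 i P > 0" by (rule prequantum_line_bundleD(5)[OF gh0 P(1)])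
    have h: "h j P = (cmod (g i j P))\<^sup>2 * h i P" "h0 j P = (cmod (g0 i j P))\<^sup>2 * h0 i P"
      by (rule prequantum_line_bundleD(6)[OF gh P], rule prequantum_line_bundleD(6)[OF gh0 P])
    have "((cmod (\<psi> j P))\<^sup>2 * (cmod (g0 i j P))\<^sup>2) * h0 i P = ((cmod (g i j P))\<^sup>2 * (cmod (\<psi> i P))\<^sup>2) * h0 i P"
      unfolding mult.assoc h[symmetric] \<psi>(3)[OF P(1)] \<psi>(3)[OF P(2)] ..
    then have "(cmod (\<psi> j P) * cmod (g0 i j P))\<^sup>2 = (cmod (g i j P) * cmod (\<psi> i P))\<^sup>2"
      using pos by (simp add: power_mult_distrib)
    then have "cmod (\<psi> j P) * cmod (g0 i j P) = cmod (g i j P) * cmod (\<psi> i P)"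
      by (simp add: power2_eq_iff_nonneg)
    then show ?thesis using \<psi>(2)[OF P(2)] g0[OF P] \<psi>(2)[OF P(1)] by (simp add: \<gamma>_def norm_mult norm_divide)
  qed
  \<comment> \<open>On the connected preimage of the overlap, which contains (1, ..., 1), a
    holomorphic function of modulus 1 is constant.\<close>
  have \<gamma>_const: "\<gamma> i j P = \<gamma> i j (\<pi> 1)" if P: "P \<in> U i" "P \<in> U j" for i j P
  proof -
    let ?L = "nonzero_coords (J i \<union> J j)"
    have sub: "?L \<subseteq> L i" "?L \<subseteq> L j" by (auto simp: nonzero_coords_def)
    have LU: "\<pi> p \<in> U i" "\<pi> p \<in> U j" if "p \<in> ?L" for p using that sub L_chart by auto
    have "holomorphic_several_on ?L (\<lambda>p. g i j (\<pi> p))" "holomorphic_several_on ?L (\<lambda>p. g0 i j (\<pi> p))"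
      using prequantum_line_bundleD(1)[OF gh] prequantum_line_bundleD(1)[OF gh0]
      unfolding lift_overlap[symmetric] .
    then have "holomorphic_several_on ?L (\<lambda>p. \<gamma> i j (\<pi> p))"
      unfolding \<gamma>_def
      by (intro holomorphic_several_on_divide holomorphic_several_on_mult
          holomorphic_several_on_subset[OF \<psi>(1)] sub) (use \<psi>(2) g0 LU in auto)
    then have "(\<lambda>p. \<gamma> i j (\<pi> p)) constant_on ?L"
      by (rule unit_modulus_holomorphic_constant[OF open_nonzero_coords connected_nonzero_coords])
         (use \<gamma>_one LU in auto)
    moreover have "rep P \<in> ?L" using rep(1)[OF P(1)] rep(1)[OF P(2)] by (auto simp: nonzero_coords_def)
    moreover have "1 \<in> ?L" by (auto simp: nonzero_coords_def)
    ultimately have "\<gamma> i j (\<pi> (rep P)) = \<gamma> i j (\<pi> 1)" unfolding constant_on_def by metis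
    then show ?thesis using rep(2)[OF P(1)] by simp
  qed
  define c where "c i j = \<gamma> i j (\<pi> 1)" for i j
  have one_U: "\<pi> 1 \<in> U i" for i using L_chart one_in_L by blast
  have c0: "c i j \<noteq> 0" for i j using \<gamma>_one[OF one_U one_U, of i j] unfolding c_def by auto
  have c_cocycle: "c i j * c j k = c i k" for i j k
  proof -
    have "g i j (\<pi> 1) * g j k (\<pi> 1) = g i k (\<pi> 1)" "g0 i j (\<pi> 1) * g0 j k (\<pi> 1) = g0 i k (\<pi> 1)"
      using prequantum_line_bundleD(3)[OF gh one_U one_U one_U]
        prequantum_line_bundleD(3)[OF gh0 one_U one_U one_U] .
    then show ?thesis unfolding c_def \<gamma>_def using \<psi>(2)[OF one_U] g0[OF one_U one_U]
      by (simp add: field_simps)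
  qed
  \<comment> \<open>An arbitrary base index. The cocycle identity gives
    \<open>c i j = c i0 j / c i0 i\<close>, so the constants \<open>c i0 i\<close> correct the
    frames \<open>\<psi> i\<close>.\<close>
  define i0 :: 'i where "i0 = undefined"
  define f where "f i P = c i0 i * \<psi> i P" for i P
  show thesis
  proof
    show "holomorphic_several_on (L i) (\<lambda>p. f i (\<pi> p))" for i
      unfolding f_def by (intro holomorphic_several_on_mult holomorphic_several_on_const \<psi>(1))
    show "f i P \<noteq> 0" if "P \<in> U i" for i P using \<psi>(2)[OF that] c0 by (simp add: f_def)
    show "g i j P = g0 i j P * f j P / f i P" if P: "P \<in> U i" "P \<in> U j" for i j P
    proof -
      have "g i j P = c i j * g0 i j P * \<psi> j P / \<psi> i P"
      proof -
        have "\<gamma> i j P = c i j" using \<gamma>_const[OF P] by (simp only: c_def)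
        then show ?thesis using \<psi>(2)[OF P(1)] \<psi>(2)[OF P(2)] g0[OF P]
          by (simp add: \<gamma>_def field_simps)
      qed
      also have "c i j = c i0 j / c i0 i" using c_cocycle[of i0 i j] c0[of i0 i] by (simp add: field_simps)
      finally show ?thesis by (simp add: f_def)
    qed
  qed
qed

end

section \<open>Sections and monomials\<close>

lemma sum_fun_apply2: "(\<Sum>b\<in>B. F b) i P = (\<Sum>b\<in>B. F b i P :: complex)"
  by (induction B rule: infinite_finite_induct) auto

interpretation section_space: vector_space scale_section
  by unfold_locales (auto simp: scale_section_def fun_eq_iff algebra_simps)

text \<open>The functions \<open>\<kappa> i\<close> are the frames \<open>e\<^sub>i\<close> in homogeneous coordinates: a section \<open>s\<close>
  corresponds to the function \<open>\<kappa> i \<cdot> s i\<close> on \<open>X\<close>, which is independent of \<open>i\<close> and transforms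
  under the torus by the same character as \<open>\<kappa> i\<close>. The metric is \<open>\<bar>e\<^sub>i\<bar>\<^sup>2 = \<bar>\<kappa> i\<bar>\<^sup>2 N\<close>.\<close>

theorem (in toric_quotient) has_quantization_dim_monomials:
  fixes \<kappa> :: "'i \<Rightarrow> complex^'m \<Rightarrow> complex" and N :: "complex^'m \<Rightarrow> real" and E :: "('m \<Rightarrow> nat) set"
  assumes E: "finite E" and cover: "X \<subseteq> (\<Union>i. L i)"
    and \<kappa>_hol: "\<And>i. holomorphic_several_on (L i) (\<kappa> i)" and \<kappa>0: "\<And>i p. p \<in> L i \<Longrightarrow> \<kappa> i p \<noteq> 0"
    and equi: "\<And>p q. p \<in> X \<Longrightarrow> q \<in> X \<Longrightarrow> \<pi> p = \<pi> q \<Longrightarrow> \<exists>t. t \<noteq> 0 \<and> (\<forall>i. \<kappa> i p = t * \<kappa> i q) \<and>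
        (\<forall>\<beta>\<in>E. cmonom \<beta> p = t * cmonom \<beta> q) \<and> N q = (cmod t)\<^sup>2 * N p"
    and N_pos: "\<And>p. p \<in> X \<Longrightarrow> N p > 0"
    and smooth: "\<And>i k. C_k_on k (L i) (\<lambda>p. (cmod (\<kappa> i p))\<^sup>2 * N p)"
    and curv: "\<And>i p u v. p \<in> L i \<Longrightarrow> \<omega> p u v = - i_ddbar (\<lambda>q. ln ((cmod (\<kappa> i q))\<^sup>2 * N q)) p u v"
    and expand: "\<And>\<Phi>. (\<And>i. holomorphic_several_on (L i) \<Phi>) \<Longrightarrow>
        (\<And>i p q. p \<in> L i \<Longrightarrow> q \<in> L i \<Longrightarrow> \<pi> p = \<pi> q \<Longrightarrow> \<Phi> p * \<kappa> i q = \<Phi> q * \<kappa> i p) \<Longrightarrow>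
        \<exists>a. \<forall>p\<in>X. \<Phi> p = (\<Sum>\<beta>\<in>E. a \<beta> * cmonom \<beta> p)"
  shows "has_quantization_dim X \<pi> U \<omega> (card E)"
proof -
  \<comment> \<open>The standard bundle. Both g0 and h0 are evaluated at a representative: under
    \<open>equi\<close> the factor t cancels in the quotient, and in h0 against the change of
    N.\<close>
  define g0 where "g0 i j P = \<kappa> j (rep P) / \<kappa> i (rep P)" for i j P
  define h0 where "h0 i P = (cmod (\<kappa> i (rep P)))\<^sup>2 * N (rep P)" for i P
  have rep_L: "rep (\<pi> p) \<in> X" "\<pi> (rep (\<pi> p)) = \<pi> p" if "p \<in> X" for p
    using class_rep[of "\<pi> p" \<pi> X] that by auto
  have g0: "g0 i j (\<pi> p) = \<kappa> j p / \<kappa> i p" if "p \<in> X" for i j p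
    using equi[OF rep_L(1)[OF that] that rep_L(2)[OF that]] unfolding g0_def by auto
  have h0: "h0 i (\<pi> p) = (cmod (\<kappa> i p))\<^sup>2 * N p" if "p \<in> X" for i p
    using equi[OF rep_L(1)[OF that] that rep_L(2)[OF that]]
    unfolding h0_def by (auto simp: norm_mult power_mult_distrib)
  have gh0: "prequantum_line_bundle X \<pi> U \<omega> g0 h0"
    unfolding prequantum_line_bundle_def
  proof (intro conjI allI ballI)
    show "holomorphic_line_bundle X \<pi> U g0"
      unfolding holomorphic_line_bundle_def
    proof (intro conjI allI ballI)
      show "holomorphic_several_on (lift_set X \<pi> (U i \<inter> U j)) (\<lambda>p. g0 i j (\<pi> p))" for i j
        unfolding lift_overlap
      proof (rule holomorphic_several_on_cong[OF open_nonzero_coords])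
        have sub: "nonzero_coords (J i \<union> J j) \<subseteq> L i" "nonzero_coords (J i \<union> J j) \<subseteq> L j"
          by (auto simp: nonzero_coords_def)
        then show "holomorphic_several_on (nonzero_coords (J i \<union> J j)) (\<lambda>p. \<kappa> j p / \<kappa> i p)"
          by (intro holomorphic_several_on_divide holomorphic_several_on_subset[OF \<kappa>_hol]) (use \<kappa>0 in auto)
        show "\<kappa> j p / \<kappa> i p = g0 i j (\<pi> p)" if "p \<in> nonzero_coords (J i \<union> J j)" for p
        proof -
          have "p \<in> X" using sub(1) L_subset that by blast
          then show ?thesis by (simp add: g0)
        qed
      qed
      show "g0 i j P \<noteq> 0" if "P \<in> U i \<inter> U j" for i j P
        using \<kappa>0[of "rep P"] rep that by (auto simp: g0_def)
      show "g0 i i P = 1" if "P \<in> U i" for i P using \<kappa>0[of "rep P"] rep that by (auto simp: g0_def)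
      show "g0 i j P * g0 j k P = g0 i k P" if "P \<in> U i \<inter> U j \<inter> U k" for i j k P
        using \<kappa>0[of "rep P"] rep that by (auto simp: g0_def)
    qed
    show "hermitian_metric X \<pi> U g0 h0"
      unfolding hermitian_metric_def
    proof (intro conjI allI ballI)
      show "smooth_fun_on (lift_set X \<pi> (U i)) (\<lambda>p. h0 i (\<pi> p))" for i
        unfolding smooth_fun_on_def lift_chart
        using C_k_on_cong[OF open_nonzero_coords, of "J i" "\<lambda>p. (cmod (\<kappa> i p))\<^sup>2 * N p" "\<lambda>p. h0 i (\<pi> p)"]
          smooth[of _ i] h0[of _ i] L_subset[of i] by (simp add: subset_iff)
      show "h0 i P > 0" if "P \<in> U i" for i P
        using \<kappa>0[OF rep(1)[OF that]] N_pos[OF subsetD[OF L_subset rep(1)[OF that]]] by (simp add: h0_def)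
      show "h0 j P = (cmod (g0 i j P))\<^sup>2 * h0 i P" if "P \<in> U i \<inter> U j" for i j P
        using \<kappa>0[of "rep P" i] rep that by (auto simp: h0_def g0_def norm_divide power_divide)
    qed
    show "\<omega> p u v = - i_ddbar (\<lambda>q. ln (h0 i (\<pi> q))) p u v" if p: "p \<in> lift_set X \<pi> (U i)" for i p u v
    proof -
      \<comment> \<open>The potentials of h0 and of the explicit metric agree on \<open>L i\<close>
        only; as that set is open, so do their forms.\<close>
      have "has_ddbar (L i) (\<lambda>q. ln ((cmod (\<kappa> i q))\<^sup>2 * N q))
          (\<lambda>j k. wirtinger j (wirtinger_bar k (\<lambda>q. complex_of_real (ln ((cmod (\<kappa> i q))\<^sup>2 * N q)))))"
        using \<kappa>0 N_pos[OF subsetD[OF L_subset]]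
        by (intro C_k_on_imp_has_ddbar C_k_on_ln open_nonzero_coords smooth) simp
      note dd = this has_ddbar_cong[OF open_nonzero_coords _ this, of "\<lambda>q. ln (h0 i (\<pi> q))"]
      have "i_ddbar (\<lambda>q. ln (h0 i (\<pi> q))) p u v = i_ddbar (\<lambda>q. ln ((cmod (\<kappa> i q))\<^sup>2 * N q)) p u v"
        using i_ddbar_eq[OF open_nonzero_coords dd(1)] i_ddbar_eq[OF open_nonzero_coords dd(2)] p
          h0[of _ i] L_subset[of i] unfolding lift_chart by (auto simp: subset_iff)
      then show ?thesis using curv p unfolding lift_chart by simp
    qed
  qed
  have dim: "(\<exists>B. finite B \<and> holomorphic_sections X \<pi> U g \<subseteq> section_space.span B) \<and>
      section_space.dim (holomorphic_sections X \<pi> U g) = card E"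
    if gh: "prequantum_line_bundle X \<pi> U \<omega> g h" for g h
  proof -
    obtain f where f: "\<And>i. holomorphic_several_on (L i) (\<lambda>p. f i (\<pi> p))" "\<And>i P. P \<in> U i \<Longrightarrow> f i P \<noteq> 0"
      "\<And>i j P. P \<in> U i \<Longrightarrow> P \<in> U j \<Longrightarrow> g i j P = g0 i j P * f j P / f i P"
      using prequantum_line_bundle_unique[OF gh gh0] by blast
    \<comment> \<open>The section given by a monomial: division by \<open>\<kappa> i\<close>
      expresses it in the frame of the standard bundle, division by \<open>f i\<close> carries it to
      the given bundle.\<close>
    define e where "e \<beta> i P = (if P \<in> U i then cmonom \<beta> (rep P) / (\<kappa> i (rep P) * f i P) else 0)"
      for \<beta> :: "'m \<Rightarrow> nat" and i P
    have e: "e \<beta> i (\<pi> p) = cmonom \<beta> p / (\<kappa> i p * f i (\<pi> p))" if p: "p \<in> L i" and \<beta>: "\<beta> \<in> E" for \<beta> i p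
    proof -
      have pX: "p \<in> X" using p L_subset by blast
      obtain t where "t \<noteq> 0" "\<And>i. \<kappa> i (rep (\<pi> p)) = t * \<kappa> i p" "\<forall>\<beta>\<in>E. cmonom \<beta> (rep (\<pi> p)) = t * cmonom \<beta> p"
        using equi[OF rep_L(1)[OF pX] pX rep_L(2)[OF pX]] by blast
      then show ?thesis using L_chart[OF p] \<beta> by (simp add: e_def)
    qed
    have e_sec: "e \<beta> \<in> holomorphic_sections X \<pi> U g" if \<beta>: "\<beta> \<in> E" for \<beta>
      unfolding holomorphic_sections_def
    proof (intro CollectI conjI allI ballI impI)
      show "holomorphic_several_on (lift_set X \<pi> (U i)) (\<lambda>p. e \<beta> i (\<pi> p))" for i
        unfolding lift_chart
      proof (rule holomorphic_several_on_cong[OF open_nonzero_coords])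
        show "holomorphic_several_on (L i) (\<lambda>p. cmonom \<beta> p / (\<kappa> i p * f i (\<pi> p)))"
          by (intro holomorphic_several_on_divide holomorphic_several_on_mult holomorphic_several_on_cmonom \<kappa>_hol f(1))
             (use \<kappa>0 f(2) L_chart in auto)
      qed (simp add: e \<beta>)
      show "e \<beta> i P = g i j P * e \<beta> j P" if "P \<in> U i \<inter> U j" for i j P
      proof -
        have P: "P \<in> U i" "P \<in> U j" using that by auto
        show ?thesis
          using \<kappa>0[OF rep(1)[OF P(1)]] \<kappa>0[OF rep(1)[OF P(2)]] f(2)[OF P(1)] f(2)[OF P(2)] P
          by (simp add: e_def f(3)[OF P] g0_def)
      qed
      show "e \<beta> i P = 0" if "P \<notin> U i" for i P using that by (simp add: e_def)
    qed
    have e_indep: "a \<beta> = 0" if a: "(\<Sum>\<beta>\<in>E. scale_section (a \<beta>) (e \<beta>)) = 0" and \<beta>: "\<beta> \<in> E" for a \<beta>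
    proof (rule cmonom_independent[OF E _ \<beta>])
      fix p :: "complex^'m" assume p: "\<And>c. p $ c \<noteq> 0"
      \<comment> \<open>Points without vanishing coordinates lie over every chart, so any index
        serves to turn the relation between sections into one between monomials.\<close>
      define i :: 'i where "i = undefined"
      have pL: "p \<in> L i" using p by (simp add: nonzero_coords_def)
      have "(\<Sum>\<beta>\<in>E. scale_section (a \<beta>) (e \<beta>)) i (\<pi> p) = 0" using a by simp
      then have "(\<Sum>\<beta>\<in>E. a \<beta> * (cmonom \<beta> p / (\<kappa> i p * f i (\<pi> p)))) = 0"
        by (simp add: sum_fun_apply2 scale_section_def e[OF pL])
      then have "(\<Sum>\<beta>\<in>E. a \<beta> * cmonom \<beta> p) / (\<kappa> i p * f i (\<pi> p)) = 0"
        by (simp add: sum_divide_distrib)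
      then show "(\<Sum>\<beta>\<in>E. a \<beta> * cmonom \<beta> p) = 0" using \<kappa>0[OF pL] f(2)[OF L_chart[OF pL]] by simp
    qed
    \<comment> \<open>Two equal sections would satisfy the nontrivial relation with coefficients 1
      and -1.\<close>
    have e_inj: "inj_on e E"
    proof (rule inj_onI, rule ccontr)
      fix \<alpha> \<beta> assume ab: "\<alpha> \<in> E" "\<beta> \<in> E" "e \<alpha> = e \<beta>" "\<alpha> \<noteq> \<beta>"
      define a where "a \<gamma> = (if \<gamma> = \<alpha> then 1 else if \<gamma> = \<beta> then - 1 else 0 :: complex)" for \<gamma>
      have "(\<Sum>\<gamma>\<in>E. scale_section (a \<gamma>) (e \<gamma>)) = (\<Sum>\<gamma>\<in>{\<alpha>, \<beta>}. scale_section (a \<gamma>) (e \<gamma>))"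
        by (intro sum.mono_neutral_right) (use E ab in \<open>auto simp: a_def\<close>)
      also have "\<dots> = scale_section (a \<alpha>) (e \<alpha>) + scale_section (a \<beta>) (e \<beta>)" using ab(4) by simp
      also have "\<dots> = 0" unfolding ab(3) using ab(4) by (auto simp: a_def scale_section_def fun_eq_iff)
      finally have "a \<alpha> = 0" using e_indep ab by blast
      then show False by (simp add: a_def)
    qed
    have indep: "section_space.independent (e ` E)"
    proof (rule section_space.independent_if_scalars_zero)
      show "u x = 0" if u: "(\<Sum>x\<in>e ` E. scale_section (u x) x) = 0" and x: "x \<in> e ` E" for u x
      proof -
        have "(\<Sum>\<beta>\<in>E. scale_section (u (e \<beta>)) (e \<beta>)) = 0" using u by (simp add: sum.reindex[OF e_inj])
        then show ?thesis using e_indep[of "\<lambda>\<beta>. u (e \<beta>)"] x by auto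
      qed
    qed (use E in simp)
    have span: "holomorphic_sections X \<pi> U g \<subseteq> section_space.span (e ` E)"
    proof
      fix s assume "s \<in> holomorphic_sections X \<pi> U g"
      then have s: "\<And>i. holomorphic_several_on (L i) (\<lambda>p. s i (\<pi> p))"
        "\<And>i j P. P \<in> U i \<Longrightarrow> P \<in> U j \<Longrightarrow> s i P = g i j P * s j P" "\<And>i P. P \<notin> U i \<Longrightarrow> s i P = 0"
        unfolding holomorphic_sections_def lift_chart by blast+
      \<comment> \<open>The function on X represented by the section; the factors absorb the
        transition functions, so the local expressions glue to \<open>\<Phi>\<close>.\<close>
      define loc where "loc i p = \<kappa> i p * f i (\<pi> p) * s i (\<pi> p)" for i p
      have loc_eq: "loc i p = loc j p" if p: "p \<in> L i" "p \<in> L j" for i j p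
      proof -
        have "s i (\<pi> p) = (\<kappa> j p / \<kappa> i p) * f j (\<pi> p) / f i (\<pi> p) * s j (\<pi> p)"
          using s(2)[OF L_chart[OF p(1)] L_chart[OF p(2)]] f(3)[OF L_chart[OF p(1)] L_chart[OF p(2)]]
            g0[OF subsetD[OF L_subset p(1)], of i j] by simp
        then show ?thesis using \<kappa>0[OF p(1)] f(2)[OF L_chart[OF p(1)]] by (simp add: loc_def)
      qed
      define \<Phi> where "\<Phi> p = loc (SOME i. p \<in> L i) p" for p
      have \<Phi>: "\<Phi> p = loc i p" if "p \<in> L i" for i p
        unfolding \<Phi>_def by (rule loc_eq[OF someI[of "\<lambda>i. p \<in> L i"] that]) (rule that)
      have "\<exists>a. \<forall>p\<in>X. \<Phi> p = (\<Sum>\<beta>\<in>E. a \<beta> * cmonom \<beta> p)"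
      proof (rule expand)
        show "holomorphic_several_on (L i) \<Phi>" for i
        proof (rule holomorphic_several_on_cong[OF open_nonzero_coords])
          show "holomorphic_several_on (L i) (\<lambda>p. loc i p)"
            unfolding loc_def by (intro holomorphic_several_on_mult \<kappa>_hol f(1) s(1))
        qed (simp add: \<Phi>)
        show "\<Phi> p * \<kappa> i q = \<Phi> q * \<kappa> i p" if "p \<in> L i" "q \<in> L i" "\<pi> p = \<pi> q" for i p q
          using that by (simp add: \<Phi>[OF that(1)] \<Phi>[OF that(2)] loc_def)
      qed
      then obtain a where a: "\<And>p. p \<in> X \<Longrightarrow> \<Phi> p = (\<Sum>\<beta>\<in>E. a \<beta> * cmonom \<beta> p)" by blast
      have "s = (\<Sum>\<beta>\<in>E. scale_section (a \<beta>) (e \<beta>))"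
      proof (intro ext)
        fix i P
        show "s i P = (\<Sum>\<beta>\<in>E. scale_section (a \<beta>) (e \<beta>)) i P"
        proof (cases "P \<in> U i")
          case True
          define p where "p = rep P"
          have p: "p \<in> L i" "\<pi> p = P" using rep[OF True] by (auto simp: p_def)
          have "\<kappa> i p * f i P * s i P = (\<Sum>\<beta>\<in>E. a \<beta> * cmonom \<beta> p)"
            using a[of p] \<Phi>[OF p(1)] p L_subset by (auto simp: loc_def)
          then have "s i P = (\<Sum>\<beta>\<in>E. a \<beta> * cmonom \<beta> p) / (\<kappa> i p * f i P)"
            using \<kappa>0[OF p(1)] f(2)[OF True] by (simp add: field_simps)
          then show ?thesis using e[OF p(1)] p(2)
            by (simp add: sum_fun_apply2 scale_section_def sum_divide_distrib)
        qed (simp add: sum_fun_apply2 scale_section_def e_def s(3))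
      qed
      also have "\<dots> \<in> section_space.span (e ` E)"
        by (intro section_space.span_sum section_space.span_scale, rule section_space.span_base) blast
      finally show "s \<in> section_space.span (e ` E)" .
    qed
    have "section_space.dim (holomorphic_sections X \<pi> U g) = card E"
      by (rule section_space.dim_unique[OF _ span indep]) (use e_sec card_image[OF e_inj] in auto)
    then show ?thesis using span E by blast
  qed
  then show ?thesis unfolding has_quantization_dim_def using gh0 by blast
qed

section \<open>Quantization of projective spaces and Hirzebruch fibrations\<close>

lemma i_ddbar_linear:
  assumes "open S" "p \<in> S" "has_ddbar S K A" "has_ddbar S L C"
  shows "i_ddbar (\<lambda>q. a * K q + b * L q) p u v = of_real a * i_ddbar K p u v + of_real b * i_ddbar L p u v"
  unfolding i_ddbar_eq[OF assms(1,3,2)] i_ddbar_eq[OF assms(1,4,2)]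
    i_ddbar_eq[OF assms(1) has_ddbar_linear[OF assms(3,4)] assms(2)]
    sum_distrib_left sum.distrib[symmetric]
  by (intro sum.cong refl) (simp add: algebra_simps)

lemma i_ddbar_cong:
  assumes "open S" "p \<in> S" "has_ddbar S K A" "\<And>q. q \<in> S \<Longrightarrow> K q = L q"
  shows "i_ddbar L p u v = i_ddbar K p u v"
  using i_ddbar_eq[OF assms(1,3,2)] i_ddbar_eq[OF assms(1) has_ddbar_cong[OF assms(1,4,3)] assms(2)] by simp

lemma fs_form_cong:
  assumes "\<And>r. r \<in> R \<Longrightarrow> F r = F' r" "\<And>r. r \<in> R \<Longrightarrow> V r = V' r" "\<And>r. r \<in> R \<Longrightarrow> W r = W' r"
  shows "fs_form R F V W = fs_form R F' V' W'"
  using assms unfolding fs_form_def hprod_def by (simp cong: sum.cong)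

lemma i_ddbar_ln_sum_holomorphic2:
  fixes f :: "'r \<Rightarrow> complex^'m \<Rightarrow> complex"
  assumes S: "open S" "p \<in> S" and f: "\<And>r. r \<in> R \<Longrightarrow> holomorphic2_on S (f r)"
    and pos: "\<And>q. q \<in> S \<Longrightarrow> (\<Sum>r\<in>R. (cmod (f r q))\<^sup>2) > 0"
    and D: "\<And>r. r \<in> R \<Longrightarrow> (f r has_derivative D r) (at p)"
  shows "\<exists>A. has_ddbar S (\<lambda>q. ln (\<Sum>r\<in>R. (cmod (f r q))\<^sup>2)) A"
    "i_ddbar (\<lambda>q. ln (\<Sum>r\<in>R. (cmod (f r q))\<^sup>2)) p u v = fs_form R (\<lambda>r. f r p) (\<lambda>r. D r u) (\<lambda>r. D r v)"
proof -
  have "\<forall>r\<in>R. \<exists>f'. has_partials_on S (f r) f' \<and> (\<forall>j. holomorphic_several_on S (f' j))"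
    using f unfolding holomorphic2_on_def by blast
  then obtain f' where f': "\<And>r. r \<in> R \<Longrightarrow> has_partials_on S (f r) (f' r)"
    "\<And>r j. r \<in> R \<Longrightarrow> holomorphic_several_on S (f' r j)" by metis
  show "\<exists>A. has_ddbar S (\<lambda>q. ln (\<Sum>r\<in>R. (cmod (f r q))\<^sup>2)) A"
    using has_ddbar_ln_sum_norm[of R S f f', OF f' pos] by blast
  have "D r = (\<lambda>v. \<Sum>j\<in>UNIV. v $ j * f' r j p)" if "r \<in> R" for r
    using f'(1)[OF that] S(2) has_derivative_unique[OF D[OF that]] unfolding has_partials_on_def by blast
  then show "i_ddbar (\<lambda>q. ln (\<Sum>r\<in>R. (cmod (f r q))\<^sup>2)) p u v = fs_form R (\<lambda>r. f r p) (\<lambda>r. D r u) (\<lambda>r. D r v)"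
    using i_ddbar_ln_sum_norm[of S p R f f', OF S f' pos] by (auto intro!: fs_form_cong)
qed

lemma sum_norm_sq_pos: "w \<noteq> 0 \<Longrightarrow> (\<Sum>k\<in>UNIV. (cmod ((w :: complex^'m) $ k))\<^sup>2) > 0"
proof -
  assume "w \<noteq> 0"
  then obtain k where "w $ k \<noteq> 0" by (auto simp: vec_eq_iff)
  then show ?thesis by (intro sum_pos2[of _ k]) auto
qed

lemma fubini_study_eq:
  assumes "w \<noteq> 0" shows "fubini_study w u v = fs_form UNIV (($) w) (($) u) (($) v)"
  unfolding fubini_study_def
  by (rule i_ddbar_ln_sum_holomorphic2(2)[where S="- {0}"])
     (use assms in \<open>auto intro!: holomorphic2_on_coordinate sum_norm_sq_pos bounded_linear_imp_has_derivative
        bounded_linear_vec_nth\<close>)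

text \<open>On the set \<open>F r \<noteq> 0\<close>, \<open>\<bar>F r\<bar>\<^sup>2 / \<bar>F\<bar>\<^sup>2\<close> is the squared norm of the section \<open>F r\<close> of the pullback of \<open>O(1)\<close>.\<close>

definition fs_ratio :: "(complex^'m \<Rightarrow> complex^'k) \<Rightarrow> 'k::finite \<Rightarrow> complex^'m \<Rightarrow> real" where
  "fs_ratio F r p = (cmod (F p $ r))\<^sup>2 * inverse (\<Sum>k\<in>UNIV. (cmod (F p $ k))\<^sup>2)"

lemma fs_ratio_pos: "F p $ r \<noteq> 0 \<Longrightarrow> fs_ratio F r p > 0"
  using sum_norm_sq_pos[of "F p"] by (force simp: fs_ratio_def)

text \<open>The logarithm splits as \<open>ln |F r|^2 - ln |F|^2\<close>. The first term is
  pluriharmonic, the second is the pulled back potential; hence the curvature is the same for every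
  r.\<close>

lemma ddbar_ln_fs_ratio:
  fixes F :: "complex^'m \<Rightarrow> complex^'k"
  assumes S: "open S" "p \<in> S" and F: "\<And>k. holomorphic2_on S (\<lambda>p. F p $ k)"
    and r: "\<And>q. q \<in> S \<Longrightarrow> F q $ r \<noteq> 0"
  shows "\<exists>A. has_ddbar S (\<lambda>q. ln (fs_ratio F r q)) A"
    "i_ddbar (\<lambda>q. ln (fs_ratio F r q)) p u v = - pullback_form F fubini_study p u v"
proof -
  have F0: "F q \<noteq> 0" if "q \<in> S" for q using r[OF that] by auto
  have "\<exists>D. ((\<lambda>p. F p $ k) has_derivative D) (at p)" for k
    using holomorphic2_on_imp[OF F[of k]] S(2) unfolding holomorphic_several_on_def by blast
  then obtain D where D: "\<And>k. ((\<lambda>p. F p $ k) has_derivative D k) (at p)" by metis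
  have dF: "(F has_derivative (\<lambda>v. \<chi> k. D k v)) (at p)"
    by (rule has_derivative_vec_lambda) (simp add: D)
  \<comment> \<open>The square of a single component is written as a sum over \<open>{r}\<close>, so
    that the general formula and \<open>fs_form_singleton\<close> apply to it.\<close>
  have pos: "(\<Sum>k\<in>{r}. (cmod (F q $ k))\<^sup>2) > 0" if "q \<in> S" for q using r[OF that] by simp
  have posU: "(\<Sum>k\<in>UNIV. (cmod (F q $ k))\<^sup>2) > 0" if "q \<in> S" for q by (rule sum_norm_sq_pos[OF F0[OF that]])
  have all: "\<exists>A. has_ddbar S (\<lambda>q. ln (\<Sum>k\<in>UNIV. (cmod (F q $ k))\<^sup>2)) A"
    "i_ddbar (\<lambda>q. ln (\<Sum>k\<in>UNIV. (cmod (F q $ k))\<^sup>2)) p u v = fs_form UNIV (\<lambda>k. F p $ k) (\<lambda>k. D k u) (\<lambda>k. D k v)"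
    by (rule i_ddbar_ln_sum_holomorphic2[OF S F posU D]; assumption)+
  have one: "\<exists>A. has_ddbar S (\<lambda>q. ln (\<Sum>k\<in>{r}. (cmod (F q $ k))\<^sup>2)) A"
    "i_ddbar (\<lambda>q. ln (\<Sum>k\<in>{r}. (cmod (F q $ k))\<^sup>2)) p u v = fs_form {r} (\<lambda>k. F p $ k) (\<lambda>k. D k u) (\<lambda>k. D k v)"
    by (rule i_ddbar_ln_sum_holomorphic2[OF S F pos D]; assumption)+
  obtain A where A: "has_ddbar S (\<lambda>q. ln (\<Sum>k\<in>UNIV. (cmod (F q $ k))\<^sup>2)) A" using all(1) by blast
  obtain C where C: "has_ddbar S (\<lambda>q. ln (\<Sum>k\<in>{r}. (cmod (F q $ k))\<^sup>2)) C" using one(1) by blast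
  have eq: "1 * ln (\<Sum>k\<in>{r}. (cmod (F q $ k))\<^sup>2) + (- 1) * ln (\<Sum>k\<in>UNIV. (cmod (F q $ k))\<^sup>2) = ln (fs_ratio F r q)"
    if "q \<in> S" for q
    using r[OF that] sum_norm_sq_pos[OF F0[OF that]] unfolding fs_ratio_def
    by (subst ln_mult_pos) (auto simp: ln_inverse)
  note lin = has_ddbar_linear[OF C A, of 1 "- 1"]
  show "\<exists>A. has_ddbar S (\<lambda>q. ln (fs_ratio F r q)) A"
    using has_ddbar_cong[OF S(1) eq lin] by auto
  have "i_ddbar (\<lambda>q. ln (fs_ratio F r q)) p u v =
      i_ddbar (\<lambda>q. 1 * ln (\<Sum>k\<in>{r}. (cmod (F q $ k))\<^sup>2) + (- 1) * ln (\<Sum>k\<in>UNIV. (cmod (F q $ k))\<^sup>2)) p u v"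
    by (rule i_ddbar_cong[OF S lin eq])
  also have "\<dots> = - fs_form UNIV (\<lambda>k. F p $ k) (\<lambda>k. D k u) (\<lambda>k. D k v)"
    unfolding i_ddbar_linear[OF S C A] one(2) all(2) fs_form_singleton by simp
  also have "fs_form UNIV (\<lambda>k. F p $ k) (\<lambda>k. D k u) (\<lambda>k. D k v) = pullback_form F fubini_study p u v"
    unfolding pullback_form_def fubini_study_eq[OF F0[OF S(2)]] frechet_derivative_at[OF dF, symmetric]
    by (intro fs_form_cong) simp_all
  finally show "i_ddbar (\<lambda>q. ln (fs_ratio F r q)) p u v = - pullback_form F fubini_study p u v" .
qed

lemma pullback_form_ident: "pullback_form (\<lambda>p. p) \<omega> = \<omega>"
  by (intro ext) (simp add: pullback_form_def)

lemma C_k_on_fs_ratio: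
  assumes S: "open S" and F: "\<And>k. C_k_on n S (\<lambda>p. (cmod (F p $ k))\<^sup>2)" and F0: "\<And>p. p \<in> S \<Longrightarrow> F p \<noteq> 0"
  shows "C_k_on n S (fs_ratio F r)"
proof -
  have "C_k_on n S (\<lambda>p. inverse (\<Sum>k\<in>UNIV. (cmod (F p $ k))\<^sup>2))"
    by (rule C_k_on_inverse[OF S _ C_k_on_sum[OF S F]]) (use sum_norm_sq_pos[OF F0] in force)
  then show ?thesis unfolding fs_ratio_def[abs_def] by (intro C_k_on_mult S F)
qed

section \<open>Projective space\<close>

lemma cp_class_eq_iff: "cp_class p = cp_class q \<longleftrightarrow> (\<exists>c. c \<noteq> 0 \<and> p = c *s q)"
proof
  assume "cp_class p = cp_class q"
  moreover have "p \<in> cp_class p" unfolding cp_class_def by (auto intro: exI[of _ 1])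
  ultimately show "\<exists>c. c \<noteq> 0 \<and> p = c *s q" unfolding cp_class_def by auto
next
  assume "\<exists>c. c \<noteq> 0 \<and> p = c *s q"
  then obtain c where c: "c \<noteq> 0" "p = c *s q" by blast
  have "cp_class (c *s q) \<subseteq> cp_class q" if "c \<noteq> 0" for c and q :: "complex^'a"
  proof
    fix w assume "w \<in> cp_class (c *s q)"
    then obtain x where "x \<noteq> 0" "w = x *s (c *s q)" unfolding cp_class_def by blast
    then show "w \<in> cp_class q"
      unfolding cp_class_def using that by (intro CollectI exI[of _ "x * c"]) simp
  qed
  from this[OF c(1), of q] this[of "inverse c" p] c show "cp_class p = cp_class q" by auto
qed

lemma toric_quotient_cp:
  "toric_quotient (cp_cone :: (complex^'m::finite) set) cp_class cp_chart (\<lambda>k. {k}) (\<lambda>k w. inverse (w $ k) *s w)"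
proof
  fix i :: 'm and p q :: "complex^'m" and c k :: 'm
  show "lift_set cp_cone cp_class (cp_chart i) = nonzero_coords {i}"
  proof (intro equalityI subsetI)
    fix w :: "complex^'m" assume "w \<in> lift_set cp_cone cp_class (cp_chart i)"
    then obtain v where "cp_class w = cp_class v" "v $ i \<noteq> 0" unfolding lift_set_def cp_chart_def by auto
    then show "w \<in> nonzero_coords {i}" unfolding cp_class_eq_iff nonzero_coords_def by auto
  next
    fix w :: "complex^'m" assume "w \<in> nonzero_coords {i}"
    then have "w \<in> {w \<in> cp_cone. w $ i \<noteq> 0}" by (auto simp: nonzero_coords_def cp_cone_def)
    then show "w \<in> lift_set cp_cone cp_class (cp_chart i)" unfolding lift_set_def cp_chart_def by blast
  qed
  show "(cp_chart i :: (complex^'m) set set) \<subseteq> cp_class ` cp_cone" unfolding cp_chart_def by auto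
  assume p: "p \<in> nonzero_coords {i}"
  then show "c \<in> {i} \<Longrightarrow> (inverse (p $ i) *s p) $ c = 1" by (auto simp: nonzero_coords_def)
  show "cp_class (inverse (p $ i) *s p) = cp_class p"
    unfolding cp_class_eq_iff using p by (auto simp: nonzero_coords_def intro!: exI[of _ "inverse (p $ i)"])
  assume q: "q \<in> nonzero_coords {i}" and "cp_class p = cp_class q"
  then obtain c where "c \<noteq> 0" "p = c *s q" unfolding cp_class_eq_iff by blast
  then show "inverse (p $ i) *s p = inverse (q $ i) *s q"
    using q by (simp add: vec_eq_iff nonzero_coords_def)
next
  show "holomorphic_several_on (nonzero_coords {i}) (\<lambda>p. (inverse (p $ i) *s p :: complex^'m) $ k)" for i k :: 'm
    by (simp, intro holomorphic_several_on_mult holomorphic_several_on_inverse holomorphic_several_on_coordinate)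
       (auto simp: nonzero_coords_def)
qed

text \<open>The bundle is O(A), with the frame \<open>w_k^A\<close> over chart k and
  \<open>N = |w|^(-2A)\<close>; the squared norm of the frame is the A-th power of
  \<open>fs_ratio\<close>.\<close>

lemma has_quantization_dim_cp:
  "has_quantization_dim (cp_cone :: (complex^'m::finite) set) cp_class cp_chart (cp_form (int A))
     (card {\<beta> :: 'm \<Rightarrow> nat. (\<Sum>i\<in>UNIV. \<beta> i) = A})"
proof (rule toric_quotient.has_quantization_dim_monomials[OF toric_quotient_cp,
      where \<kappa>="\<lambda>k w. (w $ k) ^ A" and N="\<lambda>w. inverse (\<Sum>k\<in>UNIV. (cmod (w $ k))\<^sup>2) ^ A"])
  have open_L: "open (nonzero_coords {i})" for i :: 'm by (rule open_nonzero_coords)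
  have L0: "p \<noteq> 0" if "p \<in> nonzero_coords {i}" for p :: "complex^'m" and i using that by (auto simp: nonzero_coords_def)
  have metric: "(cmod ((p $ i) ^ A))\<^sup>2 * inverse (\<Sum>k\<in>UNIV. (cmod (p $ k))\<^sup>2) ^ A = fs_ratio (\<lambda>p. p) i p ^ A"
    for p :: "complex^'m" and i
    by (simp add: fs_ratio_def norm_power power_mult_distrib power_mult[symmetric] mult.commute)
  show "finite {\<beta> :: 'm \<Rightarrow> nat. (\<Sum>i\<in>UNIV. \<beta> i) = A}" by (rule finite_exponents)
  show "(cp_cone :: (complex^'m) set) \<subseteq> (\<Union>i. nonzero_coords {i})"
    by (auto simp: cp_cone_def nonzero_coords_def vec_eq_iff)
  show "holomorphic_several_on (nonzero_coords {i}) (\<lambda>w. (w $ i) ^ A)" for i :: 'm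
    by (intro holomorphic_several_on_power holomorphic_several_on_coordinate)
  show "(p $ i) ^ A \<noteq> 0" if "p \<in> nonzero_coords {i}" for i :: 'm and p
    using that by (simp add: nonzero_coords_def)
  show "inverse (\<Sum>k\<in>UNIV. (cmod (p $ k))\<^sup>2) ^ A > 0" if "p \<in> cp_cone" for p :: "complex^'m"
    using that sum_norm_sq_pos[of p] by (simp add: cp_cone_def)
  show "\<exists>t. t \<noteq> 0 \<and> (\<forall>i. (p $ i) ^ A = t * (q $ i) ^ A) \<and>
      (\<forall>\<beta>\<in>{\<beta>. (\<Sum>i\<in>UNIV. \<beta> i) = A}. cmonom \<beta> p = t * cmonom \<beta> q) \<and>
      inverse (\<Sum>k\<in>UNIV. (cmod (q $ k))\<^sup>2) ^ A = (cmod t)\<^sup>2 * inverse (\<Sum>k\<in>UNIV. (cmod (p $ k))\<^sup>2) ^ A"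
    if pq: "p \<in> cp_cone" "q \<in> cp_cone" "cp_class p = cp_class q" for p q :: "complex^'m"
  proof -
    obtain c where c: "c \<noteq> 0" "p = c *s q" using pq(3) unfolding cp_class_eq_iff by blast
    have "(\<Sum>k\<in>UNIV. (cmod (p $ k))\<^sup>2) = (cmod c)\<^sup>2 * (\<Sum>k\<in>UNIV. (cmod (q $ k))\<^sup>2)"
      by (simp add: c norm_mult power_mult_distrib sum_distrib_left)
    then have "inverse (\<Sum>k\<in>UNIV. (cmod (q $ k))\<^sup>2) ^ A = (cmod (c ^ A))\<^sup>2 * inverse (\<Sum>k\<in>UNIV. (cmod (p $ k))\<^sup>2) ^ A"
      using c(1) by (simp add: power_mult_distrib norm_power power_mult[symmetric] mult.commute power_inverse)
    then show ?thesis using c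
      by (intro exI[of _ "c ^ A"]) (auto simp: power_mult_distrib cmonom_scale)
  qed
  show "C_k_on n (nonzero_coords {i}) (\<lambda>p. (cmod ((p $ i) ^ A))\<^sup>2 * inverse (\<Sum>k\<in>UNIV. (cmod (p $ k))\<^sup>2) ^ A)"
    for i :: 'm and n
    unfolding metric by (intro C_k_on_power C_k_on_fs_ratio open_L C_k_on_cmod_coordinate_sq L0)
  show "cp_form (int A) p u v = - i_ddbar (\<lambda>q. ln ((cmod ((q $ i) ^ A))\<^sup>2 * inverse (\<Sum>k\<in>UNIV. (cmod (q $ k))\<^sup>2) ^ A)) p u v"
    if p: "p \<in> nonzero_coords {i}" for i :: 'm and p u v
  proof -
    have nz: "q $ i \<noteq> 0" if "q \<in> nonzero_coords {i}" for q :: "complex^'m" using that by (simp add: nonzero_coords_def)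
    have dd: "\<exists>C. has_ddbar (nonzero_coords {i}) (\<lambda>q. ln (fs_ratio (\<lambda>p. p) i q)) C"
      "i_ddbar (\<lambda>q. ln (fs_ratio (\<lambda>p. p) i q)) p u v = - pullback_form (\<lambda>p. p) fubini_study p u v"
      by (rule ddbar_ln_fs_ratio[OF open_L p holomorphic2_on_coordinate nz]; assumption)+
    obtain C where C: "has_ddbar (nonzero_coords {i}) (\<lambda>q. ln (fs_ratio (\<lambda>p. p) i q)) C" using dd(1) by blast
    \<comment> \<open>The summand with factor 0 brings the multiple into the shape of the rule for
      linear combinations of two potentials.\<close>
    have "i_ddbar (\<lambda>q. ln ((cmod ((q $ i) ^ A))\<^sup>2 * inverse (\<Sum>k\<in>UNIV. (cmod (q $ k))\<^sup>2) ^ A)) p u v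
      = i_ddbar (\<lambda>q. real A * ln (fs_ratio (\<lambda>p. p) i q) + 0 * ln (fs_ratio (\<lambda>p. p) i q)) p u v"
      by (rule i_ddbar_cong[OF open_L p has_ddbar_linear[OF C C]])
         (use fs_ratio_pos[of "\<lambda>p. p"] nz in \<open>simp add: metric ln_realpow\<close>)
    also have "\<dots> = - (of_nat A * fubini_study p u v)"
      unfolding i_ddbar_linear[OF open_L p C C] dd(2) pullback_form_ident by simp
    finally show ?thesis by (simp add: cp_form_def)
  qed
  show "\<exists>a. \<forall>p\<in>cp_cone. \<Phi> p = (\<Sum>\<beta>\<in>{\<beta>. (\<Sum>i\<in>UNIV. \<beta> i) = A}. a \<beta> * cmonom \<beta> p)"
    if hol: "\<And>i. holomorphic_several_on (nonzero_coords {i}) \<Phi>" and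
      hom: "\<And>i p q. p \<in> nonzero_coords {i} \<Longrightarrow> q \<in> nonzero_coords {i} \<Longrightarrow> cp_class p = cp_class q \<Longrightarrow>
        \<Phi> p * (q $ i) ^ A = \<Phi> q * (p $ i) ^ A" for \<Phi> :: "complex^'m \<Rightarrow> complex"
  proof -
    have "holomorphic_several_on (- {0}) \<Phi>"
      unfolding holomorphic_several_on_def
    proof
      fix p :: "complex^'m" assume "p \<in> - {0}"
      then obtain i where "p $ i \<noteq> 0" by (auto simp: vec_eq_iff)
      then show "\<exists>D. (\<Phi> has_derivative D) (at p) \<and> (\<forall>c v. D (c *s v) = c * D v)"
        using hol[of i] unfolding holomorphic_several_on_def by (auto simp: nonzero_coords_def)
    qed
    moreover have "\<Phi> (c *s w) = c ^ A * \<Phi> w" if cw: "c \<noteq> 0" "w \<noteq> 0" for c w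
    proof -
      obtain i where i: "w $ i \<noteq> 0" using cw(2) by (auto simp: vec_eq_iff)
      have "\<Phi> (c *s w) * (w $ i) ^ A = \<Phi> w * ((c *s w) $ i) ^ A"
        by (rule hom) (use i cw cp_class_eq_iff[of "c *s w" w] in \<open>auto simp: nonzero_coords_def\<close>)
      then show ?thesis using i by (simp add: power_mult_distrib)
    qed
    ultimately obtain a where "\<And>w. w \<noteq> 0 \<Longrightarrow> \<Phi> w = (\<Sum>\<beta> | (\<Sum>i\<in>UNIV. \<beta> i) = A. a \<beta> * cmonom \<beta> w)"
      using homogeneous_holomorphic_imp_polynomial by blast
    then show ?thesis by (auto simp: cp_cone_def)
  qed
qed

section \<open>Hirzebruch fibrations\<close>

lemma two_cases: "(j :: 2) = 0 \<or> j = 1"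
  using exhaust_2[of j] by auto

lemma two_eq_1_iff: "(j :: 2) = 1 \<longleftrightarrow> j \<noteq> 0"
  using two_cases[of j] by auto

lemma UNIV_two: "(UNIV :: 2 set) = {0, 1}"
  using two_cases by auto

lemma cmonom_hirz:
  fixes p :: "complex^('d::finite option + 2)"
  shows "cmonom \<beta> p = cmonom (\<lambda>k. \<beta> (Inl k)) (phi_base p) * (p $ Inr 0) ^ \<beta> (Inr 0) * (p $ Inr 1) ^ \<beta> (Inr 1)"
  unfolding cmonom_def phi_base_def UNIV_Plus_UNIV[symmetric]
  by (simp add: prod.Plus UNIV_two o_def mult.assoc)

lemma hirz_act_simps:
  "hirz_act n l m p $ Inl k = l * p $ Inl k" "hirz_act n l m p $ Inr 0 = m * p $ Inr 0"
  "hirz_act n l m p $ Inr 1 = m * (inverse l ^ n * p $ Inr 1)"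
  by (simp_all add: hirz_act_def)

lemma hirz_vec_eq_iff:
  "(p :: 'a^('d::finite option + 2)) = q \<longleftrightarrow> (\<forall>k. p $ Inl k = q $ Inl k) \<and> p $ Inr 0 = q $ Inr 0 \<and> p $ Inr 1 = q $ Inr 1"
proof
  assume *: "(\<forall>k. p $ Inl k = q $ Inl k) \<and> p $ Inr 0 = q $ Inr 0 \<and> p $ Inr 1 = q $ Inr 1"
  show "p = q" unfolding vec_eq_iff
  proof
    fix c :: "'d option + 2"
    consider k where "c = Inl k" | "c = Inr 0" | "c = Inr 1" using two_cases by (cases c) auto
    then show "p $ c = q $ c" using * by cases auto
  qed
qed simp

lemma hirz_act_act: "hirz_act n l m (hirz_act n l' m' p) = hirz_act n (l * l') (m * m') p"
  by (simp add: hirz_vec_eq_iff hirz_act_simps power_mult_distrib)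

lemma hirz_act_one: "hirz_act n 1 1 p = p"
  by (simp add: hirz_vec_eq_iff hirz_act_simps)

lemma phi_act:
  "phi_base (hirz_act n l m p) = l *s phi_base p"
  "l \<noteq> 0 \<Longrightarrow> phi_fibre n (hirz_act n l m p) = m *s phi_fibre n p"
  by (auto simp: phi_base_def phi_fibre_def vec_eq_iff hirz_act_simps power_mult_distrib power_inverse
      split: option.splits)

lemma hirz_class_eq_iff:
  "hirz_class n p = hirz_class n q \<longleftrightarrow> (\<exists>l m. l \<noteq> 0 \<and> m \<noteq> 0 \<and> p = hirz_act n l m q)"
proof
  assume "hirz_class n p = hirz_class n q"
  moreover have "p \<in> hirz_class n p"
    unfolding hirz_class_def using hirz_act_one[of n p] by (intro CollectI exI[of _ 1]) simp
  ultimately show "\<exists>l m. l \<noteq> 0 \<and> m \<noteq> 0 \<and> p = hirz_act n l m q" unfolding hirz_class_def by auto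
next
  assume "\<exists>l m. l \<noteq> 0 \<and> m \<noteq> 0 \<and> p = hirz_act n l m q"
  then obtain l m where lm: "l \<noteq> 0" "m \<noteq> 0" "p = hirz_act n l m q" by blast
  have sub: "hirz_class n (hirz_act n l m q) \<subseteq> hirz_class n q" if "l \<noteq> 0" "m \<noteq> 0" for l m q
  proof
    fix w assume "w \<in> hirz_class n (hirz_act n l m q)"
    then obtain x y where "x \<noteq> 0" "y \<noteq> 0" "w = hirz_act n x y (hirz_act n l m q)"
      unfolding hirz_class_def by blast
    then show "w \<in> hirz_class n q"
      unfolding hirz_class_def using that by (intro CollectI exI[of _ "x * l"] exI[of _ "y * m"]) (simp add: hirz_act_act)
  qed
  have "q = hirz_act n (inverse l) (inverse m) p" using lm by (simp add: hirz_act_act hirz_act_one)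
  then show "hirz_class n p = hirz_class n q"
    using sub[OF lm(1,2), of q] sub[of "inverse l" "inverse m" p] lm by auto
qed

text \<open>Scaling the base coordinate x_k to 1 turns z_1 into \<open>z_1 * x_k^n\<close>; hence
  the extra power in the normalisation of z_1.\<close>

definition hirz_ret :: "nat \<Rightarrow> 'd::finite option \<times> 2 \<Rightarrow> complex^('d option + 2) \<Rightarrow> complex^('d option + 2)" where
  "hirz_ret n c p = hirz_act n (inverse (p $ Inl (fst c)))
     (if snd c = 0 then inverse (p $ Inr 0) else inverse (p $ Inr 1 * (p $ Inl (fst c)) ^ n)) p"

lemma hirz_nonzero_coords:
  "p \<in> nonzero_coords {Inl (fst c), Inr (snd c)} \<longleftrightarrow> p $ Inl (fst c) \<noteq> 0 \<and> p $ Inr (snd c) \<noteq> 0"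
  by (simp add: nonzero_coords_def)

lemma toric_quotient_hirz:
  "toric_quotient (hirz_cone :: (complex^('d::finite option + 2)) set) (hirz_class n) (hirz_chart n)
     (\<lambda>c. {Inl (fst c), Inr (snd c)}) (hirz_ret n)"
proof
  fix i :: "'d option \<times> 2" and p q :: "complex^('d option + 2)" and c k :: "'d option + 2"
  obtain k0 j0 where i: "i = (k0, j0)" by (cases i)
  show "lift_set hirz_cone (hirz_class n) (hirz_chart n i) = nonzero_coords {Inl (fst i), Inr (snd i)}"
  proof (intro equalityI subsetI)
    fix w :: "complex^('d option + 2)" assume "w \<in> lift_set hirz_cone (hirz_class n) (hirz_chart n i)"
    then obtain v where v: "hirz_class n w = hirz_class n v" "v $ Inl (fst i) \<noteq> 0" "v $ Inr (snd i) \<noteq> 0"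
      unfolding lift_set_def hirz_chart_def by auto
    then obtain l m where "l \<noteq> 0" "m \<noteq> 0" "w = hirz_act n l m v" unfolding hirz_class_eq_iff by blast
    then show "w \<in> nonzero_coords {Inl (fst i), Inr (snd i)}"
      using v(2,3) two_cases[of "snd i"] unfolding hirz_nonzero_coords by (auto simp: hirz_act_simps)
  next
    fix w :: "complex^('d option + 2)" assume "w \<in> nonzero_coords {Inl (fst i), Inr (snd i)}"
    then have "w \<in> {p \<in> hirz_cone. p $ Inl (fst i) \<noteq> 0 \<and> p $ Inr (snd i) \<noteq> 0}"
      unfolding hirz_nonzero_coords hirz_cone_def by blast
    then show "w \<in> lift_set hirz_cone (hirz_class n) (hirz_chart n i)"
      unfolding lift_set_def hirz_chart_def by blast
  qed
  show "hirz_chart n i \<subseteq> hirz_class n ` hirz_cone" unfolding hirz_chart_def by auto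
  assume p: "p \<in> nonzero_coords {Inl (fst i), Inr (snd i)}"
  then have p0: "p $ Inl (fst i) \<noteq> 0" "p $ Inr (snd i) \<noteq> 0" unfolding hirz_nonzero_coords by auto
  show "c \<in> {Inl (fst i), Inr (snd i)} \<Longrightarrow> hirz_ret n i p $ c = 1"
    using p0 two_cases[of "snd i"] by (auto simp: hirz_ret_def hirz_act_simps field_simps)
  show "hirz_class n (hirz_ret n i p) = hirz_class n p"
    unfolding hirz_class_eq_iff hirz_ret_def using p0 two_cases[of "snd i"]
    by (intro exI conjI) (auto split: if_splits)
  assume q: "q \<in> nonzero_coords {Inl (fst i), Inr (snd i)}" and "hirz_class n p = hirz_class n q"
  then obtain l m where lm: "l \<noteq> 0" "m \<noteq> 0" "p = hirz_act n l m q" unfolding hirz_class_eq_iff by blast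
  have q0: "q $ Inl (fst i) \<noteq> 0" "q $ Inr (snd i) \<noteq> 0" using q unfolding hirz_nonzero_coords by auto
  \<comment> \<open>The parameters that normalise p, multiplied by (l, m), are those that normalise
    q; the two equations for l and m say this.\<close>
  have l: "inverse (l * q $ Inl (fst i)) * l = inverse (q $ Inl (fst i))"
    using lm(1) by simp
  show "hirz_ret n i p = hirz_ret n i q"
  proof (cases "snd i = 0")
    case True
    have m: "inverse (m * q $ Inr 0) * m = inverse (q $ Inr 0)" using lm(2) by simp
    show ?thesis unfolding hirz_ret_def lm(3) hirz_act_act hirz_act_simps l if_P[OF True] m ..
  next
    case False
    have m: "inverse (m * (inverse l ^ n * q $ Inr 1) * (l * q $ Inl (fst i)) ^ n) * m
        = inverse (q $ Inr 1 * (q $ Inl (fst i)) ^ n)"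
      using lm(1,2) by (simp add: field_simps power_mult_distrib)
    show ?thesis unfolding hirz_ret_def lm(3) hirz_act_act hirz_act_simps l if_not_P[OF False] m ..
  qed
next
  fix i :: "'d option \<times> 2" and k :: "'d option + 2"
  let ?L = "nonzero_coords {Inl (fst i), Inr (snd i)}"
  have x: "holomorphic_several_on ?L (\<lambda>p. inverse (p $ Inl (fst i)))"
    by (intro holomorphic_several_on_inverse holomorphic_several_on_coordinate) (simp add: hirz_nonzero_coords)
  have m: "holomorphic_several_on ?L (\<lambda>p. if snd i = 0 then inverse (p $ Inr 0) else inverse (p $ Inr 1 * (p $ Inl (fst i)) ^ n))"
  proof (cases "snd i = 0")
    case True
    have "holomorphic_several_on ?L (\<lambda>p. inverse (p $ Inr 0))"
      by (intro holomorphic_several_on_inverse holomorphic_several_on_coordinate)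
         (simp add: nonzero_coords_def True)
    then show ?thesis using True by simp
  next
    case False
    then have s: "snd i = 1" using two_cases by blast
    have "holomorphic_several_on ?L (\<lambda>p. inverse (p $ Inr 1 * (p $ Inl (fst i)) ^ n))"
      by (intro holomorphic_several_on_inverse holomorphic_several_on_mult holomorphic_several_on_power
          holomorphic_several_on_coordinate) (simp add: nonzero_coords_def s)
    then show ?thesis using False by simp
  qed
  have x': "holomorphic_several_on ?L (\<lambda>p. inverse (inverse (p $ Inl (fst i))) ^ n * p $ Inr 1)"
    by simp (intro holomorphic_several_on_mult holomorphic_several_on_power holomorphic_several_on_coordinate)
  consider k' where "k = Inl k'" | "k = Inr 0" | "k = Inr 1" using two_cases by (cases k) auto
  then show "holomorphic_several_on ?L (\<lambda>p. hirz_ret n i p $ k)"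
    unfolding hirz_ret_def
    by (cases; simp only: hirz_act_simps;
      intro holomorphic_several_on_mult[OF x] holomorphic_several_on_mult[OF m] x' holomorphic_several_on_coordinate)
qed

text \<open>The monomials of bidegree (A, B): as z_1 has weight -n under the base scaling, its
  exponent has to be compensated by the degree in x.\<close>

definition hirz_exponents :: "nat \<Rightarrow> nat \<Rightarrow> nat \<Rightarrow> ('d::finite option + 2 \<Rightarrow> nat) set" where
  "hirz_exponents n A B = {\<beta>. (\<Sum>k\<in>UNIV. \<beta> (Inl k)) = A + n * \<beta> (Inr 1) \<and> \<beta> (Inr 0) + \<beta> (Inr 1) = B}"

definition hirz_exponent :: "nat \<Rightarrow> nat \<times> ('d::finite option \<Rightarrow> nat) \<Rightarrow> 'd option + 2 \<Rightarrow> nat" where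
  "hirz_exponent B x = case_sum (snd x) (\<lambda>j. if j = 0 then B - fst x else fst x)"

lemma hirz_exponents_bij:
  "bij_betw (hirz_exponent B) (SIGMA j:{..B}. {\<alpha> :: 'd::finite option \<Rightarrow> nat. (\<Sum>k\<in>UNIV. \<alpha> k) = A + n * j})
     (hirz_exponents n A B)"
proof (rule bij_betwI[where g="\<lambda>\<beta>. (\<beta> (Inr 1), \<lambda>k. \<beta> (Inl k))"])
  show "hirz_exponent B (\<beta> (Inr 1), \<lambda>k. \<beta> (Inl k)) = \<beta>" if "\<beta> \<in> hirz_exponents n A B" for \<beta> :: "'d option + 2 \<Rightarrow> nat"
  proof
    fix c :: "'d option + 2"
    consider k' where "c = Inl k'" | "c = Inr 0" | "c = Inr 1" using two_cases by (cases c) auto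
    then show "hirz_exponent B (\<beta> (Inr 1), \<lambda>k. \<beta> (Inl k)) c = \<beta> c"
      by cases (use that in \<open>auto simp: hirz_exponents_def hirz_exponent_def\<close>)
  qed
qed (auto simp: hirz_exponents_def hirz_exponent_def)

lemma finite_hirz_exponents: "finite (hirz_exponents n A B)"
  using bij_betw_finite[OF hirz_exponents_bij[of B A n]] finite_exponents by auto

lemma card_hirz_exponents:
  "card (hirz_exponents n A B :: ('d::finite option + 2 \<Rightarrow> nat) set) =
     (\<Sum>j\<le>B. card {\<alpha> :: 'd option \<Rightarrow> nat. (\<Sum>k\<in>UNIV. \<alpha> k) = A + n * j})"
  unfolding bij_betw_same_card[OF hirz_exponents_bij, symmetric]
  by (rule card_SigmaI) (auto intro: finite_exponents)

lemma cmonom_hirz_act: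
  assumes "\<beta> \<in> hirz_exponents n A B" "l \<noteq> 0"
  shows "cmonom \<beta> (hirz_act n l m p) = (l ^ A * m ^ B) * cmonom \<beta> p"
proof -
  have s: "(\<Sum>k\<in>UNIV. \<beta> (Inl k)) = A + n * \<beta> (Inr 1)" and B: "B = \<beta> (Inr 0) + \<beta> (Inr 1)"
    using assms by (auto simp: hirz_exponents_def)
  have "l ^ (n * \<beta> (Inr 1)) * (inverse l ^ n) ^ \<beta> (Inr 1) = 1"
    using assms(2) by (simp add: power_mult[symmetric] power_inverse)
  then have "l ^ (A + n * \<beta> (Inr 1)) * (m * inverse l ^ n) ^ \<beta> (Inr 1) * m ^ \<beta> (Inr 0) = l ^ A * m ^ B"
    by (simp add: B power_add power_mult_distrib algebra_simps)
  then show ?thesis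
    unfolding cmonom_hirz phi_act(1) cmonom_scale s hirz_act_simps
    by (simp add: power_mult_distrib mult_ac)
qed

text \<open>For fixed x the function is homogeneous in z, hence a polynomial with coefficients
  \<open>\<phi> x j\<close>. Interpolation in the fibre shows that these are holomorphic in x, the
  base scaling that they are homogeneous of degree \<open>A + n * j\<close>, and so they are
  polynomials as well.\<close>

lemma hirz_expand:
  fixes \<Phi> :: "complex^('d::finite option + 2) \<Rightarrow> complex"
  assumes hol: "holomorphic_several_on hirz_cone \<Phi>"
    and hom: "\<And>l m p. l \<noteq> 0 \<Longrightarrow> m \<noteq> 0 \<Longrightarrow> p \<in> hirz_cone \<Longrightarrow> \<Phi> (hirz_act n l m p) = l ^ A * m ^ B * \<Phi> p"
  shows "\<exists>a. \<forall>p\<in>hirz_cone. \<Phi> p = (\<Sum>\<beta>\<in>hirz_exponents n A B. a \<beta> * cmonom \<beta> p)"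
proof -
  define pt :: "complex^('d option) \<Rightarrow> complex^2 \<Rightarrow> complex^('d option + 2)" where
    "pt x z = (\<chi> i. case_sum (($) x) (($) z) i)" for x z
  have pt_simps: "pt x z $ Inl k = x $ k" "pt x z $ Inr j = z $ j" for x z k j by (simp_all add: pt_def)
  have pt_cone: "pt x z \<in> hirz_cone" if "x \<noteq> 0" "z \<noteq> 0" for x z
    using that by (auto simp: hirz_cone_def pt_simps vec_eq_iff)
  have pt_act: "hirz_act n l m (pt x z) = pt (l *s x) (\<chi> j. if j = 0 then m * z $ 0 else m * (inverse l ^ n * z $ 1))" for l m x z
    by (simp add: hirz_vec_eq_iff hirz_act_simps pt_simps)
  have "\<exists>\<phi>. \<forall>z. z \<noteq> 0 \<longrightarrow> \<Phi> (pt x z) = (\<Sum>j\<le>B. \<phi> j * (z $ 0) ^ (B - j) * (z $ 1) ^ j)" if x: "x \<noteq> 0" for x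
  proof -
    have h: "holomorphic_several_on (- {0}) (\<lambda>z. \<Phi> (pt x z))"
    proof (rule holomorphic_several_on_compose[OF hol])
      show "holomorphic_several_on (- {0}) (\<lambda>z. pt x z $ i)" for i
        by (cases i) (simp_all add: pt_simps holomorphic_several_on_const holomorphic_several_on_coordinate)
    qed (use pt_cone x in auto)
    have "\<Phi> (pt x (m *s z)) = m ^ B * \<Phi> (pt x z)" if "m \<noteq> 0" "z \<noteq> 0" for m z
    proof -
      have "m *s z = (\<chi> j. if j = 0 then m * z $ 0 else m * (inverse 1 ^ n * z $ 1))"
        by (simp add: vec_eq_iff) (metis two_cases)
      then have "pt x (m *s z) = hirz_act n 1 m (pt x z)" unfolding pt_act by simp
      then show ?thesis using hom[of 1 m "pt x z"] that pt_cone x by simp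
    qed
    then obtain a where a: "\<And>z. z \<noteq> 0 \<Longrightarrow> \<Phi> (pt x z) = (\<Sum>\<beta> | (\<Sum>i\<in>UNIV. \<beta> i) = B. a \<beta> * cmonom \<beta> z)"
      using homogeneous_holomorphic_imp_polynomial[OF h] by blast
    define b where "b j = (\<lambda>i::2. if i = 0 then B - j else j)" for j
    have "(\<Sum>\<beta> | (\<Sum>i\<in>UNIV. \<beta> i) = B. a \<beta> * cmonom \<beta> z) = (\<Sum>j\<le>B. a (b j) * (z $ 0) ^ (B - j) * (z $ 1) ^ j)" for z
    proof (rule sum.reindex_bij_witness[where i=b and j="\<lambda>\<beta>. \<beta> 1"])
      show "b (\<beta> 1) = \<beta>" if "\<beta> \<in> {\<beta>. (\<Sum>i\<in>UNIV. \<beta> i) = B}" for \<beta>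
      proof
        fix i show "b (\<beta> 1) i = \<beta> i"
          using that two_cases[of i] by (auto simp: b_def UNIV_two)
      qed
      then show "a (b (\<beta> 1)) * (z $ 0) ^ (B - \<beta> 1) * (z $ 1) ^ \<beta> 1 = a \<beta> * cmonom \<beta> z"
        if "\<beta> \<in> {\<beta>. (\<Sum>i\<in>UNIV. \<beta> i) = B}" for \<beta>
        using that by (auto simp: cmonom_def UNIV_two)
    qed (auto simp: b_def UNIV_two)
    then show ?thesis using a by (intro exI[of _ "\<lambda>j. a (b j)"]) auto
  qed
  then obtain \<phi> where \<phi>: "\<And>x z. x \<noteq> 0 \<Longrightarrow> z \<noteq> 0 \<Longrightarrow> \<Phi> (pt x z) = (\<Sum>j\<le>B. \<phi> x j * (z $ 0) ^ (B - j) * (z $ 1) ^ j)"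
    by metis
  obtain L :: "nat \<Rightarrow> nat \<Rightarrow> complex" where
    L: "\<And>a j. j \<le> B \<Longrightarrow> a j = (\<Sum>t\<le>B. L j t * (\<Sum>k\<le>B. a k * of_nat t ^ k))"
    using coefficients_from_values by blast
  \<comment> \<open>The affine coordinate t = z_1 / z_0 of the fibre; the values at t = 0, ..., B
    determine the coefficients.\<close>
  define zt :: "complex \<Rightarrow> complex^2" where "zt t = (\<chi> j. if j = 0 then 1 else t)" for t
  have zt: "zt t \<noteq> 0" "zt t $ 0 = 1" "zt t $ 1 = t" for t
    by (auto simp: zt_def vec_eq_iff)
  have \<phi>t: "\<Phi> (pt x (zt t)) = (\<Sum>k\<le>B. \<phi> x k * t ^ k)" if "x \<noteq> 0" for x t
    using \<phi>[OF that zt(1), of t] by (simp add: zt(2,3))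
  have \<phi>L: "\<phi> x j = (\<Sum>t\<le>B. L j t * \<Phi> (pt x (zt (of_nat t))))" if "x \<noteq> 0" "j \<le> B" for x j
    using L[OF that(2), of "\<phi> x"] by (simp add: \<phi>t[OF that(1)])
  have \<phi>_hol: "holomorphic_several_on (- {0}) (\<lambda>x. \<phi> x j)" if j: "j \<le> B" for j
  proof (rule holomorphic_several_on_cong)
    have "holomorphic_several_on (- {0}) (\<lambda>x. \<Phi> (pt x (zt t)))" for t
    proof (rule holomorphic_several_on_compose[OF hol])
      show "holomorphic_several_on (- {0}) (\<lambda>x. pt x (zt t) $ i)" for i
        by (cases i) (simp_all add: pt_simps holomorphic_several_on_const holomorphic_several_on_coordinate)
    qed (use pt_cone zt in auto)
    then show "holomorphic_several_on (- {0}) (\<lambda>x. \<Sum>t\<le>B. L j t * \<Phi> (pt x (zt (of_nat t))))"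
      by (intro holomorphic_several_on_sum holomorphic_several_on_mult holomorphic_several_on_const)
  qed (use \<phi>L j in \<open>auto simp: open_Compl\<close>)
  have \<phi>_hom: "\<phi> (l *s x) j = l ^ (A + n * j) * \<phi> x j" if lx: "l \<noteq> 0" "x \<noteq> 0" and j: "j \<le> B" for l x j
  proof -
    have lx0: "l *s x \<noteq> 0" using lx by simp
    have *: "\<Phi> (pt (l *s x) (zt t)) = (\<Sum>k\<le>B. (l ^ (A + n * k) * \<phi> x k) * t ^ k)" for t
    proof -
      \<comment> \<open>Scaling x by l while keeping the fibre point at t means starting from
        \<open>l^n * t\<close>; hence the factor \<open>l^(n * k)\<close> on the coefficient of
        \<open>t^k\<close>.\<close>
      have "zt t = (\<chi> j. if j = 0 then 1 * zt (l ^ n * t) $ 0 else 1 * (inverse l ^ n * zt (l ^ n * t) $ 1))"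
        using lx(1) by (simp add: zt_def vec_eq_iff power_inverse)
      then have "pt (l *s x) (zt t) = hirz_act n l 1 (pt x (zt (l ^ n * t)))" unfolding pt_act by simp
      then have "\<Phi> (pt (l *s x) (zt t)) = l ^ A * \<Phi> (pt x (zt (l ^ n * t)))"
        using hom[of l 1 "pt x (zt (l ^ n * t))"] lx pt_cone zt by simp
      also have "\<dots> = (\<Sum>k\<le>B. (l ^ (A + n * k) * \<phi> x k) * t ^ k)"
        unfolding \<phi>t[OF lx(2)] sum_distrib_left
        by (intro sum.cong refl) (simp add: power_add power_mult_distrib power_mult[symmetric] mult_ac)
      finally show ?thesis .
    qed
    show ?thesis
      using L[OF j, of "\<lambda>k. l ^ (A + n * k) * \<phi> x k"] by (simp add: *[symmetric] \<phi>L[OF lx0 j])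
  qed
  have "\<exists>a. \<forall>x. x \<noteq> 0 \<longrightarrow> \<phi> x j = (\<Sum>\<alpha> | (\<Sum>i\<in>UNIV. \<alpha> i) = A + n * j. a \<alpha> * cmonom \<alpha> x)" if j: "j \<le> B" for j
  proof -
    obtain a where "\<And>x. x \<noteq> 0 \<Longrightarrow> \<phi> x j = (\<Sum>\<alpha> | (\<Sum>i\<in>UNIV. \<alpha> i) = A + n * j. a \<alpha> * cmonom \<alpha> x)"
      using homogeneous_holomorphic_imp_polynomial[OF \<phi>_hol[OF j], of "A + n * j"] \<phi>_hom[OF _ _ j] by blast
    then show ?thesis by blast
  qed
  then have "\<forall>j. \<exists>a. j \<le> B \<longrightarrow>
      (\<forall>x. x \<noteq> 0 \<longrightarrow> \<phi> x j = (\<Sum>\<alpha> | (\<Sum>i\<in>UNIV. \<alpha> i) = A + n * j. a \<alpha> * cmonom \<alpha> x))" by blast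
  from choice[OF this] obtain c where c: "\<And>j x. j \<le> B \<Longrightarrow> x \<noteq> 0 \<Longrightarrow> \<phi> x j = (\<Sum>\<alpha> | (\<Sum>i\<in>UNIV. \<alpha> i) = A + n * j. c j \<alpha> * cmonom \<alpha> x)"
    by blast
  let ?S = "SIGMA j:{..B}. {\<alpha> :: 'd option \<Rightarrow> nat. (\<Sum>k\<in>UNIV. \<alpha> k) = A + n * j}"
  have finS: "finite ?S" using finite_exponents by auto
  have "\<Phi> p = (\<Sum>\<beta>\<in>hirz_exponents n A B. (\<Sum>i\<in>{i\<in>?S. hirz_exponent B i = \<beta>}. case_prod c i) * cmonom \<beta> p)"
    if p: "p \<in> hirz_cone" for p
  proof -
    define x where "x = phi_base p"
    define z :: "complex^2" where "z = (\<chi> j. p $ Inr j)"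
    have xz: "p = pt x z" "x \<noteq> 0" "z \<noteq> 0"
      using p by (auto simp: hirz_vec_eq_iff pt_simps x_def z_def phi_base_def hirz_cone_def vec_eq_iff)
    have "\<Phi> p = (\<Sum>j\<le>B. \<phi> x j * (z $ 0) ^ (B - j) * (z $ 1) ^ j)" using \<phi> xz by simp
    also have "\<dots> = (\<Sum>j\<le>B. \<Sum>\<alpha> | (\<Sum>i\<in>UNIV. \<alpha> i) = A + n * j. c j \<alpha> * cmonom (hirz_exponent B (j, \<alpha>)) p)"
    proof (intro sum.cong refl)
      fix j assume j: "j \<in> {..B}"
      have "cmonom (hirz_exponent B (j, \<alpha>)) p = cmonom \<alpha> x * (z $ 0) ^ (B - j) * (z $ 1) ^ j" for \<alpha>
        by (simp add: cmonom_hirz hirz_exponent_def x_def z_def)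
      then show "\<phi> x j * (z $ 0) ^ (B - j) * (z $ 1) ^ j =
          (\<Sum>\<alpha> | (\<Sum>i\<in>UNIV. \<alpha> i) = A + n * j. c j \<alpha> * cmonom (hirz_exponent B (j, \<alpha>)) p)"
        using c[of j x] j xz(2) by (simp add: sum_distrib_right mult.assoc)
    qed
    also have "\<dots> = (\<Sum>i\<in>?S. case_prod c i * cmonom (hirz_exponent B i) p)"
      by (subst sum.Sigma) (use finite_exponents in \<open>auto intro!: sum.cong\<close>)
    also have "\<dots> = (\<Sum>\<beta>\<in>hirz_exponents n A B. (\<Sum>i\<in>{i\<in>?S. hirz_exponent B i = \<beta>}. case_prod c i) * cmonom \<beta> p)"
      by (rule sum_cmonom_regroup[OF finS finite_hirz_exponents])
         (use hirz_exponents_bij[of B A n, where 'd='d] in \<open>simp add: bij_betw_def\<close>)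
    finally show ?thesis .
  qed
  then show ?thesis by (intro exI ballI)
qed

lemma phi_base_nonzero: "p \<in> hirz_cone \<Longrightarrow> phi_base p \<noteq> 0"
  by (auto simp: hirz_cone_def phi_base_def vec_eq_iff)

lemma phi_fibre_simps:
  "phi_fibre n p $ None = p $ Inr 0" "phi_fibre n p $ Some k = p $ Inr 1 * (p $ Inl k) ^ n"
  by (simp_all add: phi_fibre_def)

lemma phi_fibre_nonzero: "p \<in> hirz_cone \<Longrightarrow> phi_fibre n p \<noteq> 0"
proof
  assume p: "p \<in> hirz_cone" and "phi_fibre n p = 0"
  then have *: "phi_fibre n p $ r = 0" for r by simp
  from p obtain k j where "p $ Inl k \<noteq> 0" "p $ Inr j \<noteq> 0" unfolding hirz_cone_def by blast
  then show False using *[of None] *[of "Some k"] two_cases[of j] by (auto simp: phi_fibre_simps)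
qed

lemma holomorphic2_phi:
  "holomorphic2_on S (\<lambda>p. phi_base p $ k)" "holomorphic2_on S (\<lambda>p. phi_fibre n p $ r)"
  by (cases r; simp add: phi_base_def phi_fibre_simps holomorphic2_on_coordinate
      holomorphic2_on_mult holomorphic2_on_power)+

lemma C_k_on_phi:
  fixes S :: "(complex^('d::finite option + 2)) set"
  assumes "open S"
  shows "C_k_on m S (\<lambda>p. (cmod (phi_base p $ k))\<^sup>2)" "C_k_on m S (\<lambda>p. (cmod (phi_fibre n p $ r))\<^sup>2)"
proof -
  show "C_k_on m S (\<lambda>p. (cmod (phi_base p $ k))\<^sup>2)"
    by (simp add: phi_base_def C_k_on_cmod_coordinate_sq[OF assms])
  have "(cmod (phi_fibre n p $ Some k))\<^sup>2 = (cmod (p $ Inr 1))\<^sup>2 * ((cmod (p $ Inl k))\<^sup>2) ^ n" for p and k :: "'d option"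
    by (simp add: phi_fibre_simps norm_mult norm_power power_mult_distrib power_mult[symmetric] mult.commute)
  then show "C_k_on m S (\<lambda>p. (cmod (phi_fibre n p $ r))\<^sup>2)"
    by (cases r) (simp_all add: phi_fibre_simps(1) C_k_on_cmod_coordinate_sq C_k_on_mult C_k_on_power assms)
qed

lemma pullback_form_cp_form:
  "pullback_form F (cp_form a) p u v = of_int a * pullback_form F fubini_study p u v"
  by (simp add: pullback_form_def cp_form_def)

text \<open>The homogeneous coordinate of \<open>phi_fibre\<close> that does not vanish on the
  chart: z_0, or \<open>z_1 * x_k^n\<close>.\<close>

definition hirz_fibre_index :: "'d option \<times> 2 \<Rightarrow> 'd option option" where
  "hirz_fibre_index c = (if snd c = 0 then None else Some (fst c))"

text \<open>The bundle is the pullback of O(A) and O(B) from the two projective factors, tensored;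
  frames and metric are products of those of the factors.\<close>

lemma has_quantization_dim_hirz:
  "has_quantization_dim (hirz_cone :: (complex^('d::finite option + 2)) set) (hirz_class n) (hirz_chart n)
     (hirz_form n (int A) (int B)) (card (hirz_exponents n A B :: ('d option + 2 \<Rightarrow> nat) set))"
proof (rule toric_quotient.has_quantization_dim_monomials[OF toric_quotient_hirz,
      where \<kappa>="\<lambda>c p. (phi_base p $ fst c) ^ A * (phi_fibre n p $ hirz_fibre_index c) ^ B"
        and N="\<lambda>p. inverse (\<Sum>k\<in>UNIV. (cmod (phi_base p $ k))\<^sup>2) ^ A * inverse (\<Sum>r\<in>UNIV. (cmod (phi_fibre n p $ r))\<^sup>2) ^ B"])
  let ?L = "\<lambda>c :: 'd option \<times> 2. nonzero_coords {Inl (fst c), Inr (snd c)} :: (complex^('d option + 2)) set"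
  let ?\<kappa> = "\<lambda>(c :: 'd option \<times> 2) p. (phi_base p $ fst c) ^ A * (phi_fibre n p $ hirz_fibre_index c) ^ B"
  let ?N = "\<lambda>p :: complex^('d option + 2). inverse (\<Sum>k\<in>UNIV. (cmod (phi_base p $ k))\<^sup>2) ^ A *
    inverse (\<Sum>r\<in>UNIV. (cmod (phi_fibre n p $ r))\<^sup>2) ^ B"
  have open_L: "open (?L c)" for c by (rule open_nonzero_coords)
  have L0: "phi_base p $ fst c \<noteq> 0" "phi_fibre n p $ hirz_fibre_index c \<noteq> 0" if "p \<in> ?L c" for p c
    using that two_cases[of "snd c"]
    by (auto simp: hirz_nonzero_coords phi_base_def phi_fibre_simps hirz_fibre_index_def)
  have Lnz: "phi_base p \<noteq> 0" "phi_fibre n p \<noteq> 0" if "p \<in> ?L c" for p c using L0[OF that] by auto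
  have sq: "(x ^ A * y ^ B)\<^sup>2 * (s ^ A * t ^ B) = (x\<^sup>2 * s) ^ A * (y\<^sup>2 * t) ^ B" for x y s t :: real
    by (simp add: power_mult_distrib power_mult[symmetric] mult_ac)
  have metric: "(cmod (?\<kappa> c p))\<^sup>2 * ?N p = fs_ratio phi_base (fst c) p ^ A * fs_ratio (phi_fibre n) (hirz_fibre_index c) p ^ B" for c p
    unfolding fs_ratio_def norm_mult norm_power sq ..
  have \<kappa>_act: "?\<kappa> c (hirz_act n l m p) = (l ^ A * m ^ B) * ?\<kappa> c p" if "l \<noteq> 0" for c l m p
    using that by (simp add: phi_act power_mult_distrib mult_ac)
  show "finite (hirz_exponents n A B :: ('d option + 2 \<Rightarrow> nat) set)" by (rule finite_hirz_exponents)
  show cover: "hirz_cone \<subseteq> (\<Union>c. ?L c)"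
    by (auto simp: hirz_cone_def hirz_nonzero_coords)
  show "holomorphic_several_on (?L c) (\<lambda>p. ?\<kappa> c p)" for c
    by (intro holomorphic_several_on_mult holomorphic_several_on_power holomorphic2_on_imp holomorphic2_phi)
  show "?\<kappa> c p \<noteq> 0" if "p \<in> ?L c" for c p using L0[OF that] by simp
  show "?N p > 0" if "p \<in> hirz_cone" for p
    using sum_norm_sq_pos[OF phi_base_nonzero[OF that]] sum_norm_sq_pos[OF phi_fibre_nonzero[OF that, of n]] by simp
  show "\<exists>t. t \<noteq> 0 \<and> (\<forall>c. ?\<kappa> c p = t * ?\<kappa> c q) \<and> (\<forall>\<beta>\<in>hirz_exponents n A B. cmonom \<beta> p = t * cmonom \<beta> q) \<and>
      ?N q = (cmod t)\<^sup>2 * ?N p"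
    if pq: "p \<in> hirz_cone" "q \<in> hirz_cone" "hirz_class n p = hirz_class n q" for p q
  proof -
    obtain l m where lm: "l \<noteq> 0" "m \<noteq> 0" "p = hirz_act n l m q" using pq(3) unfolding hirz_class_eq_iff by blast
    have "(\<Sum>k\<in>UNIV. (cmod (phi_base p $ k))\<^sup>2) = (cmod l)\<^sup>2 * (\<Sum>k\<in>UNIV. (cmod (phi_base q $ k))\<^sup>2)"
      "(\<Sum>r\<in>UNIV. (cmod (phi_fibre n p $ r))\<^sup>2) = (cmod m)\<^sup>2 * (\<Sum>r\<in>UNIV. (cmod (phi_fibre n q $ r))\<^sup>2)"
      using lm(1) by (simp_all add: lm(3) phi_act norm_mult power_mult_distrib sum_distrib_left)
    note scale = this
    have "(cmod l)\<^sup>2 * inverse ((cmod l)\<^sup>2 * s) = inverse s" "(cmod m)\<^sup>2 * inverse ((cmod m)\<^sup>2 * s) = inverse s" for s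
      using lm(1,2) by simp_all
    note cancel = this
    have "?N q = (cmod (l ^ A * m ^ B))\<^sup>2 * ?N p" unfolding norm_mult norm_power sq scale cancel ..
    then show ?thesis
    proof (intro exI[of _ "l ^ A * m ^ B"] conjI allI ballI)
      show "l ^ A * m ^ B \<noteq> 0" using lm(1,2) by simp
      show "?\<kappa> c p = (l ^ A * m ^ B) * ?\<kappa> c q" for c unfolding lm(3) by (rule \<kappa>_act[OF lm(1)])
      show "cmonom \<beta> p = (l ^ A * m ^ B) * cmonom \<beta> q" if "\<beta> \<in> hirz_exponents n A B" for \<beta>
        unfolding lm(3) by (rule cmonom_hirz_act[OF that lm(1)])
    qed
  qed
  show "C_k_on k (?L c) (\<lambda>p. (cmod (?\<kappa> c p))\<^sup>2 * ?N p)" for c k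
    unfolding metric by (intro C_k_on_mult C_k_on_power C_k_on_fs_ratio open_L C_k_on_phi Lnz)
  show "hirz_form n (int A) (int B) p u v = - i_ddbar (\<lambda>q. ln ((cmod (?\<kappa> c q))\<^sup>2 * ?N q)) p u v"
    if p: "p \<in> ?L c" for c p u v
  proof -
    have base: "\<exists>C. has_ddbar (?L c) (\<lambda>q. ln (fs_ratio phi_base (fst c) q)) C"
      "i_ddbar (\<lambda>q. ln (fs_ratio phi_base (fst c) q)) p u v = - pullback_form phi_base fubini_study p u v"
      by (rule ddbar_ln_fs_ratio[OF open_L p holomorphic2_phi(1) L0(1)]; assumption)+
    have fibre: "\<exists>C. has_ddbar (?L c) (\<lambda>q. ln (fs_ratio (phi_fibre n) (hirz_fibre_index c) q)) C"
      "i_ddbar (\<lambda>q. ln (fs_ratio (phi_fibre n) (hirz_fibre_index c) q)) p u v = - pullback_form (phi_fibre n) fubini_study p u v"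
      by (rule ddbar_ln_fs_ratio[OF open_L p holomorphic2_phi(2) L0(2)]; assumption)+
    obtain C where C: "has_ddbar (?L c) (\<lambda>q. ln (fs_ratio phi_base (fst c) q)) C" using base(1) by blast
    obtain D where D: "has_ddbar (?L c) (\<lambda>q. ln (fs_ratio (phi_fibre n) (hirz_fibre_index c) q)) D" using fibre(1) by blast
    have "i_ddbar (\<lambda>q. ln ((cmod (?\<kappa> c q))\<^sup>2 * ?N q)) p u v
      = i_ddbar (\<lambda>q. real A * ln (fs_ratio phi_base (fst c) q) + real B * ln (fs_ratio (phi_fibre n) (hirz_fibre_index c) q)) p u v"
    proof (rule i_ddbar_cong[OF open_L p has_ddbar_linear[OF C D]])
      fix q assume q: "q \<in> ?L c"
      show "real A * ln (fs_ratio phi_base (fst c) q) + real B * ln (fs_ratio (phi_fibre n) (hirz_fibre_index c) q)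
        = ln ((cmod (?\<kappa> c q))\<^sup>2 * ?N q)"
        using fs_ratio_pos[of phi_base q "fst c"] fs_ratio_pos[of "phi_fibre n" q "hirz_fibre_index c"] L0[OF q]
        unfolding metric
        by (simp add: ln_mult_pos ln_realpow)
    qed
    also have "\<dots> = - hirz_form n (int A) (int B) p u v"
      unfolding i_ddbar_linear[OF open_L p C D] base(2) fibre(2) hirz_form_def pullback_form_cp_form by simp
    finally show ?thesis by simp
  qed
  show "\<exists>a. \<forall>p\<in>hirz_cone. \<Phi> p = (\<Sum>\<beta>\<in>hirz_exponents n A B. a \<beta> * cmonom \<beta> p)"
    if hol: "\<And>c. holomorphic_several_on (?L c) \<Phi>" and
      hom: "\<And>c p q. p \<in> ?L c \<Longrightarrow> q \<in> ?L c \<Longrightarrow> hirz_class n p = hirz_class n q \<Longrightarrow> \<Phi> p * ?\<kappa> c q = \<Phi> q * ?\<kappa> c p" for \<Phi>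
  proof (rule hirz_expand)
    show "holomorphic_several_on hirz_cone \<Phi>"
      using hol cover unfolding holomorphic_several_on_def by blast
    show "\<Phi> (hirz_act n l m p) = l ^ A * m ^ B * \<Phi> p" if lm: "l \<noteq> 0" "m \<noteq> 0" and p: "p \<in> hirz_cone" for l m p
    proof -
      obtain c where c: "p \<in> ?L c" using p cover by blast
      then have "hirz_act n l m p \<in> ?L c"
        using lm two_cases[of "snd c"] by (auto simp: hirz_nonzero_coords hirz_act_simps)
      then have "\<Phi> (hirz_act n l m p) * ?\<kappa> c p = \<Phi> p * ?\<kappa> c (hirz_act n l m p)"
        by (rule hom[OF _ c]) (use lm hirz_class_eq_iff in blast)
      then show ?thesis using L0[OF c] lm by (simp add: \<kappa>_act)
    qed
  qed
qed

section \<open>The moment polytope\<close>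

lemma has_derivative_cmod_coordinate_sq:
  "((\<lambda>F :: complex^'k. (cmod (F $ r))\<^sup>2) has_derivative (\<lambda>V. 2 * Re (V $ r * cnj (F $ r)))) (at F)"
proof -
  have l: "((\<lambda>F :: complex^'k. F $ r) has_derivative (\<lambda>V. V $ r)) (at F)"
    by (intro bounded_linear_imp_has_derivative bounded_linear_vec_nth)
  have "((\<lambda>F :: complex^'k. Re (F $ r * cnj (F $ r))) has_derivative (\<lambda>V. Re (F $ r * cnj (V $ r) + V $ r * cnj (F $ r)))) (at F)"
    by (intro has_derivative_Re has_derivative_mult has_derivative_cnj l)
  moreover have "Re (G $ r * cnj (G $ r)) = (cmod (G $ r))\<^sup>2" for G :: "complex^'k"
    by (simp add: complex_mult_cnj cmod_power2)
  moreover have "Re (F $ r * cnj (V $ r) + V $ r * cnj (F $ r)) = 2 * Re (V $ r * cnj (F $ r))" for V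
    by simp
  ultimately show ?thesis by simp
qed

text \<open>The moment map of the rotation of \<open>F r\<close> with weight \<open>w r\<close> is the average of the weights with respect
  to the distribution \<open>\<bar>F r\<bar>\<^sup>2 / \<bar>F\<bar>\<^sup>2\<close>.\<close>

lemma fs_moment_derivative:
  fixes F :: "complex^'k"
  assumes F: "F \<noteq> 0"
  obtains D where "((\<lambda>F. \<Sum>r\<in>UNIV. w r * fs_ratio (\<lambda>p. p) r F) has_derivative D) (at F)"
    "\<And>V. complex_of_real (D V) = fubini_study F V (\<chi> r. \<i> * of_real (w r) * F $ r)"
proof
  define S where "S F = (\<Sum>k\<in>UNIV. (cmod (F $ k))\<^sup>2)" for F :: "complex^'k"
  define W where "W F = (\<Sum>k\<in>UNIV. w k * (cmod (F $ k))\<^sup>2)" for F :: "complex^'k"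
  \<comment> \<open>The derivatives of S and W are twice the real parts of P and Q, and the products
    of V and F with the rotation field are Q and W up to i and conjugation.\<close>
  define P where "P V = (\<Sum>k\<in>UNIV. V $ k * cnj (F $ k))" for V
  define Q where "Q V = (\<Sum>k\<in>UNIV. of_real (w k) * (V $ k * cnj (F $ k)))" for V
  have S0: "S F \<noteq> 0" using sum_norm_sq_pos[OF F] by (simp add: S_def)
  have dS: "(S has_derivative (\<lambda>V. 2 * Re (P V))) (at F)"
  proof -
    have "(S has_derivative (\<lambda>V. \<Sum>k\<in>UNIV. 2 * Re (V $ k * cnj (F $ k)))) (at F)"
      unfolding S_def[abs_def] by (intro has_derivative_sum has_derivative_cmod_coordinate_sq)
    then show ?thesis by (simp only: P_def Re_sum sum_distrib_left)
  qed
  have dW: "(W has_derivative (\<lambda>V. 2 * Re (Q V))) (at F)"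
  proof -
    have "(W has_derivative (\<lambda>V. \<Sum>k\<in>UNIV. w k * (2 * Re (V $ k * cnj (F $ k))))) (at F)"
      unfolding W_def[abs_def]
      by (intro has_derivative_sum has_derivative_mult_right has_derivative_cmod_coordinate_sq)
    moreover have "(\<Sum>k\<in>UNIV. w k * (2 * Re (V $ k * cnj (F $ k)))) = 2 * Re (Q V)" for V
      unfolding Q_def Re_sum sum_distrib_left by (intro sum.cong refl) simp
    ultimately show ?thesis by simp
  qed
  let ?D = "\<lambda>V. - W F * (inverse (S F) * (2 * Re (P V)) * inverse (S F)) + 2 * Re (Q V) / S F"
  have "((\<lambda>F. W F / S F) has_derivative ?D) (at F)"
    by (rule Deriv.has_derivative_divide[OF dW dS S0])
  moreover have "W F / S F = (\<Sum>r\<in>UNIV. w r * fs_ratio (\<lambda>p. p) r F)" for F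
    by (simp add: W_def S_def fs_ratio_def sum_divide_distrib divide_inverse sum_distrib_right mult.assoc)
  ultimately show "((\<lambda>F. \<Sum>r\<in>UNIV. w r * fs_ratio (\<lambda>p. p) r F) has_derivative ?D) (at F)" by simp
  show "complex_of_real (?D V) = fubini_study F V (\<chi> r. \<i> * of_real (w r) * F $ r)" for V
  proof -
    let ?X = "($) (\<chi> r. \<i> * of_real (w r) * F $ r)"
    have h1: "hprod UNIV (($) V) ?X = - \<i> * Q V"
      by (simp add: hprod_def Q_def sum_distrib_left sum_negf mult_ac)
    have h2: "hprod UNIV ?X (($) V) = \<i> * cnj (Q V)"
      by (simp add: hprod_def Q_def sum_distrib_left mult_ac)
    have Wc: "complex_of_real (W F) = (\<Sum>k\<in>UNIV. of_real (w k) * (F $ k * cnj (F $ k)))"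
      unfolding W_def of_real_sum of_real_mult complex_norm_square ..
    have h3: "hprod UNIV (($) F) ?X = - \<i> * of_real (W F)"
      by (simp add: hprod_def Wc sum_distrib_left sum_negf mult_ac)
    have h4: "hprod UNIV ?X (($) F) = \<i> * of_real (W F)"
      by (simp add: hprod_def Wc sum_distrib_left mult_ac)
    have h5: "hprod UNIV (($) V) (($) F) = P V" "hprod UNIV (($) F) (($) V) = cnj (P V)"
      by (simp_all add: hprod_def P_def mult.commute)
    have h6: "hprod UNIV (($) F) (($) F) = of_real (S F)" unfolding hprod_self S_def ..
    have PQ: "complex_of_real (2 * Re z) = z + cnj z" for z by (simp add: complex_eq_iff)
    have "complex_of_real (?D V) = (Q V + cnj (Q V)) / of_real (S F) - of_real (W F) * (P V + cnj (P V)) / (of_real (S F))\<^sup>2"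
      unfolding PQ[symmetric] by (simp add: power2_eq_square divide_inverse mult_ac)
    also have "\<dots> = fubini_study F V (\<chi> r. \<i> * of_real (w r) * F $ r)"
      unfolding fubini_study_eq[OF F] fs_form_def h1 h2 h3 h4 h5 h6
      by (simp add: diff_divide_distrib add_divide_distrib algebra_simps)
    finally show ?thesis .
  qed
qed

text \<open>Moment maps pull back along equivariant maps; the hypothesis on \<open>DF X\<close> is
  infinitesimal equivariance.\<close>

lemma fs_moment_pullback:
  fixes F :: "complex^'m \<Rightarrow> complex^'k"
  assumes "F p \<noteq> 0" "(F has_derivative DF) (at p)" "DF X = (\<chi> r. \<i> * of_real (w r) * F p $ r)"
  obtains D where "((\<lambda>p. \<Sum>r\<in>UNIV. w r * fs_ratio F r p) has_derivative D) (at p)"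
    "\<And>v. complex_of_real (D v) = pullback_form F fubini_study p v X"
proof -
  obtain E where E: "((\<lambda>F. \<Sum>r\<in>UNIV. w r * fs_ratio (\<lambda>p. p) r F) has_derivative E) (at (F p))"
    "\<And>V. complex_of_real (E V) = fubini_study (F p) V (\<chi> r. \<i> * of_real (w r) * F p $ r)"
    using fs_moment_derivative[OF assms(1), of w] by blast
  have "((\<lambda>p. \<Sum>r\<in>UNIV. w r * fs_ratio (\<lambda>p. p) r (F p)) has_derivative (\<lambda>v. E (DF v))) (at p)"
    by (rule has_derivative_compose[OF assms(2) E(1)])
  then have "((\<lambda>p. \<Sum>r\<in>UNIV. w r * fs_ratio F r p) has_derivative (\<lambda>v. E (DF v))) (at p)"
    by (simp add: fs_ratio_def)
  moreover have "complex_of_real (E (DF v)) = pullback_form F fubini_study p v X" for v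
    unfolding pullback_form_def frechet_derivative_at[OF assms(2), symmetric] assms(3) E(2) ..
  ultimately show thesis by (rule that)
qed

lemma rotation_has_vector_derivative:
  fixes z :: "complex^'k"
  shows "((\<lambda>t. \<chi> r. cis (t * w r) * z $ r) has_vector_derivative (\<chi> r. \<i> * of_real (w r) * z $ r)) (at 0)"
  unfolding has_vector_derivative_def
proof (rule has_derivative_vec_lambda)
  fix r
  have "((\<lambda>x. exp (x * (\<i> * of_real (w r))) * z $ r) has_field_derivative (\<i> * of_real (w r) * z $ r)) (at (of_real 0))"
    by (auto intro!: derivative_eq_intros)
  then have "((\<lambda>t. exp (of_real t * (\<i> * of_real (w r))) * z $ r) has_vector_derivative (\<i> * of_real (w r) * z $ r)) (at 0)"
    by (rule has_vector_derivative_real_field)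
  moreover have "exp (of_real t * (\<i> * of_real (w r))) = cis (t * w r)" for t
    by (simp add: cis_conv_exp mult_ac)
  ultimately show "((\<lambda>t. (\<chi> r. cis (t * w r) * z $ r) $ r) has_derivative (\<lambda>h. (h *\<^sub>R (\<chi> r. \<i> * of_real (w r) * z $ r)) $ r)) (at 0)"
    by (simp add: has_vector_derivative_def)
qed

section \<open>Weights and equivariance of the embedding\<close>

definition torus_weight :: "real^('d + unit) \<Rightarrow> 'd::finite option + 2 \<Rightarrow> real" where
  "torus_weight \<xi> i = (case i of Inl None \<Rightarrow> 0 | Inl (Some k) \<Rightarrow> \<xi> $ Inl k | Inr j \<Rightarrow> if j = 0 then \<xi> $ Inr () else 0)"

definition base_weight :: "real^('d + unit) \<Rightarrow> 'd::finite option \<Rightarrow> real" where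
  "base_weight \<xi> r = torus_weight \<xi> (Inl r)"

text \<open>Since z_1 is fixed, \<open>z_1 * x_k^n\<close> rotates with n times the weight of
  x_k.\<close>

definition fibre_weight :: "nat \<Rightarrow> real^('d + unit) \<Rightarrow> 'd::finite option option \<Rightarrow> real" where
  "fibre_weight n \<xi> r = (case r of None \<Rightarrow> \<xi> $ Inr () | Some k \<Rightarrow> real n * base_weight \<xi> k)"

lemma hirz_torus_act_eq: "hirz_torus_act (t *\<^sub>R \<xi>) p = (\<chi> i. cis (t * torus_weight \<xi> i) * p $ i)"
proof -
  have "hirz_torus_act (t *\<^sub>R \<xi>) p $ i = cis (t * torus_weight \<xi> i) * p $ i" for i
    by (cases i) (auto simp: hirz_torus_act_def torus_weight_def two_eq_1_iff[symmetric] split: option.splits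
        dest!: two_eq_1_iff[THEN iffD2])
  then show ?thesis by (simp add: vec_eq_iff)
qed

lemma fundamental_field_hirz:
  "((\<lambda>t. hirz_torus_act (t *\<^sub>R \<xi>) p) has_vector_derivative fundamental_field hirz_torus_act \<xi> p) (at 0)"
proof -
  have "((\<lambda>t. hirz_torus_act (t *\<^sub>R \<xi>) p) has_vector_derivative (\<chi> i. \<i> * of_real (torus_weight \<xi> i) * p $ i)) (at 0)"
    unfolding hirz_torus_act_eq by (rule rotation_has_vector_derivative)
  then show ?thesis unfolding fundamental_field_def by (simp add: vector_derivative_at)
qed

lemma equivariant_derivative:
  fixes F :: "complex^('d::finite option + 2) \<Rightarrow> complex^'k"
  assumes F: "(F has_derivative DF) (at p)"
    and eq: "\<And>t. F (hirz_torus_act (t *\<^sub>R \<xi>) p) = (\<chi> r. cis (t * w r) * F p $ r)"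
  shows "DF (fundamental_field hirz_torus_act \<xi> p) = (\<chi> r. \<i> * of_real (w r) * F p $ r)"
proof -
  let ?X = "fundamental_field hirz_torus_act \<xi> p"
  have act0: "hirz_torus_act (0 *\<^sub>R \<xi>) p = p" unfolding hirz_torus_act_eq by (simp add: vec_eq_iff)
  have "((\<lambda>t. F (hirz_torus_act (t *\<^sub>R \<xi>) p)) has_derivative (\<lambda>s. DF (s *\<^sub>R ?X))) (at 0)"
    by (rule has_derivative_compose[OF fundamental_field_hirz[unfolded has_vector_derivative_def]])
       (simp only: act0 F)
  then have "((\<lambda>t. F (hirz_torus_act (t *\<^sub>R \<xi>) p)) has_vector_derivative DF ?X) (at 0)"
    unfolding has_vector_derivative_def by (simp add: linear_cmul[OF has_derivative_linear[OF F]])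
  then show ?thesis
    unfolding eq using rotation_has_vector_derivative[of w "F p"] by (rule vector_derivative_unique_at)
qed

lemma phi_torus_act:
  "phi_base (hirz_torus_act (t *\<^sub>R \<xi>) p) = (\<chi> r. cis (t * base_weight \<xi> r) * phi_base p $ r)"
  "phi_fibre n (hirz_torus_act (t *\<^sub>R \<xi>) p) = (\<chi> r. cis (t * fibre_weight n \<xi> r) * phi_fibre n p $ r)"
proof -
  show "phi_base (hirz_torus_act (t *\<^sub>R \<xi>) p) = (\<chi> r. cis (t * base_weight \<xi> r) * phi_base p $ r)"
    unfolding hirz_torus_act_eq by (simp add: phi_base_def base_weight_def vec_eq_iff)
  have "phi_fibre n (hirz_torus_act (t *\<^sub>R \<xi>) p) $ r = cis (t * fibre_weight n \<xi> r) * phi_fibre n p $ r" for r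
    unfolding hirz_torus_act_eq
    by (cases r) (simp_all add: phi_fibre_simps fibre_weight_def base_weight_def torus_weight_def
      power_mult_distrib Complex.DeMoivre mult_ac)
  then show "phi_fibre n (hirz_torus_act (t *\<^sub>R \<xi>) p) = (\<chi> r. cis (t * fibre_weight n \<xi> r) * phi_fibre n p $ r)"
    by (simp add: vec_eq_iff)
qed

text \<open>The coefficients of \<open>\<xi>\<close> in a times the average of the base weights plus
  b times the average of the fibre weights; see \<open>hirz_moment_inner\<close>.\<close>

definition hirz_moment :: "nat \<Rightarrow> real \<Rightarrow> real \<Rightarrow> complex^('d::finite option + 2) \<Rightarrow> real^('d + unit)" where
  "hirz_moment n a b p = (\<chi> c. case c of
      Inl k \<Rightarrow> a * fs_ratio phi_base (Some k) p + b * (n * fs_ratio (phi_fibre n) (Some (Some k)) p)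
    | Inr _ \<Rightarrow> b * fs_ratio (phi_fibre n) None p)"

lemma sum_option: "(\<Sum>r\<in>UNIV. f r) = f None + (\<Sum>k\<in>UNIV. f (Some k))"
  for f :: "'k::finite option \<Rightarrow> 'a::comm_monoid_add"
  by (simp add: UNIV_option_conv sum.reindex)

lemma hirz_moment_inner:
  "hirz_moment n a b p \<bullet> \<xi> = a * (\<Sum>r\<in>UNIV. base_weight \<xi> r * fs_ratio phi_base r p) +
     b * (\<Sum>r\<in>UNIV. fibre_weight n \<xi> r * fs_ratio (phi_fibre n) r p)"
  unfolding inner_vec_def sum_option UNIV_Plus_UNIV[symmetric]
  by (simp add: sum.Plus hirz_moment_def base_weight_def fibre_weight_def torus_weight_def UNIV_unit
      sum_distrib_left sum.distrib algebra_simps)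

lemma open_hirz_cone: "open (hirz_cone :: (complex^('d::finite option + 2)) set)"
proof -
  have "hirz_cone = (\<Union>c. nonzero_coords {Inl (fst c), Inr (snd c)} :: (complex^('d option + 2)) set)"
    by (auto simp: hirz_cone_def nonzero_coords_def)
  then show ?thesis using open_nonzero_coords by (metis (no_types, lifting) open_UN)
qed

lemma fs_ratio_scale: "c \<noteq> 0 \<Longrightarrow> F q = c *s F p \<Longrightarrow> fs_ratio F r q = fs_ratio F r p"
  by (simp add: fs_ratio_def norm_mult power_mult_distrib sum_distrib_left[symmetric])

lemma hirz_moment_class:
  assumes "hirz_class n p = hirz_class n q" shows "hirz_moment n a b p = hirz_moment n a b q"
proof -
  obtain l m where lm: "l \<noteq> 0" "m \<noteq> 0" "p = hirz_act n l m q" using assms unfolding hirz_class_eq_iff by blast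
  have "fs_ratio phi_base r p = fs_ratio phi_base r q" for r
    using fs_ratio_scale[of l phi_base p q] lm phi_act(1) by blast
  moreover have "fs_ratio (phi_fibre n) r p = fs_ratio (phi_fibre n) r q" for r
    using fs_ratio_scale[of m "phi_fibre n" p q] lm phi_act(2) by blast
  ultimately show ?thesis by (auto simp: hirz_moment_def vec_eq_iff split: sum.split)
qed

lemma holomorphic2_imp_has_derivative:
  fixes F :: "complex^'m \<Rightarrow> complex^'k"
  assumes "\<And>k. holomorphic2_on S (\<lambda>p. F p $ k)" "p \<in> S"
  shows "\<exists>D. (F has_derivative D) (at p)"
proof -
  have "\<exists>D. ((\<lambda>p. F p $ k) has_derivative D) (at p)" for k
    using holomorphic2_on_imp[OF assms(1)[of k]] assms(2) unfolding holomorphic_several_on_def by blast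
  then obtain D where "\<And>k. ((\<lambda>p. F p $ k) has_derivative D k) (at p)" by metis
  then have "(F has_derivative (\<lambda>v. \<chi> k. D k v)) (at p)" by (intro has_derivative_vec_lambda) simp
  then show ?thesis by blast
qed

lemma is_moment_map_hirz:
  assumes \<mu>: "\<And>q. q \<in> hirz_cone \<Longrightarrow> \<mu> (hirz_class n q) = hirz_moment n (of_int a) (of_int b) q"
  shows "is_moment_map (hirz_cone :: (complex^('d::finite option + 2)) set) (hirz_class n) hirz_torus_act (hirz_form n a b) \<mu>"
  unfolding is_moment_map_def
proof (intro allI ballI)
  fix \<xi> :: "real^('d + unit)" and p :: "complex^('d option + 2)" assume p: "p \<in> hirz_cone"
  let ?X = "fundamental_field hirz_torus_act \<xi> p"
  have "\<exists>D. (phi_base has_derivative D) (at p)" "\<exists>D. (phi_fibre n has_derivative D) (at p)"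
    by (rule holomorphic2_imp_has_derivative[OF holomorphic2_phi(1) UNIV_I],
        rule holomorphic2_imp_has_derivative[OF holomorphic2_phi(2) UNIV_I])
  then obtain DB DF where D: "(phi_base has_derivative DB) (at p)" "(phi_fibre n has_derivative DF) (at p)" by blast
  obtain B where B: "((\<lambda>p. \<Sum>r\<in>UNIV. base_weight \<xi> r * fs_ratio phi_base r p) has_derivative B) (at p)"
    "\<And>v. complex_of_real (B v) = pullback_form phi_base fubini_study p v ?X"
    using fs_moment_pullback[of phi_base, OF phi_base_nonzero[OF p] D(1) equivariant_derivative[OF D(1) phi_torus_act(1)]] by blast
  obtain E where E: "((\<lambda>p. \<Sum>r\<in>UNIV. fibre_weight n \<xi> r * fs_ratio (phi_fibre n) r p) has_derivative E) (at p)"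
    "\<And>v. complex_of_real (E v) = pullback_form (phi_fibre n) fubini_study p v ?X"
    using fs_moment_pullback[of "phi_fibre n", OF phi_fibre_nonzero[OF p] D(2) equivariant_derivative[OF D(2) phi_torus_act(2)]] by blast
  have "((\<lambda>q. hirz_moment n (of_int a) (of_int b) q \<bullet> \<xi>) has_derivative (\<lambda>v. of_int a * B v + of_int b * E v)) (at p)"
    unfolding hirz_moment_inner by (intro has_derivative_add has_derivative_mult_right B(1) E(1))
  then have "((\<lambda>q. \<mu> (hirz_class n q) \<bullet> \<xi>) has_derivative (\<lambda>v. of_int a * B v + of_int b * E v)) (at p)"
    by (rule has_derivative_transform_within_open[OF _ open_hirz_cone p]) (simp add: \<mu>)
  moreover have "complex_of_real (of_int a * B v + of_int b * E v) = hirz_form n a b p v ?X" for v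
    unfolding hirz_form_def pullback_form_cp_form B(2)[symmetric] E(2)[symmetric] by simp
  ultimately show "\<exists>D. ((\<lambda>q. \<mu> (hirz_class n q) \<bullet> \<xi>) has_derivative D) (at p) \<and>
      (\<forall>v. complex_of_real (D v) = hirz_form n a b p v ?X)" by blast
qed

section \<open>Surjectivity onto the simplex\<close>

lemma linear_plus_power_le_imp_le:
  fixes x y :: real
  assumes "a \<ge> 0" "\<tau> > 0" "n \<ge> 1" "x \<ge> 0" "y \<ge> 0" "a * x + \<tau> * x ^ n \<le> a * y + \<tau> * y ^ n"
  shows "x \<le> y"
proof (rule ccontr)
  assume "\<not> x \<le> y"
  then have xy: "y < x" by simp
  then have "y ^ n < x ^ n" using assms by (intro power_strict_mono) auto
  then have "\<tau> * y ^ n < \<tau> * x ^ n" using assms by simp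
  moreover have "a * y \<le> a * x" using assms(1) xy by (intro mult_left_mono) auto
  ultimately show False using assms(6) by linarith
qed

lemma linear_plus_power_root:
  fixes y :: real
  assumes "a \<ge> 0" "\<tau> > 0" "n \<ge> 1" "y \<ge> 0"
  shows "\<exists>x\<ge>0. a * x + \<tau> * x ^ n = y"
proof -
  \<comment> \<open>M is at least 1, so \<open>M^n \<ge> M\<close>, and large enough for
    \<open>\<tau> * M \<ge> y\<close>.\<close>
  define M where "M = 1 + y / \<tau>"
  have M: "1 \<le> M" using assms by (simp add: M_def)
  have "y \<le> \<tau> * M" using assms by (simp add: M_def field_simps)
  also have "M \<le> M ^ n" using self_le_power[OF M] assms(3) by simp
  then have "\<tau> * M \<le> \<tau> * M ^ n" using assms(2) by simp
  also have "\<dots> \<le> a * M + \<tau> * M ^ n" using assms(1) M by simp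
  finally have hi: "y \<le> a * M + \<tau> * M ^ n" .
  have lo: "a * 0 + \<tau> * 0 ^ n \<le> y" using assms by (simp add: zero_power)
  have "\<exists>x. 0 \<le> x \<and> x \<le> M \<and> a * x + \<tau> * x ^ n = y"
  proof -
    have "continuous_on {0..M} (\<lambda>x. a * x + \<tau> * x ^ n)" by (intro continuous_intros)
    then show ?thesis using IVT'[of "\<lambda>x. a * x + \<tau> * x ^ n" 0 y M] lo hi M by simp
  qed
  then show ?thesis by blast
qed

text \<open>For \<open>s > 0\<close> let \<open>R \<tau> k\<close> be the root of \<open>a x + \<tau> x\<^sup>n = Y k\<close>. The sum of these roots
  depends continuously on \<open>\<tau>\<close>; where it is 1, summing the equations gives \<open>\<tau> = s / \<Sum>\<^sub>k (R \<tau> k)\<^sup>n\<close>.\<close>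

lemma simplex_map_surjective:
  fixes Y :: "'k::finite \<Rightarrow> real"
  assumes a: "a \<ge> 0" and s: "s \<ge> 0" and Y: "\<And>k. Y k \<ge> 0" and sumY: "(\<Sum>k\<in>UNIV. Y k) = a + s"
    and n: "s > 0 \<Longrightarrow> n \<ge> 1"
  obtains P where "\<And>k. P k \<ge> 0" "(\<Sum>k\<in>UNIV. P k) = 1"
    "\<And>k. a * P k + s * (P k ^ n / (\<Sum>j\<in>UNIV. P j ^ n)) = Y k"
proof -
  consider "s = 0" "a = 0" | "s = 0" "a > 0" | "s > 0" using a s by linarith
  then show thesis
  proof cases
    case 1
    then have "Y k = 0" for k using sumY Y sum_nonneg_eq_0_iff[of UNIV Y] by auto
    \<comment> \<open>All Y vanish and every distribution is a solution; the uniform one is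
      taken.\<close>
    then show thesis using 1 by (intro that[of "\<lambda>_. 1 / real CARD('k)"]) auto
  next
    case 2
    then show thesis using sumY Y
      by (intro that[of "\<lambda>k. Y k / a"]) (auto simp: sum_divide_distrib[symmetric])
  next
    case 3
    define K where "K = real CARD('k)"
    have K: "K \<ge> 1" by (simp add: K_def Suc_leI)
    have "\<exists>x\<ge>0. a * x + \<tau> * x ^ n = Y k" if "\<tau> > 0" for \<tau> k
      using linear_plus_power_root[OF a that n[OF 3] Y] .
    then obtain R where R: "\<And>\<tau> k. \<tau> > 0 \<Longrightarrow> R \<tau> k \<ge> 0" "\<And>\<tau> k. \<tau> > 0 \<Longrightarrow> a * R \<tau> k + \<tau> * R \<tau> k ^ n = Y k"
      by metis
    have R_anti: "R \<tau>' k \<le> R \<tau> k" if t: "0 < \<tau>" "\<tau> \<le> \<tau>'" for \<tau> \<tau>' k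
    proof -
      have \<tau>': "0 < \<tau>'" using t by linarith
      have "\<tau> * R \<tau> k ^ n \<le> \<tau>' * R \<tau> k ^ n" using t R(1) by (intro mult_right_mono) auto
      then have "a * R \<tau>' k + \<tau>' * R \<tau>' k ^ n \<le> a * R \<tau> k + \<tau>' * R \<tau> k ^ n"
        using R(2)[OF t(1), of k] R(2)[OF \<tau>', of k] by linarith
      then show ?thesis using linear_plus_power_le_imp_le[OF a \<tau>' n[OF 3]] R(1) t(1) \<tau>' by blast
    qed
    \<comment> \<open>The bound opposite to \<open>R_anti\<close>: with
      \<open>q = \<tau> / \<tau>'\<close> one has \<open>\<tau>' * q^n \<le> \<tau>\<close>, so at
      \<open>q * R \<tau> k\<close> the left side of the equation for \<open>\<tau>'\<close> is at
      most \<open>Y k\<close>.\<close>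
    have R_mono: "\<tau> / \<tau>' * R \<tau> k \<le> R \<tau>' k" if t: "0 < \<tau>" "\<tau> \<le> \<tau>'" for \<tau> \<tau>' k
    proof -
      have \<tau>': "0 < \<tau>'" using t by linarith
      define q where "q = \<tau> / \<tau>'"
      have q: "0 \<le> q" "q \<le> 1" "\<tau>' * q = \<tau>" using t by (auto simp: q_def)
      have "q ^ n \<le> q ^ 1" by (rule power_decreasing) (use n[OF 3] q in auto)
      then have "\<tau>' * q ^ n \<le> \<tau>" using \<tau>' q(3) by (metis less_imp_le mult_left_mono power_one_right)
      then have "\<tau>' * (q * R \<tau> k) ^ n \<le> \<tau> * R \<tau> k ^ n"
        using R(1)[OF t(1), of k] by (simp add: power_mult_distrib mult.assoc[symmetric] mult_right_mono)
      moreover have "a * (q * R \<tau> k) \<le> a * R \<tau> k"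
        using a q R(1)[OF t(1), of k] by (intro mult_left_mono mult_left_le_one_le) auto
      ultimately have "a * (q * R \<tau> k) + \<tau>' * (q * R \<tau> k) ^ n \<le> a * R \<tau>' k + \<tau>' * R \<tau>' k ^ n"
        using R(2)[OF t(1), of k] R(2)[OF \<tau>', of k] by linarith
      moreover have "0 \<le> q * R \<tau> k" using q R(1)[OF t(1)] by simp
      ultimately have "q * R \<tau> k \<le> R \<tau>' k"
        using linear_plus_power_le_imp_le[OF a \<tau>' n[OF 3]] R(1)[OF \<tau>'] by blast
      then show ?thesis by (simp add: q_def)
    qed
    \<comment> \<open>The two monotonicity bounds enclose \<open>R \<tau>' k\<close>, which yields a
      Lipschitz constant and thereby continuity.\<close>
    have R_lip: "\<bar>R \<tau> k - R \<tau>' k\<bar> \<le> R s k / s * \<bar>\<tau> - \<tau>'\<bar>" if t: "s \<le> \<tau>" "\<tau> \<le> \<tau>'" for \<tau> \<tau>' k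
    proof -
      have pos: "0 < \<tau>" "0 < \<tau>'" using t 3 by linarith+
      have "\<bar>R \<tau> k - R \<tau>' k\<bar> \<le> R \<tau> k - \<tau> / \<tau>' * R \<tau> k"
        using R_anti[OF pos(1) t(2), of k] R_mono[OF pos(1) t(2), of k] by linarith
      also have "\<dots> = R \<tau> k * ((\<tau>' - \<tau>) / \<tau>')" using pos by (simp add: field_simps)
      also have "\<dots> \<le> R s k * ((\<tau>' - \<tau>) / s)"
        using R_anti[OF 3 t(1), of k] R(1)[OF 3, of k] t 3 by (intro mult_mono divide_left_mono) auto
      finally show ?thesis using t by simp
    qed
    have cont: "continuous_on {s..u} (\<lambda>\<tau>. \<Sum>k\<in>UNIV. R \<tau> k)" for u
    proof (rule continuous_on_sum)
      fix k
      have "dist (R \<tau> k) (R \<tau>' k) \<le> R s k / s * dist \<tau> \<tau>'" if t: "\<tau> \<in> {s..u}" "\<tau>' \<in> {s..u}" for \<tau> \<tau>'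
      proof (cases "\<tau> \<le> \<tau>'")
        case True
        then show ?thesis using R_lip[of \<tau> \<tau>' k] t by (simp add: dist_real_def)
      next
        case False
        then show ?thesis using R_lip[of \<tau>' \<tau> k] t by (simp add: dist_real_def abs_minus_commute)
      qed
      then have "(R s k / s)-lipschitz_on {s..u} (\<lambda>\<tau>. R \<tau> k)"
        by (intro lipschitz_onI) (use R(1)[OF 3] 3 in auto)
      then show "continuous_on {s..u} (\<lambda>\<tau>. R \<tau> k)" by (rule lipschitz_on_continuous_on)
    qed
    have sumR: "a * (\<Sum>k\<in>UNIV. R \<tau> k) + \<tau> * (\<Sum>k\<in>UNIV. R \<tau> k ^ n) = a + s" if "\<tau> > 0" for \<tau>
      using R(2)[OF that] by (simp add: sumY[symmetric] sum_distrib_left sum.distrib[symmetric])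
    \<comment> \<open>The upper end for the intermediate value theorem: a sum of roots above 1 has a
      root above 1/K, and then \<open>u * \<Sum>R^n\<close> exceeds s, against \<open>sumR\<close>.
      At the lower end s a sum below 1 would leave the left side of \<open>sumR\<close> below a +
      s.\<close>
    define u where "u = s * K ^ n"
    have su: "s \<le> u" using 3 K by (simp add: u_def)
    have lo: "1 \<le> (\<Sum>k\<in>UNIV. R s k)"
    proof (rule ccontr)
      assume "\<not> 1 \<le> (\<Sum>k\<in>UNIV. R s k)"
      then have lt: "(\<Sum>k\<in>UNIV. R s k) < 1" by simp
      have "R s k ^ n \<le> R s k" for k
      proof -
        have "R s k \<le> 1" using member_le_sum[of k UNIV "R s"] R(1)[OF 3] lt by force
        then have "R s k ^ n \<le> R s k ^ 1" by (intro power_decreasing) (use n[OF 3] R(1)[OF 3] in auto)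
        then show ?thesis by simp
      qed
      then have "(\<Sum>k\<in>UNIV. R s k ^ n) \<le> (\<Sum>k\<in>UNIV. R s k)" by (intro sum_mono)
      then have "(\<Sum>k\<in>UNIV. R s k ^ n) < 1" using lt by linarith
      then have "s * (\<Sum>k\<in>UNIV. R s k ^ n) < s * 1" using 3 by (intro mult_strict_left_mono)
      moreover have "a * (\<Sum>k\<in>UNIV. R s k) \<le> a * 1" using a lt by (intro mult_left_mono) auto
      ultimately show False using sumR[OF 3] by linarith
    qed
    have hi: "(\<Sum>k\<in>UNIV. R u k) \<le> 1"
    proof (rule ccontr)
      assume "\<not> (\<Sum>k\<in>UNIV. R u k) \<le> 1"
      then have gt: "(\<Sum>k\<in>UNIV. R u k) > 1" by simp
      have u0: "u > 0" using su 3 by linarith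
      have "\<exists>k. R u k > 1 / K"
      proof (rule ccontr)
        assume "\<nexists>k. R u k > 1 / K"
        then have "(\<Sum>k\<in>UNIV. R u k) \<le> (\<Sum>k\<in>(UNIV :: 'k set). 1 / K)" by (intro sum_mono) (auto simp: not_less)
        then show False using gt K by (simp add: K_def)
      qed
      then obtain k where k: "R u k > 1 / K" by blast
      have "(1 / K) ^ n < R u k ^ n" using k K n[OF 3] by (intro power_strict_mono) auto
      also have "\<dots> \<le> (\<Sum>k\<in>UNIV. R u k ^ n)" using R(1)[OF u0] by (intro member_le_sum) auto
      finally have "u * (1 / K) ^ n < u * (\<Sum>k\<in>UNIV. R u k ^ n)" using u0 by simp
      then have "s < u * (\<Sum>k\<in>UNIV. R u k ^ n)" using K by (simp add: u_def power_divide)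
      moreover have "a * 1 \<le> a * (\<Sum>k\<in>UNIV. R u k)" using a gt by (intro mult_left_mono) auto
      ultimately show False using sumR[OF u0] by linarith
    qed
    obtain \<tau> where \<tau>: "s \<le> \<tau>" "(\<Sum>k\<in>UNIV. R \<tau> k) = 1"
      using IVT2'[of "\<lambda>\<tau>. \<Sum>k\<in>UNIV. R \<tau> k" u 1 s] hi lo su cont by blast
    have \<tau>0: "\<tau> > 0" using \<tau> 3 by linarith
    have t: "\<tau> * (\<Sum>k\<in>UNIV. R \<tau> k ^ n) = s" using sumR[OF \<tau>0] \<tau>(2) by simp
    then have "s * (R \<tau> k ^ n / (\<Sum>j\<in>UNIV. R \<tau> j ^ n)) = \<tau> * R \<tau> k ^ n" for k
      using 3 by (auto simp: field_simps)
    then show thesis using \<tau>(2) R[OF \<tau>0] by (intro that[of "R \<tau>"]) auto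
  qed
qed

section \<open>The image of the moment map\<close>

lemma sum_fs_ratio: "F p \<noteq> 0 \<Longrightarrow> (\<Sum>r\<in>UNIV. fs_ratio F r p) = 1"
  using sum_norm_sq_pos[of "F p"] by (simp add: fs_ratio_def sum_distrib_right[symmetric])

lemma fs_ratio_nonneg: "fs_ratio F r p \<ge> 0"
  by (simp add: fs_ratio_def sum_nonneg)

text \<open>For surjectivity the height \<open>y $ Inr ()\<close> fixes the fibre distribution
  between z_0 and the rest; with this split the first d components form the simplex map with
  \<open>s = n (b - t)\<close>.\<close>

lemma hirz_moment_image:
  fixes a b :: real
  assumes a: "a \<ge> 0" and b: "b \<ge> 0"
  shows "hirz_moment n a b ` (hirz_cone :: (complex^('d::finite option + 2)) set) =
    {x. (\<forall>i. x $ i \<ge> 0) \<and> (\<Sum>i\<in>UNIV. x $ Inl i) \<le> a + real n * (b - x $ Inr ()) \<and> x $ Inr () \<le> b}"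
proof (intro equalityI subsetI)
  fix x assume "x \<in> hirz_moment n a b ` (hirz_cone :: (complex^('d option + 2)) set)"
  then obtain p :: "complex^('d option + 2)" where p: "p \<in> hirz_cone" "x = hirz_moment n a b p" by blast
  note one = sum_fs_ratio[of phi_base, OF phi_base_nonzero[OF p(1)]]
    sum_fs_ratio[of "phi_fibre n", OF phi_fibre_nonzero[OF p(1)]]
  have le: "(\<Sum>k\<in>UNIV. fs_ratio phi_base (Some k) p) \<le> 1"
    "(\<Sum>k\<in>UNIV. fs_ratio (phi_fibre n) (Some (Some k)) p) \<le> 1 - fs_ratio (phi_fibre n) None p"
    using one fs_ratio_nonneg[of phi_base None p] fs_ratio_nonneg[of "phi_fibre n" "Some None" p]
    unfolding sum_option by linarith+
  have "x $ i \<ge> 0" for i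
    unfolding p(2) using a b by (cases i) (auto simp: hirz_moment_def fs_ratio_nonneg)
  moreover have "(\<Sum>i\<in>UNIV. x $ Inl i) = a * (\<Sum>k\<in>UNIV. fs_ratio phi_base (Some k) p) +
      b * (n * (\<Sum>k\<in>UNIV. fs_ratio (phi_fibre n) (Some (Some k)) p))"
    unfolding p(2) by (simp add: hirz_moment_def sum.distrib sum_distrib_left)
  moreover have "\<dots> \<le> a * 1 + b * (n * (1 - fs_ratio (phi_fibre n) None p))"
    using a b le by (intro add_mono mult_left_mono) auto
  moreover have "x $ Inr () = b * fs_ratio (phi_fibre n) None p" unfolding p(2) by (simp add: hirz_moment_def)
  moreover have "fs_ratio (phi_fibre n) None p \<le> 1"
    using le(2) sum_nonneg[of UNIV "\<lambda>k. fs_ratio (phi_fibre n) (Some (Some k)) p"] fs_ratio_nonneg by fastforce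
  then have "b * fs_ratio (phi_fibre n) None p \<le> b" using b by (simp add: mult_left_le)
  ultimately show "x \<in> {x. (\<forall>i. x $ i \<ge> 0) \<and> (\<Sum>i\<in>UNIV. x $ Inl i) \<le> a + real n * (b - x $ Inr ()) \<and> x $ Inr () \<le> b}"
    by (simp add: algebra_simps)
next
  fix y :: "real^('d + unit)"
  assume "y \<in> {x. (\<forall>i. x $ i \<ge> 0) \<and> (\<Sum>i\<in>UNIV. x $ Inl i) \<le> a + real n * (b - x $ Inr ()) \<and> x $ Inr () \<le> b}"
  then have y: "\<And>i. y $ i \<ge> 0" "(\<Sum>i\<in>UNIV. y $ Inl i) \<le> a + real n * (b - y $ Inr ())" "y $ Inr () \<le> b" by auto
  define t where "t = y $ Inr ()"
  have t: "0 \<le> t" "t \<le> b" using y by (auto simp: t_def)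
  \<comment> \<open>The component at \<open>None\<close> is the slack of the inequality, so that Y
    has the sum required by \<open>simplex_map_surjective\<close>.\<close>
  define Y where "Y r = (case r of None \<Rightarrow> a + real n * (b - t) - (\<Sum>i\<in>UNIV. y $ Inl i) | Some k \<Rightarrow> y $ Inl k)" for r
  obtain P :: "'d option \<Rightarrow> real" where P: "\<And>k. P k \<ge> 0" "(\<Sum>k\<in>UNIV. P k) = 1"
    "\<And>k. a * P k + (real n * (b - t)) * (P k ^ n / (\<Sum>j\<in>UNIV. P j ^ n)) = Y k"
  proof (rule simplex_map_surjective[of a "real n * (b - t)" Y n])
    show "Y k \<ge> 0" for k using y by (auto simp: Y_def t_def split: option.splits)
    show "(\<Sum>k\<in>UNIV. Y k) = a + real n * (b - t)" by (simp add: sum_option Y_def)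
    show "1 \<le> n" if "0 < real n * (b - t)" using that by (cases n) auto
  qed (use a t in auto)
  define T where "T = (\<Sum>j\<in>UNIV. P j ^ n)"
  obtain k0 where k0: "P k0 > 0"
    using P(1,2) by (metis less_eq_real_def sum.neutral zero_neq_one)
  have T: "T > 0" unfolding T_def using k0 P(1) by (intro sum_pos2[of _ k0]) auto
  \<comment> \<open>z0 and z1 are the squared moduli of the fibre coordinates, scaled so that
    \<open>phi_fibre\<close> has squared norm b. For b = 0 that would be the excluded point 0, so z0
    is 1.\<close>
  define z0 where "z0 = (if b = 0 then 1 else t)"
  define z1 where "z1 = (b - t) / T"
  have z: "z0 \<ge> 0" "z1 \<ge> 0" "z0 + z1 * T = (if b = 0 then 1 else b)"
    using t T by (auto simp: z0_def z1_def)
  define p :: "complex^('d option + 2)" where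
    "p = (\<chi> i. case i of Inl k \<Rightarrow> of_real (sqrt (P k)) | Inr j \<Rightarrow> of_real (sqrt (if j = 0 then z0 else z1)))"
  have p_simps: "p $ Inl k = of_real (sqrt (P k))" "p $ Inr 0 = of_real (sqrt z0)" "p $ Inr 1 = of_real (sqrt z1)" for k
    by (simp_all add: p_def)
  have base: "(cmod (phi_base p $ k))\<^sup>2 = P k" for k
    using P(1) by (simp add: phi_base_def p_simps)
  have fib: "(cmod (phi_fibre n p $ None))\<^sup>2 = z0" "(cmod (phi_fibre n p $ Some k))\<^sup>2 = z1 * P k ^ n" for k
  proof -
    show "(cmod (phi_fibre n p $ None))\<^sup>2 = z0" using z by (simp add: phi_fibre_simps p_simps)
    have "(cmod (phi_fibre n p $ Some k))\<^sup>2 = (sqrt z1 * sqrt (P k) ^ n)\<^sup>2"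
      using z P(1) by (simp add: phi_fibre_simps p_simps norm_mult norm_power)
    also have "\<dots> = (sqrt z1)\<^sup>2 * ((sqrt (P k))\<^sup>2) ^ n"
      by (simp only: power_mult_distrib power_mult[symmetric] mult.commute)
    finally show "(cmod (phi_fibre n p $ Some k))\<^sup>2 = z1 * P k ^ n" using z P(1) by simp
  qed
  have fib_sum: "(\<Sum>r\<in>UNIV. (cmod (phi_fibre n p $ r))\<^sup>2) = (if b = 0 then 1 else b)"
    unfolding sum_option[of "\<lambda>r. (cmod (phi_fibre n p $ r))\<^sup>2"] fib sum_distrib_left[symmetric] T_def[symmetric] z(3) ..
  have "hirz_moment n a b p $ i = y $ i" for i
  proof (cases i)
    case (Inl k)
    have "hirz_moment n a b p $ i = a * P (Some k) + real n * (b - t) * (P (Some k) ^ n / T)"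
      unfolding Inl using t T by (cases "b = 0")
        (auto simp: hirz_moment_def fs_ratio_def base P(2) fib fib_sum z1_def field_simps)
    then show ?thesis using P(3)[of "Some k"] by (simp add: T_def Y_def Inl)
  next
    case (Inr j)
    then show ?thesis using t
      by (simp add: hirz_moment_def fs_ratio_def fib fib_sum z0_def t_def)
  qed
  then have "hirz_moment n a b p = y" by (simp add: vec_eq_iff)
  moreover have "p \<in> hirz_cone"
  proof -
    have "p $ Inl k0 \<noteq> 0" using k0 by (simp add: p_simps)
    moreover have "p $ Inr 0 \<noteq> 0 \<or> p $ Inr 1 \<noteq> 0"
      using z(3) T b by (auto simp: p_simps split: if_splits)
    ultimately show ?thesis unfolding hirz_cone_def by blast
  qed
  ultimately show "y \<in> hirz_moment n a b ` (hirz_cone :: (complex^('d option + 2)) set)" by blast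
qed

lemma is_moment_polytope_hirz:
  assumes "a \<ge> 0" "b \<ge> 0"
  shows "is_moment_polytope (hirz_cone :: (complex^('d::finite option + 2)) set) (hirz_class n)
    hirz_torus_act (hirz_form n a b) (hirz_polytope n a b)"
proof -
  define \<mu> where "\<mu> P = hirz_moment n (of_int a) (of_int b) (class_rep hirz_cone (hirz_class n) P)"
    for P :: "(complex^('d option + 2)) set"
  have \<mu>: "\<mu> (hirz_class n q) = hirz_moment n (of_int a) (of_int b) q" if "q \<in> hirz_cone" for q
    unfolding \<mu>_def using class_rep[of "hirz_class n q" "hirz_class n" hirz_cone] that
    by (intro hirz_moment_class) auto
  have "\<mu> ` (hirz_class n ` hirz_cone) = hirz_moment n (of_int a) (of_int b) ` hirz_cone"
    unfolding image_image by (rule image_cong) (auto simp: \<mu>)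
  also have "\<dots> = hirz_polytope n a b"
    using hirz_moment_image[of "of_int a" "of_int b" n, where 'd='d] assms by (simp add: hirz_polytope_def)
  finally show ?thesis unfolding is_moment_polytope_def using is_moment_map_hirz[OF \<mu>] by blast
qed

section \<open>Counting\<close>

text \<open>An enumeration of the index type identifies exponents with lists of fixed length and
  sum, which stars and bars counts.\<close>

lemma card_exponents:
  "card {\<beta> :: 'm::finite \<Rightarrow> nat. (\<Sum>i\<in>UNIV. \<beta> i) = N} = (N + CARD('m) - 1) choose N"
proof -
  obtain xs :: "'m list" where xs: "set xs = UNIV" "distinct xs" using finite_distinct_list[OF finite] by blast
  have len: "length xs = CARD('m)" using xs distinct_card by fastforce
  have "bij_betw (\<lambda>\<beta>. map \<beta> xs) {\<beta>. (\<Sum>i\<in>UNIV. \<beta> i) = N} {l :: nat list. size l = CARD('m) \<and> sum_list l = N}"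
  proof (rule bij_betw_imageI)
    show "inj_on (\<lambda>\<beta>. map \<beta> xs) {\<beta>. (\<Sum>i\<in>UNIV. \<beta> i) = N}"
      by (rule inj_onI) (auto simp: xs)
    have sum: "sum_list (map \<beta> xs) = (\<Sum>i\<in>UNIV. \<beta> i)" for \<beta> :: "'m \<Rightarrow> nat"
      using sum_list_distinct_conv_sum_set[OF xs(2), of \<beta>] xs(1) by simp
    have "l \<in> (\<lambda>\<beta>. map \<beta> xs) ` {\<beta>. (\<Sum>i\<in>UNIV. \<beta> i) = N}" if l: "length l = CARD('m)" "sum_list l = N" for l
    proof -
      define \<beta> where "\<beta> i = the (map_of (zip xs l) i)" for i
      have "map \<beta> xs = l"
        using l(1) len xs(2) by (intro nth_equalityI) (auto simp: \<beta>_def map_of_zip_nth)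
      moreover from this have "(\<Sum>i\<in>UNIV. \<beta> i) = N" using sum[of \<beta>] l(2) by simp
      ultimately show ?thesis by blast
    qed
    then show "(\<lambda>\<beta>. map \<beta> xs) ` {\<beta>. (\<Sum>i\<in>UNIV. \<beta> i) = N} = {l. size l = CARD('m) \<and> sum_list l = N}"
      by (auto simp: len sum)
  qed
  from bij_betw_same_card[OF this] show ?thesis by (simp only: card_length_sum_list)
qed

lemma card_exponents_option:
  "card {\<beta> :: 'd::finite option \<Rightarrow> nat. (\<Sum>i\<in>UNIV. \<beta> i) = N} = (N + CARD('d)) choose CARD('d)"
  using card_exponents[of N, where 'm="'d option"] binomial_symmetric[of "CARD('d)" "N + CARD('d)"]
  by (simp add: card_option)

text \<open>In the slice at height t the slack of the remaining inequality is recorded as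
  \<open>\<alpha> None\<close>, which turns lattice points into exponents of degree
  \<open>A + n * (B - t)\<close>.\<close>

lemma card_polytope_points:
  "card (hirz_polytope n (int A) (int B) \<inter> integer_points :: (real^('d::finite + unit)) set) =
     (\<Sum>t\<le>B. (A + n * (B - t) + CARD('d)) choose CARD('d))"
proof -
  let ?S = "SIGMA t:{..B}. {\<alpha> :: 'd option \<Rightarrow> nat. (\<Sum>i\<in>UNIV. \<alpha> i) = A + n * (B - t)}"
  define v :: "nat \<times> ('d option \<Rightarrow> nat) \<Rightarrow> real^('d + unit)" where
    "v x = (\<chi> c. case c of Inl k \<Rightarrow> real (snd x (Some k)) | Inr _ \<Rightarrow> real (fst x))" for x
  have v_simps: "v x $ Inl k = real (snd x (Some k))" "v x $ Inr () = real (fst x)" for x k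
    by (simp_all add: v_def)
  have "bij_betw v ?S (hirz_polytope n (int A) (int B) \<inter> integer_points)"
  proof (rule bij_betw_imageI)
    show "inj_on v ?S"
    proof (rule inj_onI)
      fix x y assume x: "x \<in> ?S" and y: "y \<in> ?S" and e: "v x = v y"
      have t: "fst x = fst y" using arg_cong[OF e, of "\<lambda>w. w $ Inr ()"] by (simp add: v_simps)
      have k: "snd x (Some k) = snd y (Some k)" for k
        using arg_cong[OF e, of "\<lambda>w. w $ Inl k"] by (simp add: v_simps)
      have "snd x None + (\<Sum>k\<in>UNIV. snd x (Some k)) = snd y None + (\<Sum>k\<in>UNIV. snd y (Some k))"
        using x y t by (auto simp: sum_option)
      then have "snd x None = snd y None" using k by simp
      then have "snd x i = snd y i" for i using k by (cases i) auto
      then show "x = y" using t by (simp add: prod_eq_iff fun_eq_iff)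
    qed
    show "v ` ?S = hirz_polytope n (int A) (int B) \<inter> integer_points"
    proof (intro equalityI subsetI)
      fix w :: "real^('d + unit)" assume "w \<in> v ` ?S"
      then obtain t \<alpha> where w: "w = v (t, \<alpha>)" "t \<le> B" "(\<Sum>i\<in>UNIV. \<alpha> i) = A + n * (B - t)" by auto
      have "w $ i \<in> \<int> \<and> w $ i \<ge> 0" for i unfolding w(1) by (cases i) (auto simp: v_def)
      moreover have "(\<Sum>i\<in>UNIV. w $ Inl i) \<le> real A + real n * (real B - real t)"
      proof -
        have "(\<Sum>k\<in>UNIV. \<alpha> (Some k)) \<le> A + n * (B - t)" using w(3) by (simp add: sum_option)
        then have "real (\<Sum>k\<in>UNIV. \<alpha> (Some k)) \<le> real (A + n * (B - t))" by (rule of_nat_mono)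
        then show ?thesis using w(2) by (simp add: w(1) v_simps of_nat_diff)
      qed
      ultimately show "w \<in> hirz_polytope n (int A) (int B) \<inter> integer_points"
        using w(2) by (auto simp: hirz_polytope_def integer_points_def w(1) v_simps)
    next
      fix w :: "real^('d + unit)" assume "w \<in> hirz_polytope n (int A) (int B) \<inter> integer_points"
      then have w: "\<And>i. w $ i \<ge> 0" "\<And>i. w $ i \<in> \<int>" "w $ Inr () \<le> real B"
        "(\<Sum>i\<in>UNIV. w $ Inl i) \<le> real A + real n * (real B - w $ Inr ())"
        by (auto simp: hirz_polytope_def integer_points_def)
      have "\<exists>m. w $ i = real m" for i
        using w(1,2)[of i] by (metis Ints_cases of_int_0_le_iff of_nat_nat of_int_of_nat_eq)
      then obtain m where m: "\<And>i. w $ i = real (m i)" by metis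
      define t where "t = m (Inr ())"
      have t: "t \<le> B" using w(3) by (simp add: m t_def)
      have "real (\<Sum>i\<in>UNIV. m (Inl i)) \<le> real (A + n * (B - t))"
        using w(4) t by (simp add: m t_def of_nat_diff)
      then have le: "(\<Sum>i\<in>UNIV. m (Inl i)) \<le> A + n * (B - t)" by (simp only: of_nat_le_iff)
      define \<alpha> where "\<alpha> r = (case r of None \<Rightarrow> A + n * (B - t) - (\<Sum>i\<in>UNIV. m (Inl i)) | Some k \<Rightarrow> m (Inl k))"
        for r :: "'d option"
      have "(t, \<alpha>) \<in> ?S" using t le by (simp add: sum_option \<alpha>_def)
      moreover have "w = v (t, \<alpha>)"
      proof -
        have "w $ i = v (t, \<alpha>) $ i" for i by (cases i) (simp_all add: v_def m t_def \<alpha>_def)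
        then show ?thesis by (simp add: vec_eq_iff)
      qed
      ultimately show "w \<in> v ` ?S" by blast
    qed
  qed
  then have "card (hirz_polytope n (int A) (int B) \<inter> integer_points :: (real^('d + unit)) set) = card ?S"
    by (simp add: bij_betw_same_card)
  also have "\<dots> = (\<Sum>t\<le>B. card {\<alpha> :: 'd option \<Rightarrow> nat. (\<Sum>i\<in>UNIV. \<alpha> i) = A + n * (B - t)})"
    by (rule card_SigmaI) (auto intro: finite_exponents)
  finally show ?thesis by (simp add: card_exponents_option)
qed

lemma sum_int_eq_sum_nat: "(\<Sum>i = 0..int B. f i) = (\<Sum>j\<le>B. f (int j))"
  by (rule sum.reindex_bij_witness[where i=int and j=nat]) auto

lemma ichoose_of_nat: "ichoose (int m) k = m choose k"
  by (simp add: ichoose_def)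

theorem mainTheorem1:
  fixes n d :: nat and a b :: int
  assumes "CARD('d::finite) = d" and "a \<ge> 0" and "b \<ge> 0"
  shows "\<exists>(\<Delta> :: (real^('d + unit)) set) Q Q0.
      \<Delta> = hirz_polytope n a b \<and>
      is_moment_polytope (hirz_cone :: (complex^('d option + 2)) set) (hirz_class n)
        hirz_torus_act (hirz_form n a b) \<Delta> \<and>
      has_quantization_dim (hirz_cone :: (complex^('d option + 2)) set) (hirz_class n)
        (hirz_chart n) (hirz_form n a b) Q \<and>
      has_quantization_dim (cp_cone :: (complex^('d option)) set) cp_class cp_chart
        (cp_form a) Q0 \<and>
      Q = card (\<Delta> \<inter> integer_points) \<and>
      Q = (\<Sum>t = 0..b. ichoose (a + int n * (b - t) + int d) d) \<and>
      Q = (\<Sum>i = 0..b. ichoose (a + int d + int n * i) d) \<and>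
      Q = Q0 + (\<Sum>i = 1..b. ichoose (a + int d + int n * i) d) \<and>
      Q0 = ichoose (a + int d) d"
proof -
  define A where "A = nat a"
  define B where "B = nat b"
  have ab: "a = int A" "b = int B" using assms by (auto simp: A_def B_def)
  define Q where "Q = (\<Sum>j\<le>B. (A + n * j + d) choose d)"
  have Q: "card (hirz_exponents n A B :: ('d option + 2 \<Rightarrow> nat) set) = Q"
    unfolding card_hirz_exponents card_exponents_option Q_def assms(1) ..
  have Q0: "card {\<beta> :: 'd option \<Rightarrow> nat. (\<Sum>i\<in>UNIV. \<beta> i) = A} = (A + d) choose d"
    unfolding card_exponents_option assms(1) ..
  \<comment> \<open>Height t in the polytope corresponds to exponent t of z_0, hence to exponent
    \<open>B - t\<close> of z_1, the index of the sum Q.\<close>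
  have Q_rev: "(\<Sum>t\<le>B. (A + n * (B - t) + d) choose d) = Q"
    unfolding Q_def by (rule sum.reindex_bij_witness[where i="\<lambda>t. B - t" and j="\<lambda>t. B - t"]) auto
  have Q1: "(\<Sum>i = 0..b. ichoose (a + int d + int n * i) d) = Q"
  proof -
    have "int A + int d + int n * int j = int (A + n * j + d)" for j by simp
    then show ?thesis unfolding ab sum_int_eq_sum_nat Q_def by (simp only: ichoose_of_nat)
  qed
  have Q2: "(\<Sum>t = 0..b. ichoose (a + int n * (b - t) + int d) d) = Q"
  proof -
    have "int A + int n * (int B - int t) + int d = int (A + n * (B - t) + d)" if "t \<le> B" for t
      using that by (simp add: of_nat_diff)
    then show ?thesis unfolding ab sum_int_eq_sum_nat Q_rev[symmetric]
      by (intro sum.cong refl) (simp only: atMost_iff ichoose_of_nat)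
  qed
  have c0: "ichoose (a + int d) d = (A + d) choose d"
    using ichoose_of_nat[of "A + d" d] by (simp add: ab)
  \<comment> \<open>The term for i = 0, where z_1 does not occur, is the contribution of the
    base.\<close>
  have "{0..b} = insert 0 {1..b}" using assms(3) by auto
  then have Q3: "Q = ((A + d) choose d) + (\<Sum>i = 1..b. ichoose (a + int d + int n * i) d)"
    using Q1[symmetric] by (simp add: c0)
  have "is_moment_polytope (hirz_cone :: (complex^('d option + 2)) set) (hirz_class n)
      hirz_torus_act (hirz_form n a b) (hirz_polytope n a b)"
    by (rule is_moment_polytope_hirz[OF assms(2,3)])
  moreover have "has_quantization_dim (hirz_cone :: (complex^('d option + 2)) set) (hirz_class n)
      (hirz_chart n) (hirz_form n a b) Q"
    using has_quantization_dim_hirz[of n A B, where 'd='d] unfolding Q ab .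
  moreover have "has_quantization_dim (cp_cone :: (complex^('d option)) set) cp_class cp_chart
      (cp_form a) ((A + d) choose d)"
    using has_quantization_dim_cp[of A, where 'm="'d option"] unfolding Q0 ab .
  moreover have "Q = card (hirz_polytope n a b \<inter> integer_points :: (real^('d + unit)) set)"
    unfolding ab card_polytope_points assms(1) Q_rev ..
  ultimately show ?thesis
    using Q1 Q2 Q3 c0
    by (intro exI[of _ "hirz_polytope n a b"] exI[of _ Q] exI[of _ "(A + d) choose d"]) auto
qed

end
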